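(* Let $(M,\circ,e)$ be an F-manifold with an Euler vector field $E$ and a torsionless connection $\nabla$ on $\mathcal{T}_M$ (not assumed to be flat) such that $\nabla e=0$ and such that the endomorphism $\nabla E:\mathcal{T}_M\to\mathcal{T}_M$, $X\mapsto\nabla_XE$, is non-degenerate. Assume $E\circ$ is invertible on an open dense subset $U$ of $M$. On $U$ define a new product $X*Y=(E\circ)^{-1}(X\circ Y)$ and a new connection $$\nabla^*_XY=\nabla_XY-\nabla_{X*Y}E .$$ For each constant $\lambda$ put $L=E\circ$, $L_\lambda=L-\lambda I$, and let $$\nabla^{GM}_XY=\nabla^*_XY+\lambda\left(\nabla^*_{L_{\lambda}^{-1}X}Y-\nabla_{L_{\lambda}^{-1}X}Y\right)$$ be the associated family of Gauss-Manin connections, defined on the open subset of $U$ where $L_\lambda$ is invertible. Then $\nabla^{GM}$ is flat and torsionless (for all $\lambda$) if and only if the data $(M,\circ,e,\nabla,*,E,\nabla^* )$ define a bi-flat F-structure.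
   Context: Conventions: $M$ is a smooth, real analytic or complex manifold, $\mathcal{T}_M$ its tangent sheaf, $\mathcal{O}_M$ its structure sheaf; in the complex case everything is holomorphic. $X,Y,Z,W$ denote arbitrary local sections of $\mathcal{T}_M$; $\lambda$ is a constant (real or complex accordingly). F-manifold $(M,\circ,e)$: $\circ$ is an $\mathcal{O}_M$-bilinear commutative associative product on $\mathcal{T}_M$ with unit a global vector field $e$ ($e\circ X=X$), satisfying $[X\circ Y,W\circ Z]-[X\circ Y,Z]\circ W-[X\circ Y,W]\circ Z-X\circ[Y,Z\circ W]+X\circ[Y,Z]\circ W+X\circ[Y,W]\circ Z-Y\circ[X,Z\circ W]+Y\circ[X,Z]\circ W+Y\circ[X,W]\circ Z=0$. Flat F-manifold $(M,\nabla,\circ,e)$: an F-manifold with a connection $\nabla$ on $\mathcal{T}_M$ such that for every constant $\lambda$ the connection $(X,Y)\mapsto \nabla_XY-\lambda X\circ Y$ is flat and torsionless, and $\nabla e=0$. Euler vector field of an F-manifold: a global vector field $E$ with $[e,E]=e$ and $\mathcal{L}_E\circ=\circ$, i.e. $[E,X\circ Y]-[E,X]\circ Y-X\circ[E,Y]=X\circ Y$. Bi-flat F-structure $(\nabla,\circ,e,\nabla^*,*,E)$ on $M$: (i) $(\nabla,\circ,e)$ is a flat F-structure on $M$; (ii) $E$ is an Euler vector field for $(M,\circ,e)$ and the operator $E\circ$ is invertible at generic points, i.e. on an open dense subset $U$; (iii) on $U$, $X*Y=(E\circ)^{-1}(X\circ Y)$; (iv) $(\nabla^*,*,E)$ is a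 flat F-structure on $U$ (with unit $E$, so $\nabla^*E=0$); (v) $(d_\nabla-d_{\nabla^*})(X\circ)=0$ for all local $X$, i.e. $\nabla_Y(X\circ Z)-\nabla_Z(X\circ Y)=\nabla^*_Y(X\circ Z)-\nabla^*_Z(X\circ Y)$. *)

theory Defs
  imports "HOL-Analysis.Analysis" "HOL-Library.Function_Algebras"
begin

text \<open>
  The scalars form a type \<open>'k\<close> of class \<open>{real_normed_field, banach}\<close>; up to isomorphism the only
  such fields are the reals and the complex numbers.  The three kinds of manifold are:
  smooth (\<open>'k = real\<close>, \<open>Smooth\<close>), real analytic (\<open>'k = real\<close>, \<open>Analytic\<close>) and complex
  (\<open>'k = complex\<close>, \<open>Analytic\<close>: holomorphic functions of several variables as local sums of power
  series).  For \<open>'k = complex\<close> the partial derivatives below are complex ones, so that \<open>Smooth\<close>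
  describes the holomorphic functions as well.
\<close>

datatype regularity = Smooth | Analytic

definition partial :: "'n::finite \<Rightarrow> (('k::real_normed_field)^'n \<Rightarrow> 'k) \<Rightarrow> 'k^'n \<Rightarrow> 'k" where
  "partial i f x = deriv (\<lambda>t. f (x + axis i t)) 0"

primrec cont_diff :: "nat \<Rightarrow> (('k::real_normed_field)^'n::finite) set \<Rightarrow> ('k^'n \<Rightarrow> 'k) \<Rightarrow> bool" where
  "cont_diff 0 S f \<longleftrightarrow> continuous_on S f"
| "cont_diff (Suc r) S f \<longleftrightarrow> continuous_on S f \<and>
     (\<forall>i. (\<forall>x\<in>S. (\<lambda>t. f (x + axis i t)) field_differentiable at 0) \<and> cont_diff r S (partial i f))"

text \<open>Power series in several variables are indexed by multi-indices \<open>\<alpha> :: 'n \<Rightarrow> nat\<close>.\<close>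

definition power_series_on :: "(('k::real_normed_field)^'n::finite) set \<Rightarrow> ('k^'n \<Rightarrow> 'k) \<Rightarrow> bool" where
  "power_series_on S f \<longleftrightarrow> (\<forall>p\<in>S. \<exists>c :: ('n \<Rightarrow> nat) \<Rightarrow> 'k. \<exists>r>0. \<forall>x \<in> S \<inter> ball p r.
     ((\<lambda>\<alpha>. c \<alpha> * (\<Prod>i\<in>UNIV. (x $ i - p $ i) ^ \<alpha> i)) has_sum f x) UNIV)"

fun regular_on ::
    "regularity \<Rightarrow> (('k::real_normed_field)^'n::finite) set \<Rightarrow> ('k^'n \<Rightarrow> 'k) \<Rightarrow> bool" where
  "regular_on Smooth S f \<longleftrightarrow> (\<forall>r. cont_diff r S f)"
| "regular_on Analytic S f \<longleftrightarrow> power_series_on S f"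


text \<open>
  The underlying space of a manifold is a type \<open>'m\<close>.  A manifold is given by its structure sheaf
  \<open>\<O>\<close>, a sheaf of \<open>'k\<close>-valued functions locally isomorphic to the sheaf of regular functions on an
  open subset of \<open>'k^'n\<close>.  An element of \<open>\<O> V\<close>, a function on \<open>V\<close>, is represented by its extension
  by zero outside \<open>V\<close>.  Functions and operators are added and multiplied pointwise.
\<close>

type_synonym ('m, 'k) func_sheaf = "'m set \<Rightarrow> ('m \<Rightarrow> 'k) set"

definition frestr :: "'m set \<Rightarrow> ('m \<Rightarrow> 'k::zero) \<Rightarrow> 'm \<Rightarrow> 'k" where
  "frestr V f = (\<lambda>x. if x \<in> V then f x else 0)"

definition func_sheaf :: "('m::topological_space, 'k::real_normed_field) func_sheaf \<Rightarrow> bool" where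
  "func_sheaf \<O> \<longleftrightarrow>
     (\<forall>V f. open V \<longrightarrow> f \<in> \<O> V \<longrightarrow> frestr V f = f) \<and>
     (\<forall>\<V> f. (\<forall>V\<in>\<V>. open V) \<longrightarrow> frestr (\<Union>\<V>) f = f \<longrightarrow>
        (f \<in> \<O> (\<Union>\<V>) \<longleftrightarrow> (\<forall>V\<in>\<V>. frestr V f \<in> \<O> V)))"

definition chart :: "regularity \<Rightarrow> ('m::topological_space, 'k::real_normed_field) func_sheaf \<Rightarrow>
    'm set \<Rightarrow> ('k^'n::finite) set \<Rightarrow> ('m \<Rightarrow> 'k^'n) \<Rightarrow> ('k^'n \<Rightarrow> 'm) \<Rightarrow> bool" where
  "chart reg \<O> D S h g \<longleftrightarrow> open D \<and> open S \<and> homeomorphism D S h g \<and>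
     (\<forall>V f. open V \<longrightarrow> V \<subseteq> D \<longrightarrow> frestr V f = f \<longrightarrow>
        (f \<in> \<O> V \<longleftrightarrow> regular_on reg (h ` V) (f \<circ> g)))"

definition manifold :: "regularity \<Rightarrow> 'n::finite itself \<Rightarrow>
    ('m::{t2_space, second_countable_topology}, 'k::real_normed_field) func_sheaf \<Rightarrow> bool" where
  "manifold reg n \<O> \<longleftrightarrow> func_sheaf \<O> \<and>
     (\<forall>p. \<exists>D (S :: ('k^'n) set) h g. p \<in> D \<and> chart reg \<O> D S h g)"


text \<open>
  The tangent sheaf is the sheaf of derivations of \<open>\<O>\<close>: a section \<open>X\<close> over \<open>V\<close> is a family of
  derivations \<open>X W\<close> of \<open>\<O> W\<close>, for \<open>W\<close> open in \<open>V\<close>, compatible with restriction.  Off these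
  arguments \<open>X\<close> is required to be zero, so that equality of sections is equality in HOL.
\<close>

type_synonym ('m, 'k) vfield = "'m set \<Rightarrow> ('m \<Rightarrow> 'k) \<Rightarrow> 'm \<Rightarrow> 'k"

definition tangent :: "('m::topological_space, 'k::real_normed_field) func_sheaf \<Rightarrow>
    'm set \<Rightarrow> ('m, 'k) vfield set" where
  "tangent \<O> V = {X.
     (\<forall>W f. \<not> (open W \<and> W \<subseteq> V \<and> f \<in> \<O> W) \<longrightarrow> X W f = 0) \<and>
     (\<forall>W. open W \<longrightarrow> W \<subseteq> V \<longrightarrow>
        (\<forall>f\<in>\<O> W. X W f \<in> \<O> W) \<and>
        (\<forall>f\<in>\<O> W. \<forall>g\<in>\<O> W. X W (f + g) = X W f + X W g) \<and>
        (\<forall>c. \<forall>f\<in>\<O> W. X W ((\<lambda>_. c) * f) = (\<lambda>_. c) * X W f) \<and>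
        (\<forall>f\<in>\<O> W. \<forall>g\<in>\<O> W. X W (f * g) = X W f * g + f * X W g)) \<and>
     (\<forall>W W'. open W \<longrightarrow> open W' \<longrightarrow> W' \<subseteq> W \<longrightarrow> W \<subseteq> V \<longrightarrow>
        (\<forall>f\<in>\<O> W. X W' (frestr W' f) = frestr W' (X W f)))}"

definition vrestr :: "'m set \<Rightarrow> ('m, 'k::zero) vfield \<Rightarrow> ('m, 'k) vfield" where
  "vrestr V X = (\<lambda>W. if W \<subseteq> V then X W else 0)"

definition smult :: "('m \<Rightarrow> 'k::times) \<Rightarrow> ('m, 'k) vfield \<Rightarrow> ('m, 'k) vfield" where
  "smult f X = (\<lambda>W g. f * X W g)"

definition bracket :: "('m, 'k::minus) vfield \<Rightarrow> ('m, 'k) vfield \<Rightarrow> ('m, 'k) vfield" where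
  "bracket X Y = (\<lambda>W f. X W (Y W f) - Y W (X W f))"


text \<open>
  Endomorphisms of the tangent sheaf, products and connections are given by their components over
  all open sets.
\<close>

type_synonym ('m, 'k) endo = "'m set \<Rightarrow> ('m, 'k) vfield \<Rightarrow> ('m, 'k) vfield"
type_synonym ('m, 'k) binop = "'m set \<Rightarrow> ('m, 'k) vfield \<Rightarrow> ('m, 'k) vfield \<Rightarrow> ('m, 'k) vfield"

definition invertible_on :: "('m::topological_space, 'k::real_normed_field) func_sheaf \<Rightarrow>
    'm set \<Rightarrow> ('m, 'k) endo \<Rightarrow> bool" where
  "invertible_on \<O> S A \<longleftrightarrow>
     (\<forall>V. open V \<longrightarrow> V \<subseteq> S \<longrightarrow> bij_betw (A V) (tangent \<O> V) (tangent \<O> V))"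

definition endo_inv :: "('m::topological_space, 'k::real_normed_field) func_sheaf \<Rightarrow>
    ('m, 'k) endo \<Rightarrow> ('m, 'k) endo" where
  "endo_inv \<O> A V = inv_into (tangent \<O> V) (A V)"

definition binop_on :: "('m::topological_space, 'k::real_normed_field) func_sheaf \<Rightarrow>
    'm set \<Rightarrow> ('m, 'k) binop \<Rightarrow> bool" where
  "binop_on \<O> S B \<longleftrightarrow>
     (\<forall>V. open V \<longrightarrow> V \<subseteq> S \<longrightarrow> (\<forall>X\<in>tangent \<O> V. \<forall>Y\<in>tangent \<O> V.
        B V X Y \<in> tangent \<O> V \<and>
        (\<forall>W. open W \<longrightarrow> W \<subseteq> V \<longrightarrow> B W (vrestr W X) (vrestr W Y) = vrestr W (B V X Y))))"

definition product_on :: "('m::topological_space, 'k::real_normed_field) func_sheaf \<Rightarrow>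
    'm set \<Rightarrow> ('m, 'k) binop \<Rightarrow> bool" where
  "product_on \<O> S circ \<longleftrightarrow> binop_on \<O> S circ \<and>
     (\<forall>V. open V \<longrightarrow> V \<subseteq> S \<longrightarrow>
        (\<forall>X\<in>tangent \<O> V. \<forall>Y\<in>tangent \<O> V. \<forall>Z\<in>tangent \<O> V. \<forall>f\<in>\<O> V.
           circ V (X + Y) Z = circ V X Z + circ V Y Z \<and>
           circ V X (Y + Z) = circ V X Y + circ V X Z \<and>
           circ V (smult f X) Y = smult f (circ V X Y) \<and>
           circ V X (smult f Y) = smult f (circ V X Y) \<and>
           circ V X Y = circ V Y X \<and>
           circ V (circ V X Y) Z = circ V X (circ V Y Z)))"

definition connection_on :: "('m::topological_space, 'k::real_normed_field) func_sheaf \<Rightarrow>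
    'm set \<Rightarrow> ('m, 'k) binop \<Rightarrow> bool" where
  "connection_on \<O> S nabla \<longleftrightarrow> binop_on \<O> S nabla \<and>
     (\<forall>V. open V \<longrightarrow> V \<subseteq> S \<longrightarrow>
        (\<forall>X\<in>tangent \<O> V. \<forall>Y\<in>tangent \<O> V. \<forall>Z\<in>tangent \<O> V. \<forall>f\<in>\<O> V.
           nabla V (X + Y) Z = nabla V X Z + nabla V Y Z \<and>
           nabla V X (Y + Z) = nabla V X Y + nabla V X Z \<and>
           nabla V (smult f X) Y = smult f (nabla V X Y) \<and>
           nabla V X (smult f Y) = smult (X V f) Y + smult f (nabla V X Y)))"

definition torsionless_on :: "('m::topological_space, 'k::real_normed_field) func_sheaf \<Rightarrow>
    'm set \<Rightarrow> ('m, 'k) binop \<Rightarrow> bool" where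
  "torsionless_on \<O> S nabla \<longleftrightarrow>
     (\<forall>V. open V \<longrightarrow> V \<subseteq> S \<longrightarrow> (\<forall>X\<in>tangent \<O> V. \<forall>Y\<in>tangent \<O> V.
        nabla V X Y - nabla V Y X = bracket X Y))"

definition flat_on :: "('m::topological_space, 'k::real_normed_field) func_sheaf \<Rightarrow>
    'm set \<Rightarrow> ('m, 'k) binop \<Rightarrow> bool" where
  "flat_on \<O> S nabla \<longleftrightarrow>
     (\<forall>V. open V \<longrightarrow> V \<subseteq> S \<longrightarrow>
        (\<forall>X\<in>tangent \<O> V. \<forall>Y\<in>tangent \<O> V. \<forall>Z\<in>tangent \<O> V.
           nabla V X (nabla V Y Z) - nabla V Y (nabla V X Z) - nabla V (bracket X Y) Z = 0))"

definition parallel_on :: "('m::topological_space, 'k::real_normed_field) func_sheaf \<Rightarrow>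
    'm set \<Rightarrow> ('m, 'k) binop \<Rightarrow> ('m, 'k) vfield \<Rightarrow> bool" where
  "parallel_on \<O> S nabla Y \<longleftrightarrow>
     (\<forall>V. open V \<longrightarrow> V \<subseteq> S \<longrightarrow> (\<forall>X\<in>tangent \<O> V. nabla V X (vrestr V Y) = 0))"


text \<open>
  In the following structures over an open subset \<open>S\<close> of the manifold, \<open>e\<close> and \<open>E\<close> are vector
  fields on \<open>S\<close> and have to be restricted before they are combined with sections over \<open>V \<subseteq> S\<close>.
\<close>

definition F_manifold :: "('m::topological_space, 'k::real_normed_field) func_sheaf \<Rightarrow>
    'm set \<Rightarrow> ('m, 'k) binop \<Rightarrow> ('m, 'k) vfield \<Rightarrow> bool" where
  "F_manifold \<O> S circ e \<longleftrightarrow> product_on \<O> S circ \<and> e \<in> tangent \<O> S \<and>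
     (\<forall>V. open V \<longrightarrow> V \<subseteq> S \<longrightarrow>
        (\<forall>X\<in>tangent \<O> V. circ V (vrestr V e) X = X) \<and>
        (\<forall>X\<in>tangent \<O> V. \<forall>Y\<in>tangent \<O> V. \<forall>W\<in>tangent \<O> V. \<forall>Z\<in>tangent \<O> V.
           bracket (circ V X Y) (circ V W Z)
             - circ V (bracket (circ V X Y) Z) W
             - circ V (bracket (circ V X Y) W) Z
             - circ V X (bracket Y (circ V Z W))
             + circ V X (circ V (bracket Y Z) W)
             + circ V X (circ V (bracket Y W) Z)
             - circ V Y (bracket X (circ V Z W))
             + circ V Y (circ V (bracket X Z) W)
             + circ V Y (circ V (bracket X W) Z) = 0))"

definition flat_F_manifold :: "('m::topological_space, 'k::real_normed_field) func_sheaf \<Rightarrow>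
    'm set \<Rightarrow> ('m, 'k) binop \<Rightarrow> ('m, 'k) binop \<Rightarrow> ('m, 'k) vfield \<Rightarrow> bool" where
  "flat_F_manifold \<O> S nabla circ e \<longleftrightarrow> F_manifold \<O> S circ e \<and> connection_on \<O> S nabla \<and>
     (\<forall>l :: 'k. flat_on \<O> S (\<lambda>V X Y. nabla V X Y - smult (\<lambda>_. l) (circ V X Y)) \<and>
                torsionless_on \<O> S (\<lambda>V X Y. nabla V X Y - smult (\<lambda>_. l) (circ V X Y))) \<and>
     parallel_on \<O> S nabla e"

definition Euler_field :: "('m::topological_space, 'k::real_normed_field) func_sheaf \<Rightarrow>
    'm set \<Rightarrow> ('m, 'k) binop \<Rightarrow> ('m, 'k) vfield \<Rightarrow> ('m, 'k) vfield \<Rightarrow> bool" where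
  "Euler_field \<O> S circ e E \<longleftrightarrow> E \<in> tangent \<O> S \<and> bracket e E = e \<and>
     (\<forall>V. open V \<longrightarrow> V \<subseteq> S \<longrightarrow> (\<forall>X\<in>tangent \<O> V. \<forall>Y\<in>tangent \<O> V.
        bracket (vrestr V E) (circ V X Y) - circ V (bracket (vrestr V E) X) Y
          - circ V X (bracket (vrestr V E) Y) = circ V X Y))"

definition mult_by :: "('m, 'k::zero) binop \<Rightarrow> ('m, 'k) vfield \<Rightarrow> ('m, 'k) endo" where
  "mult_by circ E V X = circ V (vrestr V E) X"

definition dual_product :: "('m::topological_space, 'k::real_normed_field) func_sheaf \<Rightarrow>
    ('m, 'k) binop \<Rightarrow> ('m, 'k) vfield \<Rightarrow> ('m, 'k) binop" where
  "dual_product \<O> circ E V X Y = endo_inv \<O> (mult_by circ E) V (circ V X Y)"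

definition biflat_F_structure :: "('m::topological_space, 'k::real_normed_field) func_sheaf \<Rightarrow>
    'm set \<Rightarrow> ('m, 'k) binop \<Rightarrow> ('m, 'k) binop \<Rightarrow> ('m, 'k) vfield \<Rightarrow>
    ('m, 'k) binop \<Rightarrow> ('m, 'k) binop \<Rightarrow> ('m, 'k) vfield \<Rightarrow> bool" where
  "biflat_F_structure \<O> U nabla circ e nabla' star E \<longleftrightarrow>
     flat_F_manifold \<O> UNIV nabla circ e \<and>
     Euler_field \<O> UNIV circ e E \<and>
     open U \<and> closure U = UNIV \<and> invertible_on \<O> U (mult_by circ E) \<and>
     (\<forall>V. open V \<longrightarrow> V \<subseteq> U \<longrightarrow> (\<forall>X\<in>tangent \<O> V. \<forall>Y\<in>tangent \<O> V.
        star V X Y = dual_product \<O> circ E V X Y)) \<and>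
     flat_F_manifold \<O> U nabla' star (vrestr U E) \<and>
     (\<forall>V. open V \<longrightarrow> V \<subseteq> U \<longrightarrow>
        (\<forall>X\<in>tangent \<O> V. \<forall>Y\<in>tangent \<O> V. \<forall>Z\<in>tangent \<O> V.
           nabla V Y (circ V X Z) - nabla V Z (circ V X Y)
             = nabla' V Y (circ V X Z) - nabla' V Z (circ V X Y)))"


definition dual_connection :: "('m::topological_space, 'k::real_normed_field) func_sheaf \<Rightarrow>
    ('m, 'k) binop \<Rightarrow> ('m, 'k) vfield \<Rightarrow> ('m, 'k) binop \<Rightarrow> ('m, 'k) binop" where
  "dual_connection \<O> circ E nabla V X Y =
     nabla V X Y - nabla V (dual_product \<O> circ E V X Y) (vrestr V E)"

definition shifted_mult :: "('m, 'k::real_normed_field) binop \<Rightarrow> ('m, 'k) vfield \<Rightarrow> 'k \<Rightarrow>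
    ('m, 'k) endo" where
  "shifted_mult circ E l V X = mult_by circ E V X - smult (\<lambda>_. l) X"

text \<open>The largest open subset of \<open>U\<close> over which \<open>L\<^sub>\<lambda>\<close> is invertible.\<close>

definition GM_domain :: "('m::topological_space, 'k::real_normed_field) func_sheaf \<Rightarrow>
    'm set \<Rightarrow> ('m, 'k) binop \<Rightarrow> ('m, 'k) vfield \<Rightarrow> 'k \<Rightarrow> 'm set" where
  "GM_domain \<O> U circ E l =
     \<Union>{V. open V \<and> V \<subseteq> U \<and> invertible_on \<O> V (shifted_mult circ E l)}"

definition Gauss_Manin :: "('m::topological_space, 'k::real_normed_field) func_sheaf \<Rightarrow>
    ('m, 'k) binop \<Rightarrow> ('m, 'k) vfield \<Rightarrow> ('m, 'k) binop \<Rightarrow> 'k \<Rightarrow> ('m, 'k) binop" where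
  "Gauss_Manin \<O> circ E nabla l V X Y =
     (let X' = endo_inv \<O> (shifted_mult circ E l) V X in
      dual_connection \<O> circ E nabla V X Y
        + smult (\<lambda>_. l) (dual_connection \<O> circ E nabla V X' Y - nabla V X' Y))"

end

theory Submission
  imports Defs
begin

text \<open>
  Notation: \<open>L = E\<circ>\<close>, \<open>L\<^sub>\<lambda> = L - \<lambda>\<close>, \<open>A X = \<nabla>\<^sub>X E\<close>, \<open>R\<close> is the curvature of \<open>\<nabla>\<close>, \<open>R*\<close> that of \<open>\<nabla>*\<close>, and
  \<open>H(X,Y) = \<nabla>\<^sub>X \<nabla>\<^sub>Y E - \<nabla>\<^bsub>\<nabla>\<^sub>X Y\<^esub> E\<close> is the second derivative of \<open>E\<close>.  Further
  \<open>S(X,Y,Z) = (\<nabla>\<^sub>X \<circ>)(Y,Z) - (\<nabla>\<^sub>Y \<circ>)(X,Z)\<close>, and \<open>S*\<close> is the same expression for \<open>\<nabla>*\<close> and \<open>*\<close>.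

  Since \<open>X * Y = L\<inverse>(X \<circ> Y)\<close>, the Gauss-Manin connection is
  \<open>\<nabla>\<^sub>X Y - A(L\<^sub>\<lambda>\<inverse>(X \<circ> Y))\<close>.  It is torsionless for every \<open>\<lambda>\<close>, because \<open>\<circ>\<close> is commutative.  The
  Nijenhuis torsion of \<open>L\<close> vanishes (\<open>Nijenhuis_E\<close>), and so \<open>L\<^sub>\<lambda>\<inverse>[L\<^sub>\<lambda> X, L\<^sub>\<lambda> Y]\<close> is a polynomial in \<open>\<lambda>\<close>.
  Hence the curvature on \<open>L\<^sub>\<lambda> X, L\<^sub>\<lambda> Y, Z\<close> is a quadratic polynomial \<open>F0 + \<lambda> F1 + \<lambda>\<^sup>2 F2\<close>
  (\<open>gm_curvature\<close>) with \<open>F0 = R*(L X, L Y)Z\<close>, \<open>F2 = R(X,Y)Z\<close> and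
  \<open>F1 = H(X, Y \<circ> Z) - H(Y, X \<circ> Z) + A(S(X,Y,Z)) - R(X, L Y)Z - R(L X, Y)Z\<close>.
  On the other hand \<open>\<nabla> - \<lambda>\<circ>\<close> has curvature \<open>R - \<lambda> S\<close>, and similarly for the dual pencil.  The
  theorem therefore amounts to: \<open>F0 = F1 = F2 = 0\<close> if and only if \<open>R = S = R* = S* = 0\<close>.  The link is
  the identity \<open>R*(X,Y)Z = R(X,Y)Z - H(X, Y * Z) + H(Y, X * Z) - A(S*(X,Y,Z))\<close> (\<open>dual_curv\<close>).

  If \<open>F0 = F1 = F2 = 0\<close>, put \<open>Y = e\<close> in \<open>F1 = 0\<close>.  The F-manifold identity contains
  \<open>\<L>\<^sub>e \<circ> = 0\<close>, that is, \<open>\<nabla>\<^sub>e \<circ> = 0\<close>, and it follows that \<open>H = 0\<close>; then \<open>A(S) = 0\<close>, and \<open>S = 0\<close>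
  since \<open>A\<close> is injective.  Now \<open>dual_curv\<close> gives \<open>S* = 0\<close>, which in turn implies the F-manifold
  identity for \<open>*\<close> (\<open>hm_zero_if_d_mul_zero\<close>).  Conversely, if \<open>R = S = R* = S* = 0\<close>, then
  \<open>H(X, Y * Z) = H(Y, X * Z)\<close>; taking \<open>Y = e\<close>, where \<open>H(e, -) = 0\<close>, gives \<open>H = 0\<close> and so \<open>F1 = 0\<close>.

  Geometry enters where vanishing of the polynomial is turned into vanishing of its coefficients:
  near the points of a dense set there have to be two non-zero \<open>\<lambda>\<close> for which \<open>L\<^sub>\<lambda>\<close> is invertible.
  A vector field on a chart is determined by its values on the coordinates
  (\<open>tangent_zero_if_coordinates\<close>), because regular functions satisfy
  \<open>f(x) - f(x with x\<^sub>i = q\<^sub>i) = (x\<^sub>i - q\<^sub>i) g(x)\<close> with \<open>g\<close> regular (\<open>regular_on_division\<close>).  Gaussian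
  elimination then yields, on a small open set, a relation \<open>E\<^sup>k = \<Sum>j<k. f\<^sub>j E\<^sup>j\<close> between the powers of
  \<open>E\<close> (\<open>generic_linear_dependence\<close>), and \<open>L\<^sub>\<lambda>\<close> is invertible where \<open>\<lambda>\<^sup>k - (\<Sum>j<k. f\<^sub>j \<lambda>\<^sup>j)\<close> has no zero
  (\<open>shifted_mult_bij\<close>).  Sections that vanish on a dense open set vanish, so \<open>R\<close>, \<open>S\<close> and \<open>H\<close> are zero
  on the whole manifold.
\<close>

section \<open>Products and torsion-free connections\<close>

text \<open>
  The model is the group of sections over one fixed open set.  The carrier is a set, because these
  sections do not form a type.
\<close>
locale torsionless_product =
  fixes T :: "'a::ab_group_add set"
    and mul :: "'a \<Rightarrow> 'a \<Rightarrow> 'a"  (infixl "\<odot>" 70)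
    and nb br :: "'a \<Rightarrow> 'a \<Rightarrow> 'a"
  assumes zero_closed [simp]: "0 \<in> T"
    and add_closed [simp]: "X \<in> T \<Longrightarrow> Y \<in> T \<Longrightarrow> X + Y \<in> T"
    and uminus_closed [simp]: "X \<in> T \<Longrightarrow> - X \<in> T"
    and mul_closed [simp]: "X \<in> T \<Longrightarrow> Y \<in> T \<Longrightarrow> X \<odot> Y \<in> T"
    and nb_closed [simp]: "X \<in> T \<Longrightarrow> Y \<in> T \<Longrightarrow> nb X Y \<in> T"
    and mul_add_right [simp]: "X \<in> T \<Longrightarrow> Y \<in> T \<Longrightarrow> Z \<in> T \<Longrightarrow> X \<odot> (Y + Z) = X \<odot> Y + X \<odot> Z"
    and mul_comm: "X \<in> T \<Longrightarrow> Y \<in> T \<Longrightarrow> X \<odot> Y = Y \<odot> X"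
    and mul_assoc: "X \<in> T \<Longrightarrow> Y \<in> T \<Longrightarrow> Z \<in> T \<Longrightarrow> X \<odot> Y \<odot> Z = X \<odot> (Y \<odot> Z)"
    and nb_add_left [simp]: "X \<in> T \<Longrightarrow> Y \<in> T \<Longrightarrow> Z \<in> T \<Longrightarrow> nb (X + Y) Z = nb X Z + nb Y Z"
    and nb_add_right [simp]: "X \<in> T \<Longrightarrow> Y \<in> T \<Longrightarrow> Z \<in> T \<Longrightarrow> nb X (Y + Z) = nb X Y + nb X Z"
    and br_eq: "X \<in> T \<Longrightarrow> Y \<in> T \<Longrightarrow> br X Y = nb X Y - nb Y X"
begin

lemma diff_closed [simp]: "X \<in> T \<Longrightarrow> Y \<in> T \<Longrightarrow> X - Y \<in> T"
  using add_closed[of X "- Y"] by simp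

lemma br_closed [simp]: "X \<in> T \<Longrightarrow> Y \<in> T \<Longrightarrow> br X Y \<in> T"
  by (simp add: br_eq)

lemma mul_add_left [simp]: "X \<in> T \<Longrightarrow> Y \<in> T \<Longrightarrow> Z \<in> T \<Longrightarrow> (X + Y) \<odot> Z = X \<odot> Z + Y \<odot> Z"
  by (simp add: mul_comm[of _ Z])

lemma mul_zero [simp]: "X \<in> T \<Longrightarrow> X \<odot> 0 = 0" "X \<in> T \<Longrightarrow> 0 \<odot> X = 0"
  using mul_add_right[of X 0 0] mul_add_left[of 0 0 X] by auto

lemma nb_zero [simp]: "X \<in> T \<Longrightarrow> nb X 0 = 0" "X \<in> T \<Longrightarrow> nb 0 X = 0"
  using nb_add_right[of X 0 0] nb_add_left[of 0 0 X] by auto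

lemma mul_uminus [simp]:
  assumes "X \<in> T" "Y \<in> T" shows "X \<odot> (- Y) = - (X \<odot> Y)" "(- X) \<odot> Y = - (X \<odot> Y)"
  using mul_add_right[of X Y "- Y"] mul_add_left[of X "- X" Y] assms
  by (simp_all add: eq_neg_iff_add_eq_0 add.commute)

lemma nb_uminus [simp]:
  assumes "X \<in> T" "Y \<in> T" shows "nb X (- Y) = - nb X Y" "nb (- X) Y = - nb X Y"
  using nb_add_right[of X Y "- Y"] nb_add_left[of X "- X" Y] assms
  by (simp_all add: eq_neg_iff_add_eq_0 add.commute)

lemma mul_diff [simp]:
  assumes "X \<in> T" "Y \<in> T" "Z \<in> T"
  shows "X \<odot> (Y - Z) = X \<odot> Y - X \<odot> Z" "(X - Y) \<odot> Z = X \<odot> Z - Y \<odot> Z"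
  using mul_add_right[of X Y "- Z"] mul_add_left[of X "- Y" Z] assms by simp_all

lemma nb_diff [simp]:
  assumes "X \<in> T" "Y \<in> T" "Z \<in> T"
  shows "nb X (Y - Z) = nb X Y - nb X Z" "nb (X - Y) Z = nb X Z - nb Y Z"
  using nb_add_right[of X Y "- Z"] nb_add_left[of X "- Y" Z] assms by simp_all

lemma mul_left_comm:
  assumes "X \<in> T" "Y \<in> T" "Z \<in> T" shows "X \<odot> (Y \<odot> Z) = Y \<odot> (X \<odot> Z)"
  using assms mul_assoc[of X Y Z] mul_assoc[of Y X Z] mul_comm[of X Y] by simp

lemmas mul_ac = mul_assoc mul_comm mul_left_comm

definition curv :: "'a \<Rightarrow> 'a \<Rightarrow> 'a \<Rightarrow> 'a" where
  "curv X Y Z = nb X (nb Y Z) - nb Y (nb X Z) - nb (br X Y) Z"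

definition nb_mul :: "'a \<Rightarrow> 'a \<Rightarrow> 'a \<Rightarrow> 'a" where
  "nb_mul X Y Z = nb X (Y \<odot> Z) - nb X Y \<odot> Z - Y \<odot> nb X Z"

text \<open>
  The exterior covariant derivative of \<open>X \<mapsto> X\<odot>\<close>.
\<close>
definition d_mul :: "'a \<Rightarrow> 'a \<Rightarrow> 'a \<Rightarrow> 'a" where
  "d_mul X Y Z = nb_mul X Y Z - nb_mul Y X Z"

text \<open>
  The Hertling-Manin expression, whose vanishing is the F-manifold identity.
\<close>
definition hm :: "'a \<Rightarrow> 'a \<Rightarrow> 'a \<Rightarrow> 'a \<Rightarrow> 'a" where
  "hm X Y W Z = br (X \<odot> Y) (W \<odot> Z)
     - br (X \<odot> Y) Z \<odot> W - br (X \<odot> Y) W \<odot> Z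
     - X \<odot> br Y (Z \<odot> W) + X \<odot> (br Y Z \<odot> W) + X \<odot> (br Y W \<odot> Z)
     - Y \<odot> br X (Z \<odot> W) + Y \<odot> (br X Z \<odot> W) + Y \<odot> (br X W \<odot> Z)"

lemma nb_mul_closed [simp]: "X \<in> T \<Longrightarrow> Y \<in> T \<Longrightarrow> Z \<in> T \<Longrightarrow> nb_mul X Y Z \<in> T"
  by (simp add: nb_mul_def)

lemma d_mul_closed [simp]: "X \<in> T \<Longrightarrow> Y \<in> T \<Longrightarrow> Z \<in> T \<Longrightarrow> d_mul X Y Z \<in> T"
  by (simp add: d_mul_def)

text \<open>
  The covariant derivative of the associative law.
\<close>
lemma nb_mul_assoc:
  assumes "X \<in> T" "Y \<in> T" "Z \<in> T" "W \<in> T"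
  shows "nb_mul X (Y \<odot> Z) W = nb_mul X Y (Z \<odot> W) + Y \<odot> nb_mul X Z W - nb_mul X Y Z \<odot> W"
  using assms by (simp add: nb_mul_def algebra_simps mul_ac)

text \<open>
  For a torsion-free connection the brackets may be replaced by covariant derivatives, and all terms
  in which no product is differentiated cancel.
\<close>
lemma hm_eq_nb_mul:
  assumes "X \<in> T" "Y \<in> T" "W \<in> T" "Z \<in> T"
  shows "hm X Y W Z = nb_mul (X \<odot> Y) Z W - X \<odot> nb_mul Y Z W - Y \<odot> nb_mul X Z W
     - nb_mul (Z \<odot> W) X Y + W \<odot> nb_mul Z X Y + Z \<odot> nb_mul W X Y"
  using assms by (simp add: hm_def nb_mul_def br_eq algebra_simps mul_ac)

text \<open>
  If \<open>d_mul\<close> vanishes, \<open>nb_mul\<close> is totally symmetric.  Moving the product into another slot and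
  differentiating the associative law there turns both halves of the Hertling-Manin expression
  into \<open>nb_mul X Z (W \<odot> Y)\<close>.
\<close>
lemma hm_zero_if_d_mul_zero:
  assumes S: "\<And>X Y Z. X \<in> T \<Longrightarrow> Y \<in> T \<Longrightarrow> Z \<in> T \<Longrightarrow> d_mul X Y Z = 0"
    and T: "X \<in> T" "Y \<in> T" "W \<in> T" "Z \<in> T"
  shows "hm X Y W Z = 0"
proof -
  have sw: "nb_mul X Y Z = nb_mul Y X Z" if "X \<in> T" "Y \<in> T" "Z \<in> T" for X Y Z
    using S[OF that] by (simp add: d_mul_def)
  have 1: "nb_mul (X \<odot> Y) Z W = nb_mul X Z (W \<odot> Y) + X \<odot> nb_mul Y Z W - W \<odot> nb_mul Z X Y"
    using T nb_mul_assoc[of Z X Y W] sw[of "X \<odot> Y" Z W] sw[of Z X "Y \<odot> W"] sw[of Z Y W]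
    by (simp add: mul_comm)
  have 2: "nb_mul (Z \<odot> W) X Y = nb_mul X Z (W \<odot> Y) + Z \<odot> nb_mul W X Y - Y \<odot> nb_mul X Z W"
    using T nb_mul_assoc[of X Z W Y] sw[of "Z \<odot> W" X Y] sw[of W X Y]
    by (simp add: mul_comm)
  show ?thesis
    unfolding hm_eq_nb_mul[OF T] 1 2 by simp
qed

end

locale scaled_torsionless_product = torsionless_product T mul nb br
  for T :: "'a::ab_group_add set" and mul (infixl "\<odot>" 70) and nb br +
  fixes sc :: "'k::field \<Rightarrow> 'a \<Rightarrow> 'a"
  assumes vs: "vector_space sc"
    and sc_closed [simp]: "X \<in> T \<Longrightarrow> sc l X \<in> T"
    and mul_sc_right [simp]: "X \<in> T \<Longrightarrow> Y \<in> T \<Longrightarrow> X \<odot> sc l Y = sc l (X \<odot> Y)"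
    and nb_sc_left [simp]: "X \<in> T \<Longrightarrow> Y \<in> T \<Longrightarrow> nb (sc l X) Y = sc l (nb X Y)"
    and nb_sc_right [simp]: "X \<in> T \<Longrightarrow> Y \<in> T \<Longrightarrow> nb X (sc l Y) = sc l (nb X Y)"
begin

lemma mul_sc_left [simp]: "X \<in> T \<Longrightarrow> Y \<in> T \<Longrightarrow> sc l X \<odot> Y = sc l (X \<odot> Y)"
  by (simp add: mul_comm[of _ Y])

interpretation vs: vector_space sc by (rule vs)

lemmas sc_simps = vs.scale_right_distrib vs.scale_right_diff_distrib

text \<open>
  The quadratic term in \<open>l\<close> is the commutator of two multiplications, which is zero.
\<close>
lemma curv_pencil:
  assumes "X \<in> T" "Y \<in> T" "Z \<in> T"
  shows "nb X (nb Y Z - sc l (Y \<odot> Z)) - sc l (X \<odot> (nb Y Z - sc l (Y \<odot> Z)))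
     - (nb Y (nb X Z - sc l (X \<odot> Z)) - sc l (Y \<odot> (nb X Z - sc l (X \<odot> Z))))
     - (nb (br X Y) Z - sc l (br X Y \<odot> Z)) = curv X Y Z - sc l (d_mul X Y Z)"
  using assms
  by (simp add: curv_def d_mul_def nb_mul_def br_eq sc_simps algebra_simps mul_left_comm)

end

section \<open>Euler fields and the Gauss-Manin pencil\<close>
locale Euler_algebra = scaled_torsionless_product T mul nb br sc
  for T :: "'a::ab_group_add set" and mul (infixl "\<odot>" 70) and nb br and sc :: "'k::field \<Rightarrow> 'a \<Rightarrow> 'a" +
  fixes e E :: 'a
  assumes e_closed [simp]: "e \<in> T" and E_closed [simp]: "E \<in> T"
    and unit [simp]: "X \<in> T \<Longrightarrow> e \<odot> X = X"
    and hm_zero: "X \<in> T \<Longrightarrow> Y \<in> T \<Longrightarrow> W \<in> T \<Longrightarrow> Z \<in> T \<Longrightarrow> hm X Y W Z = 0"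
    and br_e_E: "br e E = e"
    and Euler: "X \<in> T \<Longrightarrow> Y \<in> T \<Longrightarrow> br E (X \<odot> Y) - br E X \<odot> Y - X \<odot> br E Y = X \<odot> Y"
    and nb_e [simp]: "X \<in> T \<Longrightarrow> nb X e = 0"
begin

interpretation vs: vector_space sc by (rule vs)

lemma unit_right [simp]: "X \<in> T \<Longrightarrow> X \<odot> e = X"
  by (simp add: mul_comm[of X])

lemma nb_mul_unit: "X \<in> T \<Longrightarrow> Y \<in> T \<Longrightarrow> nb_mul X e Y = 0"
  by (simp add: nb_mul_def)

text \<open>
  The Hertling-Manin identity with \<open>X = Y = e\<close> says that the Lie derivative of the product along \<open>e\<close>
  vanishes; as \<open>nb _ e = 0\<close>, this is the covariant derivative along \<open>e\<close>.
\<close>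
lemma nb_mul_along_unit: "X \<in> T \<Longrightarrow> Y \<in> T \<Longrightarrow> nb_mul e X Y = 0"
  using hm_zero[of e e Y X] by (simp add: hm_eq_nb_mul nb_mul_def)

lemma nb_e_E: "nb e E = e"
  using br_e_E by (simp add: br_eq)

text \<open>
  Vanishing of the Nijenhuis torsion of \<open>E\<odot>\<close>.  It comes from the Hertling-Manin identity for the
  arguments \<open>E, X, E, Y\<close> after the Euler property has removed every bracket of \<open>E\<close> with a product.
\<close>
lemma Nijenhuis_E:
  assumes T: "X \<in> T" "Y \<in> T"
  shows "br (E \<odot> X) (E \<odot> Y) = E \<odot> (br (E \<odot> X) Y + br X (E \<odot> Y) - E \<odot> br X Y)"
proof -
  have 1: "br (E \<odot> X) E = - (E \<odot> X) - E \<odot> br E X"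
    using Euler[of E X] T by (simp add: br_eq algebra_simps)
  have 2: "br E (E \<odot> Y) = E \<odot> Y + E \<odot> br E Y"
    using Euler[of E Y] T by (simp add: br_eq algebra_simps)
  have 3: "br E (Y \<odot> E) = E \<odot> Y + E \<odot> br E Y" using 2 T by (simp add: mul_comm)
  have 4: "br E E = 0" by (simp add: br_eq)
  have 5: "br X E = - br E X" using T by (simp add: br_eq)
  have "hm E X E Y = 0" using T hm_zero by simp
  then show ?thesis
    using T unfolding hm_def 1 2 3 4 5
    by (simp add: algebra_simps mul_ac)
qed

definition hess :: "'a \<Rightarrow> 'a \<Rightarrow> 'a" where
  "hess X W = nb X (nb W E) - nb (nb X W) E"

lemma hess_closed [simp]: "X \<in> T \<Longrightarrow> Y \<in> T \<Longrightarrow> hess X Y \<in> T"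
  by (simp add: hess_def)

lemma hess_swap: "X \<in> T \<Longrightarrow> Y \<in> T \<Longrightarrow> hess X Y - hess Y X = curv X Y E"
  by (simp add: hess_def curv_def br_eq algebra_simps)

text \<open>
  The Hessian is symmetric up to curvature, and \<open>hess X e = 0\<close> since both \<open>e\<close> and
  \<open>nb e E = e\<close> are parallel.
\<close>
lemma hess_unit:
  assumes "X \<in> T" "curv e X E = 0"
  shows "hess e X = 0"
  using hess_swap[of e X] assms by (simp add: hess_def nb_e_E)

text \<open>
  The coefficient of \<open>l\<close> in the curvature of the Gauss-Manin connections.
\<close>
definition linear_coeff :: "'a \<Rightarrow> 'a \<Rightarrow> 'a \<Rightarrow> 'a" where
  "linear_coeff X Y Z = hess X (Y \<odot> Z) - hess Y (X \<odot> Z) + nb (d_mul X Y Z) E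
     - curv X (E \<odot> Y) Z - curv (E \<odot> X) Y Z"

text \<open>
  The Gauss-Manin connection along the shifted direction \<open>(E - l) \<odot> X\<close>.  Written in this way it
  contains no inverse, hence makes sense for all \<open>l\<close> and is affine in \<open>l\<close>.
\<close>
definition gm :: "'k \<Rightarrow> 'a \<Rightarrow> 'a \<Rightarrow> 'a" where
  "gm l X Z = nb (E \<odot> X - sc l X) Z - nb (X \<odot> Z) E"

text \<open>
  The bracket of \<open>(E - l) \<odot> X\<close> and \<open>(E - l) \<odot> Y\<close>, divided by \<open>E - l\<close>; see \<open>br_shift\<close>.
\<close>
definition gm_br :: "'k \<Rightarrow> 'a \<Rightarrow> 'a \<Rightarrow> 'a" where
  "gm_br l X Y = br (E \<odot> X) Y + br X (E \<odot> Y) - E \<odot> br X Y - sc l (br X Y)"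

lemma gm_br_closed [simp]: "X \<in> T \<Longrightarrow> Y \<in> T \<Longrightarrow> gm_br l X Y \<in> T"
  by (simp add: gm_br_def)

text \<open>
  The operator \<open>E\<odot> - l\<close> has no Nijenhuis torsion either, as a multiple of the identity does not
  change it.
\<close>
lemma br_shift:
  assumes T: "X \<in> T" "Y \<in> T"
  shows "br (E \<odot> X - sc l X) (E \<odot> Y - sc l Y) = E \<odot> gm_br l X Y - sc l (gm_br l X Y)"
proof -
  have "br (E \<odot> X - sc l X) (E \<odot> Y - sc l Y)
     = br (E \<odot> X) (E \<odot> Y) - sc l (br (E \<odot> X) Y + br X (E \<odot> Y)) + sc l (sc l (br X Y))"
    using T by (simp add: br_eq sc_simps algebra_simps del: vs.scale_scale)
  then show ?thesis unfolding Nijenhuis_E[OF T] gm_br_def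
    using T by (simp add: sc_simps algebra_simps  del: vs.scale_scale)
qed

text \<open>
  Since \<open>gm\<close> and \<open>gm_br\<close> are affine in \<open>l\<close>, the curvature is quadratic in \<open>l\<close>.
\<close>
lemma gm_curvature:
  assumes T: "X \<in> T" "Y \<in> T" "Z \<in> T"
  shows "gm l X (gm l Y Z) - gm l Y (gm l X Z) - gm l (gm_br l X Y) Z
    = (gm 0 X (gm 0 Y Z) - gm 0 Y (gm 0 X Z) - gm 0 (gm_br 0 X Y) Z)
      + sc l (linear_coeff X Y Z) + sc l (sc l (curv X Y Z))"
  using T unfolding gm_def gm_br_def linear_coeff_def
  by (simp add: hess_def curv_def d_mul_def nb_mul_def br_eq sc_simps algebra_simps mul_left_comm
      del: vs.scale_scale)

end

section \<open>Dual product and dual connection\<close>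

text \<open>
  The two cancellation properties are what remains, on a single open set, of the invertibility of
  \<open>E\<odot>\<close> and of \<open>X \<mapsto> nb X E\<close>.
\<close>
locale dual_Euler_algebra = Euler_algebra T mul nb br sc e E
  for T :: "'a::ab_group_add set" and mul (infixl "\<odot>" 70) and nb br
    and sc :: "'k::field \<Rightarrow> 'a \<Rightarrow> 'a" and e E +
  fixes star :: "'a \<Rightarrow> 'a \<Rightarrow> 'a"  (infixl "\<star>" 70)
  assumes star_closed [simp]: "X \<in> T \<Longrightarrow> Y \<in> T \<Longrightarrow> X \<star> Y \<in> T"
    and E_star [simp]: "X \<in> T \<Longrightarrow> Y \<in> T \<Longrightarrow> E \<odot> (X \<star> Y) = X \<odot> Y"
    and E_cancel: "X \<in> T \<Longrightarrow> E \<odot> X = 0 \<Longrightarrow> X = 0"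
    and nb_E_cancel: "X \<in> T \<Longrightarrow> nb X E = 0 \<Longrightarrow> X = 0"
begin

interpretation vs: vector_space sc by (rule vs)

lemma E_inj: "X \<in> T \<Longrightarrow> Y \<in> T \<Longrightarrow> E \<odot> X = E \<odot> Y \<Longrightarrow> X = Y"
  using E_cancel[of "X - Y"] by simp

definition nbs :: "'a \<Rightarrow> 'a \<Rightarrow> 'a" where
  "nbs X Y = nb X Y - nb (X \<star> Y) E"

lemma nbs_closed [simp]: "X \<in> T \<Longrightarrow> Y \<in> T \<Longrightarrow> nbs X Y \<in> T"
  by (simp add: nbs_def)

lemma star_comm: "X \<in> T \<Longrightarrow> Y \<in> T \<Longrightarrow> X \<star> Y = Y \<star> X"
  by (rule E_inj) (simp_all add: mul_comm)

lemma star_add_right [simp]: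
  "X \<in> T \<Longrightarrow> Y \<in> T \<Longrightarrow> Z \<in> T \<Longrightarrow> X \<star> (Y + Z) = X \<star> Y + X \<star> Z"
  by (rule E_inj) simp_all

lemma star_sc_right [simp]: "X \<in> T \<Longrightarrow> Y \<in> T \<Longrightarrow> X \<star> sc l Y = sc l (X \<star> Y)"
  by (rule E_inj) simp_all

lemma star_assoc:
  assumes "X \<in> T" "Y \<in> T" "Z \<in> T" shows "X \<star> Y \<star> Z = X \<star> (Y \<star> Z)"
proof (rule E_inj[OF _ _ E_inj])
  show "E \<odot> (E \<odot> (X \<star> Y \<star> Z)) = E \<odot> (E \<odot> (X \<star> (Y \<star> Z)))"
    using assms mul_assoc[of E "X \<star> Y" Z] by (simp add: mul_left_comm[of E X] mul_assoc)
qed (use assms in simp_all)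

lemma E_star_unit [simp]: "X \<in> T \<Longrightarrow> E \<star> X = X"
  by (rule E_inj) simp_all

lemma star_E_mul [simp]: "X \<in> T \<Longrightarrow> Y \<in> T \<Longrightarrow> (E \<odot> X) \<star> Y = X \<odot> Y"
  by (rule E_inj) (simp_all add: mul_assoc)

text \<open>
  The dual structure is again a torsion-free connection with a product.  Everything proved about
  \<open>curv\<close>, \<open>d_mul\<close> and \<open>hm\<close> is thereby available for it.
\<close>
sublocale dual: scaled_torsionless_product T "(\<star>)" nbs br sc
proof
  have "(X + Y) \<star> Z = X \<star> Z + Y \<star> Z" if "X \<in> T" "Y \<in> T" "Z \<in> T" for X Y Z
    using that by (simp add: star_comm[of _ Z])
  then show "nbs (X + Y) Z = nbs X Z + nbs Y Z" if "X \<in> T" "Y \<in> T" "Z \<in> T" for X Y Z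
    using that by (simp add: nbs_def)
  have "sc l X \<star> Y = sc l (X \<star> Y)" if "X \<in> T" "Y \<in> T" for X Y l
    using that by (simp add: star_comm[of _ Y])
  then show "nbs (sc l X) Y = sc l (nbs X Y)" if "X \<in> T" "Y \<in> T" for X Y l
    using that by (simp add: nbs_def sc_simps)
  show "br X Y = nbs X Y - nbs Y X" if "X \<in> T" "Y \<in> T" for X Y
    using that by (simp add: nbs_def br_eq star_comm)
qed (auto simp: star_assoc nbs_def br_eq sc_simps intro: star_comm)

lemma nbs_E: "X \<in> T \<Longrightarrow> nbs X E = 0"
  by (simp add: nbs_def star_comm[of X])

text \<open>
  The two connections differ by \<open>nb (Y \<star> (X \<odot> Z)) E\<close>, which is symmetric in \<open>Y\<close> and \<open>Z\<close>.
\<close>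
lemma almost_dual_condition:
  assumes "X \<in> T" "Y \<in> T" "Z \<in> T"
  shows "nb Y (X \<odot> Z) - nb Z (X \<odot> Y) = nbs Y (X \<odot> Z) - nbs Z (X \<odot> Y)"
proof -
  have "Y \<star> (X \<odot> Z) = Z \<star> (X \<odot> Y)"
    by (rule E_inj) (use assms in \<open>simp_all add: mul_ac\<close>)
  then show ?thesis by (simp add: nbs_def)
qed

text \<open>
  The derivative of \<open>nb (Y \<star> Z) E\<close> along \<open>X\<close> splits into the Hessian of \<open>E\<close> and the image under
  \<open>X \<mapsto> nb X E\<close> of the derivative of \<open>\<star>\<close>; the terms quadratic in the difference of the connections
  turn the latter into the derivative for \<open>nbs\<close>.
\<close>
lemma dual_curv:
  assumes T: "X \<in> T" "Y \<in> T" "Z \<in> T"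
  shows "dual.curv X Y Z
    = curv X Y Z - hess X (Y \<star> Z) + hess Y (X \<star> Z) - nb (dual.d_mul X Y Z) E"
proof -
  have sym: "Y \<star> X = X \<star> Y" "Y \<star> (X \<star> Z) = X \<star> (Y \<star> Z)"
    using T by (simp_all add: star_comm dual.mul_left_comm)
  show ?thesis
    using T unfolding dual.curv_def curv_def hess_def dual.d_mul_def dual.nb_mul_def nbs_def br_eq[OF T(1,2)]
    by (simp add: sym)
qed

text \<open>
  This identifies \<open>gm\<close> with the Gauss-Manin connection: there \<open>X\<close> is the image of the direction under
  the inverse of \<open>E\<odot> - l\<close>.
\<close>
lemma gm_eq:
  assumes "X \<in> T" "Y \<in> T"
  shows "nbs (E \<odot> X - sc l X) Y + sc l (nbs X Y - nb X Y) = gm l X Y"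
  using assms by (simp add: nbs_def gm_def sc_simps)

lemma gm_zero_eq: "X \<in> T \<Longrightarrow> Y \<in> T \<Longrightarrow> gm 0 X Y = nbs (E \<odot> X) Y"
  by (simp add: nbs_def gm_def)

lemma gm_zero_curv:
  assumes "X \<in> T" "Y \<in> T" "Z \<in> T"
  shows "gm 0 X (gm 0 Y Z) - gm 0 Y (gm 0 X Z) - gm 0 (gm_br 0 X Y) Z
    = dual.curv (E \<odot> X) (E \<odot> Y) Z"
  using assms br_shift[of X Y 0] by (simp add: gm_zero_eq dual.curv_def)

lemma gm_torsionless:
  assumes "X \<in> T" "Y \<in> T"
  shows "gm l X (E \<odot> Y - sc l Y) - gm l Y (E \<odot> X - sc l X)
    = br (E \<odot> X - sc l X) (E \<odot> Y - sc l Y)"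
  using assms by (simp add: gm_def br_eq mul_ac)

definition gm_flat :: "'k \<Rightarrow> bool" where
  "gm_flat l \<longleftrightarrow> (\<forall>X\<in>T. \<forall>Y\<in>T. \<forall>Z\<in>T.
     gm l X (gm l Y Z) - gm l Y (gm l X Z) - gm l (gm_br l X Y) Z = 0)"

text \<open>
  A quadratic polynomial with three zeros \<open>0\<close>, \<open>l\<close>, \<open>m\<close> is zero, so the curvature and \<open>linear_coeff\<close>
  vanish.  In \<open>linear_coeff X e Z = 0\<close> the \<open>d_mul\<close> term is zero by \<open>nb_mul_unit\<close> and
  \<open>nb_mul_along_unit\<close>, and only the Hessian survives.
\<close>
lemma flat_consequences:
  assumes flat: "gm_flat 0" "gm_flat l" "gm_flat m" and lm: "l \<noteq> 0" "m \<noteq> 0" "l \<noteq> m"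
    and T: "X \<in> T" "Y \<in> T" "Z \<in> T"
  shows "curv X Y Z = 0" "d_mul X Y Z = 0" "hess X Z = 0"
proof -
  have *: "linear_coeff X Y Z + sc k (curv X Y Z) = 0"
    if "X \<in> T" "Y \<in> T" "Z \<in> T" "gm_flat k" "k \<noteq> 0" for X Y Z k
  proof -
    have "sc k (linear_coeff X Y Z + sc k (curv X Y Z)) = 0"
      using that flat(1) gm_curvature[of X Y Z k]
      by (simp add: gm_flat_def sc_simps del: vs.scale_scale)
    then show ?thesis using that by simp
  qed
  have R: "curv X Y Z = 0" if "X \<in> T" "Y \<in> T" "Z \<in> T" for X Y Z
  proof -
    have "sc l (curv X Y Z) = sc m (curv X Y Z)"
      using *[OF that flat(2) lm(1)] *[OF that flat(3) lm(2)] by (metis add_left_cancel)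
    then show ?thesis using lm by (simp add: vs.scale_cancel_right)
  qed
  have F: "hess X (Y \<odot> Z) - hess Y (X \<odot> Z) + nb (d_mul X Y Z) E = 0"
    if "X \<in> T" "Y \<in> T" "Z \<in> T" for X Y Z
    using *[OF that flat(2) lm(1)] that by (simp add: R linear_coeff_def)
  have H: "hess X Z = 0" if "X \<in> T" "Z \<in> T" for X Z
    using F[of X e Z] that
    by (simp add: hess_unit R d_mul_def nb_mul_unit nb_mul_along_unit)
  show "curv X Y Z = 0" by (rule R[OF T])
  show "hess X Z = 0" by (rule H[OF T(1,3)])
  show "d_mul X Y Z = 0"
    using nb_E_cancel[of "d_mul X Y Z"] F[OF T] T by (simp add: H)
qed

text \<open>
  The formula for the dual curvature with \<open>Y = e\<close>, where the Hessian vanishes by \<open>hess_unit\<close>;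
  the argument \<open>E \<odot> Z\<close> is chosen so that \<open>e \<star> (E \<odot> Z) = Z\<close>.
\<close>
lemma hess_zero:
  assumes 1: "\<And>X Y Z. X \<in> T \<Longrightarrow> Y \<in> T \<Longrightarrow> Z \<in> T \<Longrightarrow> curv X Y Z = 0"
    and 2: "\<And>X Y Z. X \<in> T \<Longrightarrow> Y \<in> T \<Longrightarrow> Z \<in> T \<Longrightarrow> dual.curv X Y Z = 0"
    and 3: "\<And>X Y Z. X \<in> T \<Longrightarrow> Y \<in> T \<Longrightarrow> Z \<in> T \<Longrightarrow> dual.d_mul X Y Z = 0"
    and T: "X \<in> T" "Z \<in> T"
  shows "hess X Z = 0"
proof -
  have z: "e \<star> (E \<odot> Z) = Z" "X \<star> (E \<odot> Z) = X \<odot> Z"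
    using T by (simp_all add: star_comm[of _ "E \<odot> Z"] mul_comm[of Z])
  have "dual.curv X e (E \<odot> Z) = 0" "dual.d_mul X e (E \<odot> Z) = 0" "curv X e (E \<odot> Z) = 0"
    using T by (simp_all add: 1 2 3)
  moreover have "hess e (X \<odot> Z) = 0"
    using T by (simp add: hess_unit 1)
  ultimately show ?thesis
    using dual_curv[of X e "E \<odot> Z"] T z by simp
qed

lemma gm_flat_if_biflat:
  assumes 1: "\<And>X Y Z. X \<in> T \<Longrightarrow> Y \<in> T \<Longrightarrow> Z \<in> T \<Longrightarrow> curv X Y Z = 0"
    and 2: "\<And>X Y Z. X \<in> T \<Longrightarrow> Y \<in> T \<Longrightarrow> Z \<in> T \<Longrightarrow> d_mul X Y Z = 0"
    and 3: "\<And>X Y Z. X \<in> T \<Longrightarrow> Y \<in> T \<Longrightarrow> Z \<in> T \<Longrightarrow> dual.curv X Y Z = 0"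
    and 4: "\<And>X Y Z. X \<in> T \<Longrightarrow> Y \<in> T \<Longrightarrow> Z \<in> T \<Longrightarrow> dual.d_mul X Y Z = 0"
  shows "gm_flat l"
  unfolding gm_flat_def
proof (intro ballI)
  fix X Y Z assume T: "X \<in> T" "Y \<in> T" "Z \<in> T"
  have "dual.curv (E \<odot> X) (E \<odot> Y) Z = 0" using T by (intro 3) simp_all
  moreover have "hess X (Y \<odot> Z) = 0" "hess Y (X \<odot> Z) = 0"
    using T by (intro hess_zero[OF 1 3 4]; simp)+
  then have "linear_coeff X Y Z = 0"
    using T by (simp add: linear_coeff_def 1 2)
  ultimately show "gm l X (gm l Y Z) - gm l Y (gm l X Z) - gm l (gm_br l X Y) Z = 0"
    unfolding gm_curvature[OF T, of l] gm_zero_curv[OF T] by (simp add: 1 T)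
qed

lemma dual_d_mul_zero:
  assumes 1: "\<And>X Y Z. X \<in> T \<Longrightarrow> Y \<in> T \<Longrightarrow> Z \<in> T \<Longrightarrow> curv X Y Z = 0"
    and 2: "\<And>X Y Z. X \<in> T \<Longrightarrow> Y \<in> T \<Longrightarrow> Z \<in> T \<Longrightarrow> d_mul X Y Z = 0"
    and H: "\<And>X Z. X \<in> T \<Longrightarrow> Z \<in> T \<Longrightarrow> hess X Z = 0"
    and 3: "dual.curv X Y Z = 0"
    and T: "X \<in> T" "Y \<in> T" "Z \<in> T"
  shows "dual.d_mul X Y Z = 0"
proof (rule nb_E_cancel)
  show "nb (dual.d_mul X Y Z) E = 0"
    using dual_curv[OF T] T by (simp add: 1 3 H)
qed (use T in simp)

end

section \<open>Sums over products and lists\<close>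

lemma has_sum_product_abs:
  fixes f :: "'i \<Rightarrow> 'k::{real_normed_field, banach}" and g :: "'j \<Rightarrow> 'k"
  assumes f: "(f has_sum u) A" "(\<lambda>x. norm (f x)) summable_on A"
    and g: "(g has_sum v) B" "(\<lambda>x. norm (g x)) summable_on B"
  shows "((\<lambda>(x, y). f x * g y) has_sum (u * v)) (A \<times> B)"
    and "(\<lambda>(x, y). norm (f x * g y)) summable_on (A \<times> B)"
proof -
  show *: "(\<lambda>(x, y). norm (f x * g y)) summable_on (A \<times> B)"
  proof (rule summable_on_SigmaI)
    show "((\<lambda>y. case (x, y) of (x, y) \<Rightarrow> norm (f x * g y)) has_sum (norm (f x) * (\<Sum>\<^sub>\<infinity>y\<in>B. norm (g y)))) B" for x
      using has_sum_cmult_right[OF has_sum_infsum[OF g(2)], of "norm (f x)"] by (simp add: norm_mult)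
    show "(\<lambda>x. norm (f x) * (\<Sum>\<^sub>\<infinity>y\<in>B. norm (g y))) summable_on A"
      by (rule summable_on_cmult_left[OF f(2)])
  qed auto
  have "(\<lambda>(x, y). f x * g y) summable_on (A \<times> B)"
    by (rule abs_summable_summable) (use * in \<open>simp add: case_prod_unfold\<close>)
  then show "((\<lambda>(x, y). f x * g y) has_sum (u * v)) (A \<times> B)"
    using has_sum_cmult_right[OF g(1)] has_sum_cmult_left[OF f(1)]
    by (intro has_sum_SigmaI[where g = "\<lambda>x. f x * v"]) auto
qed

lemma has_sum_lists_of_length:
  fixes g :: "'i \<Rightarrow> 'k::{real_normed_field, banach}"
  assumes "(g has_sum u) UNIV" "(\<lambda>x. norm (g x)) summable_on UNIV"
  shows "((\<lambda>l. prod_list (map g l)) has_sum u ^ k) {l. length l = k} \<and>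
    (\<lambda>l. norm (prod_list (map g l))) summable_on {l. length l = k}"
proof (induction k)
  case 0
  have "{l :: 'i list. length l = 0} = {[]}" by auto
  then show ?case
    by (auto intro!: has_sum_finiteI)
next
  case (Suc k)
  note pr = has_sum_product_abs[OF assms conjunct1[OF Suc] conjunct2[OF Suc]]
  have "((\<lambda>(x, l). g x * prod_list (map g l)) has_sum (u * u ^ k)) (UNIV \<times> {l. length l = k}) =
      ((\<lambda>l. prod_list (map g l)) has_sum (u ^ Suc k)) {l. length l = Suc k}"
    by (rule has_sum_reindex_bij_witness[where i = "\<lambda>l. (hd l, tl l)" and j = "\<lambda>(x, l). x # l"])
      (auto simp: length_Suc_conv)
  moreover have "((\<lambda>(x, l). norm (g x * prod_list (map g l))) summable_on (UNIV \<times> {l. length l = k})) =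
      ((\<lambda>l. norm (prod_list (map g l))) summable_on {l. length l = Suc k})"
    by (rule summable_on_reindex_bij_witness[where i = "\<lambda>l. (hd l, tl l)" and j = "\<lambda>(x, l). x # l"])
      (auto simp: length_Suc_conv)
  ultimately show ?case using pr by blast
qed

lemma norm_prod_list: "norm (prod_list (map g l)) = prod_list (map (\<lambda>x. norm (g x :: 'k::real_normed_field)) l)"
  by (induction l) (auto simp: norm_mult)

text \<open>
  The geometric series \<open>\<Sum>k. u ^ k\<close> with all powers of \<open>u = \<Sum>x. g x\<close> multiplied out: the summands are
  then indexed by lists.  This is how the coefficients of the inverse of a power series are found.
\<close>
lemma has_sum_lists:
  fixes g :: "'i \<Rightarrow> 'k::{real_normed_field, banach}"
  assumes u: "(g has_sum u) UNIV" and q: "((\<lambda>x. norm (g x)) has_sum q) UNIV" "q < 1"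
  shows "((\<lambda>l. prod_list (map g l)) has_sum (1 / (1 - u))) UNIV"
    and "(\<lambda>l. norm (prod_list (map g l))) summable_on UNIV"
proof -
  have sum: "(\<lambda>x. norm (g x)) summable_on UNIV" using q by (auto simp: summable_on_def)
  have nu: "norm u \<le> q" by (rule norm_has_sum_bound[OF q(1) u])
  then have q0: "0 \<le> q" "norm u < 1" using q norm_ge_zero[of u] by linarith+
  have tr: "(h has_sum a) (UNIV :: 'i list set) \<longleftrightarrow>
      ((\<lambda>(k, l). h l) has_sum a) (Sigma UNIV (\<lambda>k. {l. length l = k}))" for h :: "'i list \<Rightarrow> 'c::topological_comm_monoid_add" and a
    by (rule has_sum_reindex_bij_witness[where i = snd and j = "\<lambda>l. (length l, l)"]) auto
  have N: "(\<lambda>(k, l). norm (prod_list (map g l))) summable_on (Sigma UNIV (\<lambda>k. {l. length l = k}))"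
  proof (rule summable_on_SigmaI)
    show "((\<lambda>y. case (k, y) of (k, l) \<Rightarrow> norm (prod_list (map g l))) has_sum (q ^ k)) {l. length l = k}" for k
      using has_sum_lists_of_length[of "\<lambda>x. norm (g x)" q k] q(1) sum by (simp add: norm_prod_list)
    show "(\<lambda>k. q ^ k) summable_on UNIV"
      using q0 q(2) by (intro summable_nonneg_imp_summable_on summable_geometric) auto
  qed auto
  then show "(\<lambda>l. norm (prod_list (map g l))) summable_on UNIV"
    unfolding summable_on_def tr by simp
  have "((\<lambda>k. u ^ k) has_sum (1 / (1 - u))) UNIV"
    using q0 by (intro norm_summable_imp_has_sum geometric_sums)
      (auto simp: norm_power intro!: summable_geometric)
  moreover have "(\<lambda>(k, l). prod_list (map g l)) summable_on (Sigma UNIV (\<lambda>k. {l. length l = k}))"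
    by (rule abs_summable_summable) (use N in \<open>simp add: case_prod_unfold\<close>)
  ultimately show "((\<lambda>l. prod_list (map g l)) has_sum (1 / (1 - u))) UNIV"
    unfolding tr using has_sum_lists_of_length[OF u sum]
    by (intro has_sum_SigmaI[where g = "\<lambda>k. u ^ k"]) auto
qed

section \<open>Power series in several variables\<close>
definition mon :: "('n \<Rightarrow> nat) \<Rightarrow> ('k::real_normed_field)^'n::finite \<Rightarrow> 'k" where
  "mon \<alpha> y = (\<Prod>i\<in>UNIV. (y $ i) ^ \<alpha> i)"

definition deg :: "('n::finite \<Rightarrow> nat) \<Rightarrow> nat" where
  "deg \<alpha> = sum \<alpha> UNIV"

lemma deg_add: "deg (\<alpha> + \<beta>) = deg \<alpha> + deg \<beta>"
  by (simp add: deg_def sum.distrib plus_fun_def)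

lemma deg_0 [simp]: "deg 0 = 0" by (simp add: deg_def zero_fun_def)

lemma deg_eq_0 [simp]: "deg \<alpha> = 0 \<longleftrightarrow> \<alpha> = 0"
  by (auto simp: deg_def zero_fun_def fun_eq_iff)

lemma mon_add: "mon (\<alpha> + \<beta>) y = mon \<alpha> y * mon \<beta> y"
  by (simp add: mon_def power_add prod.distrib plus_fun_def)

lemma mon_0 [simp]: "mon 0 y = 1" by (simp add: mon_def zero_fun_def)

lemma mon_at_0: "\<alpha> \<noteq> 0 \<Longrightarrow> mon \<alpha> 0 = 0"
  by (auto simp: mon_def zero_fun_def fun_eq_iff)

lemma norm_mon_le:
  assumes "\<And>i. norm (y $ i) \<le> s"
  shows "norm (mon \<alpha> y) \<le> s ^ deg \<alpha>"
  unfolding mon_def deg_def prod_norm[symmetric] power_sum norm_power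
  by (intro prod_mono) (auto intro!: power_mono assms)

definition polydisc :: "('k::real_normed_field)^'n::finite \<Rightarrow> real \<Rightarrow> ('k^'n) set" where
  "polydisc p s = {x. \<forall>i. norm (x $ i - p $ i) \<le> s}"

lemma center_in_polydisc [simp]: "0 \<le> s \<Longrightarrow> p \<in> polydisc p s"
  by (simp add: polydisc_def)

lemma polydisc_subset_ball:
  fixes p :: "('k::real_normed_field)^'n::finite"
  assumes "0 < r"
  obtains t where "0 < t" "polydisc p t \<subseteq> ball p r"
proof
  define t where "t = r / (2 * real CARD('n))"
  have c: "real CARD('n) > 0" by simp
  show "0 < t" using assms c by (simp add: t_def)
  show "polydisc p t \<subseteq> ball p r"
  proof
    fix x assume "x \<in> polydisc p t"
    then have i: "norm ((x - p) $ i) \<le> t" for i by (simp add: polydisc_def)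
    have "norm (x - p) \<le> (\<Sum>i\<in>UNIV. norm ((x - p) $ i))"
      unfolding norm_vec_def by (rule L2_set_le_sum) auto
    also have "\<dots> \<le> (\<Sum>i::'n\<in>UNIV. t)" by (intro sum_mono i)
    also have "\<dots> < r" using assms c by (simp add: t_def)
    finally show "x \<in> ball p r" by (simp add: dist_norm norm_minus_commute)
  qed
qed

lemma ball_subset_polydisc: "ball p s \<subseteq> polydisc p s"
proof
  fix x assume "x \<in> ball p s"
  then have "norm (x - p) < s" by (simp add: dist_norm norm_minus_commute)
  then show "x \<in> polydisc p s"
    unfolding polydisc_def using Finite_Cartesian_Product.norm_nth_le[of "x - p"] by (fastforce intro: order_trans)
qed

text \<open>
  Unconditional convergence near \<open>p\<close> is strengthened here to absolute convergence on a polydisc,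
  which permits arbitrary rearrangement; \<open>expansion_if_has_sum\<close> shows that nothing is lost.
\<close>
definition expansion :: "(('n \<Rightarrow> nat) \<Rightarrow> 'k) \<Rightarrow> real \<Rightarrow> ('k::real_normed_field)^'n::finite \<Rightarrow> ('k^'n \<Rightarrow> 'k) \<Rightarrow> bool" where
  "expansion c s p f \<longleftrightarrow> s > 0 \<and> (\<lambda>\<alpha>. norm (c \<alpha>) * s ^ deg \<alpha>) summable_on UNIV \<and>
     (\<forall>x\<in>polydisc p s. ((\<lambda>\<alpha>. c \<alpha> * mon \<alpha> (x - p)) has_sum f x) UNIV)"

lemma polydisc_mono: "t \<le> s \<Longrightarrow> polydisc p t \<subseteq> polydisc p s"
  by (auto simp: polydisc_def intro: order_trans)

lemma expansion_shrink:
  assumes "expansion c s p f" "0 < t" "t \<le> s" "\<And>x. x \<in> polydisc p t \<Longrightarrow> f x = g x"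
  shows "expansion c t p g"
proof -
  have "(\<lambda>\<alpha>. norm (c \<alpha>) * t ^ deg \<alpha>) summable_on UNIV"
    by (rule summable_on_comparison_test[where f = "\<lambda>\<alpha>. norm (c \<alpha>) * s ^ deg \<alpha>"])
      (use assms in \<open>auto simp: expansion_def intro!: mult_left_mono power_mono\<close>)
  then show ?thesis
    using assms(1,2) polydisc_mono[OF assms(3), of p] by (auto simp: expansion_def assms(4)[symmetric])
qed

lemma expansion_center:
  fixes p :: "('k::real_normed_field)^'n::finite"
  assumes "expansion c s p f" shows "f p = c 0"
proof -
  have "((\<lambda>\<alpha>. c \<alpha> * mon \<alpha> 0) has_sum f p) UNIV"
    using assms by (auto simp: expansion_def dest: bspec[where x = p])
  moreover have "((\<lambda>\<alpha>. c \<alpha> * mon \<alpha> (0 :: 'k^'n)) has_sum c 0) UNIV \<longleftrightarrow>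
     ((\<lambda>\<alpha>. c \<alpha> * mon \<alpha> (0 :: 'k^'n)) has_sum c 0) {0}"
    by (rule has_sum_cong_neutral) (auto simp: mon_at_0)
  ultimately show ?thesis by (auto intro: has_sum_unique has_sum_finiteI)
qed

text \<open>
  A finite partial sum is contained in a cube of multi-indices, over which the sum is a product of
  partial sums of the geometric series.
\<close>
lemma summable_half_power_deg: "(\<lambda>\<alpha> :: 'n::finite \<Rightarrow> nat. (1/2 :: real) ^ deg \<alpha>) summable_on UNIV"
proof (rule nonneg_bdd_above_summable_on)
  show "bdd_above (sum (\<lambda>\<alpha> :: 'n \<Rightarrow> nat. (1/2 :: real) ^ deg \<alpha>) ` {F. F \<subseteq> UNIV \<and> finite F})"
  proof (rule bdd_aboveI2)
    fix F :: "('n \<Rightarrow> nat) set" assume "F \<in> {F. F \<subseteq> UNIV \<and> finite F}"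
    then have F: "finite F" by simp
    define N where "N = Max (insert 0 (deg ` F))"
    have N: "\<alpha> i \<le> N" if "\<alpha> \<in> F" for \<alpha> i
    proof -
      have "\<alpha> i \<le> deg \<alpha>" unfolding deg_def by (rule member_le_sum) auto
      also have "\<dots> \<le> N" using F that by (auto simp: N_def)
      finally show ?thesis .
    qed
    have "sum (\<lambda>\<alpha>. (1/2 :: real) ^ deg \<alpha>) F \<le> sum (\<lambda>\<alpha> :: 'n \<Rightarrow> nat. (1/2 :: real) ^ deg \<alpha>) (PiE UNIV (\<lambda>_. {..N}))"
      by (intro sum_mono2 finite_PiE) (use F N in \<open>auto simp: PiE_def\<close>)
    also have "\<dots> = (\<Prod>i::'n\<in>UNIV. \<Sum>k\<in>{..N}. (1/2 :: real) ^ k)"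
      unfolding deg_def power_sum by (subst prod_sum_PiE) auto
    also have "\<dots> \<le> (\<Prod>i::'n\<in>UNIV. 2)"
    proof (intro prod_mono conjI)
      have "(\<Sum>k\<in>{..N}. (1/2 :: real) ^ k) \<le> (\<Sum>k. (1/2 :: real) ^ k)"
        by (intro sum_le_suminf summable_geometric) auto
      then show "(\<Sum>k\<in>{..N}. (1/2 :: real) ^ k) \<le> 2" by (simp add: suminf_geometric)
    qed (auto intro: sum_nonneg)
    finally show "sum (\<lambda>\<alpha>. (1/2 :: real) ^ deg \<alpha>) F \<le> (\<Prod>i::'n\<in>UNIV. 2)" .
  qed
qed auto

text \<open>
  Abel's lemma: the terms at the point \<open>p + (t, ..., t)\<close> are bounded, and at half of the radius
  they are dominated by a multiple of \<open>(1/2) ^ deg \<alpha>\<close>.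
\<close>
lemma expansion_if_has_sum:
  fixes p :: "('k::{real_normed_field, banach})^'n::finite"
  assumes r: "0 < r" and f: "\<And>x. x \<in> ball p r \<Longrightarrow> ((\<lambda>\<alpha>. c \<alpha> * mon \<alpha> (x - p)) has_sum f x) UNIV"
  obtains s where "expansion c s p f"
proof -
  obtain t where t: "0 < t" "polydisc p t \<subseteq> ball p r" using polydisc_subset_ball[OF r] .
  \<comment> \<open>a corner of the polydisc, where \<open>norm (mon \<alpha> y)\<close> is the full \<open>t ^ deg \<alpha>\<close>\<close>
  define y :: "'k^'n" where "y = (\<chi> i. of_real t)"
  have "p + y \<in> polydisc p t" using t by (simp add: polydisc_def y_def)
  then have "((\<lambda>\<alpha>. c \<alpha> * mon \<alpha> y) has_sum f (p + y)) UNIV" using f[of "p + y"] t by auto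
  moreover have my: "norm (mon \<alpha> y) = t ^ deg \<alpha>" for \<alpha>
    using t by (simp add: mon_def y_def deg_def prod_norm[symmetric] norm_power power_sum)
  ultimately obtain F where F: "finite F" "\<And>G. finite G \<Longrightarrow> F \<subseteq> G \<Longrightarrow>
       dist (\<Sum>\<alpha>\<in>G. c \<alpha> * mon \<alpha> y) (f (p + y)) < 1"
    unfolding has_sum_def tendsto_iff eventually_finite_subsets_at_top
    by (metis (no_types, lifting) subset_UNIV zero_less_one)
  \<comment> \<open>beyond the finite set \<open>F\<close> two partial sums differ by less than 2\<close>
  define K where "K = 2 + (\<Sum>\<alpha>\<in>F. norm (c \<alpha> * mon \<alpha> y))"
  have K2: "K \<ge> 2" by (auto simp: K_def intro: sum_nonneg)
  have K: "norm (c \<alpha>) * t ^ deg \<alpha> \<le> K" for \<alpha>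
  proof (cases "\<alpha> \<in> F")
    case True
    then have "norm (c \<alpha> * mon \<alpha> y) \<le> (\<Sum>\<alpha>\<in>F. norm (c \<alpha> * mon \<alpha> y))"
      using F by (intro member_le_sum) auto
    then show ?thesis by (simp add: K_def norm_mult my)
  next
    case False
    have "(\<Sum>\<alpha>\<in>insert \<alpha> F. c \<alpha> * mon \<alpha> y) - (\<Sum>\<alpha>\<in>F. c \<alpha> * mon \<alpha> y) = c \<alpha> * mon \<alpha> y"
      using F False by simp
    then have "norm (c \<alpha> * mon \<alpha> y) = dist (\<Sum>\<alpha>\<in>insert \<alpha> F. c \<alpha> * mon \<alpha> y) (\<Sum>\<alpha>\<in>F. c \<alpha> * mon \<alpha> y)"
      by (simp add: dist_norm)
    also have "\<dots> < 2"
      using F(2)[of "insert \<alpha> F"] F(2)[of F] F(1)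
        dist_triangle2[of "\<Sum>\<alpha>\<in>insert \<alpha> F. c \<alpha> * mon \<alpha> y" "\<Sum>\<alpha>\<in>F. c \<alpha> * mon \<alpha> y" "f (p + y)"]
      by (simp add: subset_insertI)
    finally show ?thesis using K2 by (simp add: norm_mult my)
  qed
  have "expansion c (t / 2) p f"
    unfolding expansion_def
  proof (intro conjI ballI)
    show "t / 2 > 0" using t by simp
    show "(\<lambda>\<alpha>. norm (c \<alpha>) * (t / 2) ^ deg \<alpha>) summable_on UNIV"
    proof (rule summable_on_comparison_test)
      show "(\<lambda>\<alpha>::'n\<Rightarrow>nat. K * (1/2) ^ deg \<alpha>) summable_on UNIV"
        by (intro summable_on_cmult_right summable_half_power_deg)
      show "norm (c \<alpha>) * (t / 2) ^ deg \<alpha> \<le> K * (1/2) ^ deg \<alpha>" for \<alpha>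
        using mult_right_mono[OF K[of \<alpha>], of "(1/2) ^ deg \<alpha>"] by (simp add: power_divide)
    qed (use t in auto)
    show "((\<lambda>\<alpha>. c \<alpha> * mon \<alpha> (x - p)) has_sum f x) UNIV" if "x \<in> polydisc p (t / 2)" for x
      using that f t polydisc_mono[of "t/2" t p] by auto
  qed
  then show thesis by (rule that)
qed

definition analytic_germ :: "('k::real_normed_field)^'n::finite \<Rightarrow> ('k^'n \<Rightarrow> 'k) \<Rightarrow> bool" where
  "analytic_germ p f \<longleftrightarrow> (\<exists>c s. expansion c s p f)"

lemma power_series_on_iff_germ:
  fixes S :: "(('k::{real_normed_field, banach})^'n::finite) set"
  assumes "open S"
  shows "power_series_on S f \<longleftrightarrow> (\<forall>p\<in>S. analytic_germ p f)"
proof (intro iffI ballI)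
  fix p assume ps: "power_series_on S f" and p: "p \<in> S"
  from ps p obtain c r where r: "r > 0" and c: "\<And>x. x \<in> S \<inter> ball p r \<Longrightarrow> ((\<lambda>\<alpha>. c \<alpha> * mon \<alpha> (x - p)) has_sum f x) UNIV"
    unfolding power_series_on_def mon_def vector_minus_component by meson
  obtain r' where r': "r' > 0" "ball p r' \<subseteq> S" using assms p by (meson openE)
  have "\<exists>s. expansion c s p f"
    by (rule expansion_if_has_sum[of "min r r'" p c f]) (use r r' c in \<open>auto simp: subset_iff\<close>)
  then show "analytic_germ p f" by (auto simp: analytic_germ_def)
next
  assume *: "\<forall>p\<in>S. analytic_germ p f"
  show "power_series_on S f"
    unfolding power_series_on_def
  proof
    fix p assume "p \<in> S"
    with * obtain c s where "expansion c s p f" by (auto simp: analytic_germ_def)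
    then show "\<exists>c r. 0 < r \<and> (\<forall>x\<in>S \<inter> ball p r.
        ((\<lambda>\<alpha>. c \<alpha> * (\<Prod>i\<in>UNIV. (x $ i - p $ i) ^ \<alpha> i)) has_sum f x) UNIV)"
      using ball_subset_polydisc[of p s] by (intro exI[of _ c] exI[of _ s]) (auto simp: expansion_def mon_def)
  qed
qed

lemma analytic_germ_cong:
  fixes p :: "('k::real_normed_field)^'n::finite"
  assumes "analytic_germ p f" "open S" "p \<in> S" "\<And>x. x \<in> S \<Longrightarrow> f x = g x"
  shows "analytic_germ p g"
proof -
  obtain c s where c: "expansion c s p f" using assms by (auto simp: analytic_germ_def)
  obtain r where r: "r > 0" "ball p r \<subseteq> S" using assms by (meson openE)
  obtain t where t: "0 < t" "polydisc p t \<subseteq> ball p r" using polydisc_subset_ball[OF r(1)] .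
  have "s > 0" using c by (simp add: expansion_def)
  have "expansion c (min s t) p g"
    by (rule expansion_shrink[OF c]) (use \<open>s > 0\<close> t r assms polydisc_mono[of "min s t" t p] in auto)
  then show ?thesis by (auto simp: analytic_germ_def)
qed

text \<open>
  A series of monomials indexed by an arbitrary set becomes a power series when the terms with the same
  multi-index are collected.  With pairs of multi-indices this gives products, with lists inverses.
\<close>
lemma expansion_regroup:
  fixes a :: "'i \<Rightarrow> 'k::{real_normed_field, banach}" and d :: "'i \<Rightarrow> 'n::finite \<Rightarrow> nat"
  assumes s: "s > 0" and N: "(\<lambda>\<iota>. norm (a \<iota>) * s ^ deg (d \<iota>)) summable_on I"
    and f: "\<And>x. x \<in> polydisc p s \<Longrightarrow> ((\<lambda>\<iota>. a \<iota> * mon (d \<iota>) (x - p)) has_sum f x) I"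
  shows "expansion (\<lambda>\<alpha>. infsum a {\<iota>\<in>I. d \<iota> = \<alpha>}) s p f"
proof -
  define B where "B \<alpha> = {\<iota>\<in>I. d \<iota> = \<alpha>}" for \<alpha>
  have tr: "(h has_sum y) I \<longleftrightarrow> ((\<lambda>(\<alpha>, \<iota>). h \<iota>) has_sum y) (Sigma UNIV B)"
    for h :: "'i \<Rightarrow> 'c::topological_comm_monoid_add" and y
    by (rule has_sum_reindex_bij_witness[where i = snd and j = "\<lambda>\<iota>. (d \<iota>, \<iota>)"]) (auto simp: B_def)
  have fib: "(\<lambda>\<iota>. norm (a \<iota>)) summable_on B \<alpha>" for \<alpha>
  proof -
    have "(\<lambda>\<iota>. norm (a \<iota>) * s ^ deg (d \<iota>)) summable_on B \<alpha>"
      by (rule summable_on_subset_banach[OF N]) (auto simp: B_def)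
    also have "?this \<longleftrightarrow> (\<lambda>\<iota>. norm (a \<iota>) * s ^ deg \<alpha>) summable_on B \<alpha>"
      by (rule summable_on_cong) (auto simp: B_def)
    finally show ?thesis using s by (simp add: summable_on_cmult_left')
  qed
  have N': "(\<lambda>(\<alpha>, \<iota>). norm (a \<iota>) * s ^ deg (d \<iota>)) summable_on Sigma UNIV B"
    using N unfolding summable_on_def tr .
  have "(\<lambda>\<alpha>. \<Sum>\<^sub>\<infinity>\<iota>\<in>B \<alpha>. norm (a \<iota>) * s ^ deg (d \<iota>)) summable_on UNIV"
    using summable_on_Sigma_banach[OF N'] .
  moreover have "(\<Sum>\<^sub>\<infinity>\<iota>\<in>B \<alpha>. norm (a \<iota>) * s ^ deg (d \<iota>)) = infsum (\<lambda>\<iota>. norm (a \<iota>)) (B \<alpha>) * s ^ deg \<alpha>" for \<alpha>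
    by (subst infsum_cmult_left'[symmetric], rule infsum_cong) (auto simp: B_def)
  ultimately have "(\<lambda>\<alpha>. infsum (\<lambda>\<iota>. norm (a \<iota>)) (B \<alpha>) * s ^ deg \<alpha>) summable_on UNIV" by simp
  then have 1: "(\<lambda>\<alpha>. norm (infsum a (B \<alpha>)) * s ^ deg \<alpha>) summable_on UNIV"
    by (rule summable_on_comparison_test) (use s fib in \<open>auto intro!: mult_right_mono norm_infsum_bound\<close>)
  have 2: "((\<lambda>\<alpha>. infsum a (B \<alpha>) * mon \<alpha> (x - p)) has_sum f x) UNIV" if "x \<in> polydisc p s" for x
  proof (rule has_sum_SigmaD)
    show "((\<lambda>(\<alpha>, \<iota>). a \<iota> * mon (d \<iota>) (x - p)) has_sum f x) (Sigma UNIV B)"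
      using f[OF that] unfolding tr .
    show "((\<lambda>\<iota>. case (\<alpha>, \<iota>) of (\<alpha>, \<iota>) \<Rightarrow> a \<iota> * mon (d \<iota>) (x - p)) has_sum infsum a (B \<alpha>) * mon \<alpha> (x - p)) (B \<alpha>)" for \<alpha>
    proof -
      have "((\<lambda>\<iota>. a \<iota> * mon \<alpha> (x - p)) has_sum infsum a (B \<alpha>) * mon \<alpha> (x - p)) (B \<alpha>)"
        by (intro has_sum_cmult_left has_sum_infsum abs_summable_summable[OF fib])
      also have "?this \<longleftrightarrow> ?thesis" by (rule has_sum_cong) (auto simp: B_def)
      finally show ?thesis .
    qed
  qed
  from s 1 2 show ?thesis by (simp add: expansion_def B_def)
qed

lemma analytic_germ_regroup:
  fixes a :: "'i \<Rightarrow> 'k::{real_normed_field, banach}" and d :: "'i \<Rightarrow> 'n::finite \<Rightarrow> nat"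
  assumes "s > 0" "(\<lambda>\<iota>. norm (a \<iota>) * s ^ deg (d \<iota>)) summable_on I"
    and "\<And>x. x \<in> polydisc p s \<Longrightarrow> ((\<lambda>\<iota>. a \<iota> * mon (d \<iota>) (x - p)) has_sum f x) I"
  shows "analytic_germ p f"
  using expansion_regroup[OF assms] by (auto simp: analytic_germ_def)

lemma analytic_germ_mon:
  fixes p :: "('k::{real_normed_field, banach})^'n::finite"
  shows "analytic_germ p (\<lambda>x. c * mon \<alpha> (x - p))"
  by (rule analytic_germ_regroup[where I = "{()}" and s = 1 and a = "\<lambda>_. c" and d = "\<lambda>_. \<alpha>"])
    (auto intro!: has_sum_finiteI)

lemma analytic_germ_const:
  fixes p :: "('k::{real_normed_field, banach})^'n::finite"
  shows "analytic_germ p (\<lambda>x. c)"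
  using analytic_germ_mon[of p c 0] by simp

lemma analytic_germ_add:
  fixes p :: "('k::{real_normed_field, banach})^'n::finite"
  assumes "analytic_germ p f" "analytic_germ p g"
  shows "analytic_germ p (\<lambda>x. f x + g x)"
proof -
  obtain a s b t where ab: "expansion a s p f" "expansion b t p g" using assms by (auto simp: analytic_germ_def)
  define u where "u = min s t"
  have "u > 0" using ab by (simp add: expansion_def u_def)
  then have ab: "expansion a u p f" "expansion b u p g"
    using expansion_shrink[OF ab(1), of u f] expansion_shrink[OF ab(2), of u g] by (simp_all add: u_def)
  have "(\<lambda>\<alpha>. norm (a \<alpha> + b \<alpha>) * u ^ deg \<alpha>) summable_on UNIV"
  proof (rule summable_on_comparison_test)
    show "(\<lambda>\<alpha>. norm (a \<alpha>) * u ^ deg \<alpha> + norm (b \<alpha>) * u ^ deg \<alpha>) summable_on UNIV"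
      using ab by (intro summable_on_add) (simp_all add: expansion_def)
    show "norm (a \<alpha> + b \<alpha>) * u ^ deg \<alpha> \<le> norm (a \<alpha>) * u ^ deg \<alpha> + norm (b \<alpha>) * u ^ deg \<alpha>" for \<alpha>
      using \<open>u > 0\<close> mult_right_mono[OF norm_triangle_ineq, of "u ^ deg \<alpha>"] by (simp add: distrib_right)
  qed (use \<open>u > 0\<close> in auto)
  moreover have "((\<lambda>\<alpha>. (a \<alpha> + b \<alpha>) * mon \<alpha> (x - p)) has_sum (f x + g x)) UNIV" if "x \<in> polydisc p u" for x
    unfolding distrib_right by (rule has_sum_add) (use ab that in \<open>auto simp: expansion_def\<close>)
  ultimately have "expansion (\<lambda>\<alpha>. a \<alpha> + b \<alpha>) u p (\<lambda>x. f x + g x)"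
    using \<open>u > 0\<close> by (simp add: expansion_def)
  then show ?thesis by (auto simp: analytic_germ_def)
qed

lemma expansion_abs_summable:
  assumes "expansion a s p f" "x \<in> polydisc p s"
  shows "(\<lambda>\<alpha>. norm (a \<alpha> * mon \<alpha> (x - p))) summable_on UNIV"
    "norm (a \<alpha> * mon \<alpha> (x - p)) \<le> norm (a \<alpha>) * s ^ deg \<alpha>"
proof -
  show *: "norm (a \<alpha> * mon \<alpha> (x - p)) \<le> norm (a \<alpha>) * s ^ deg \<alpha>" for \<alpha>
    using assms by (auto simp: norm_mult polydisc_def intro!: mult_left_mono norm_mon_le)
  show "(\<lambda>\<alpha>. norm (a \<alpha> * mon \<alpha> (x - p))) summable_on UNIV"
    by (rule summable_on_comparison_test[where f = "\<lambda>\<alpha>. norm (a \<alpha>) * s ^ deg \<alpha>"])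
      (use assms * in \<open>auto simp: expansion_def\<close>)
qed

lemma analytic_germ_mult:
  fixes p :: "('k::{real_normed_field, banach})^'n::finite"
  assumes "analytic_germ p f" "analytic_germ p g"
  shows "analytic_germ p (\<lambda>x. f x * g x)"
proof -
  obtain a s b t where ab: "expansion a s p f" "expansion b t p g" using assms by (auto simp: analytic_germ_def)
  define u where "u = min s t"
  have "u > 0" using ab by (simp add: expansion_def u_def)
  then have ab: "expansion a u p f" "expansion b u p g"
    using expansion_shrink[OF ab(1), of u f] expansion_shrink[OF ab(2), of u g] by (simp_all add: u_def)
  show ?thesis
  proof (rule analytic_germ_regroup[where I = "UNIV \<times> UNIV" and s = u and a = "\<lambda>(\<alpha>, \<beta>). a \<alpha> * b \<beta>" and d = "\<lambda>(\<alpha>, \<beta>). \<alpha> + \<beta>"])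
    have "(\<lambda>(\<alpha>, \<beta>). norm ((norm (a \<alpha>) * u ^ deg \<alpha>) * (norm (b \<beta>) * u ^ deg \<beta>))) summable_on UNIV \<times> UNIV"
      by (rule has_sum_product_abs(2)[OF has_sum_infsum _ has_sum_infsum])
        (use ab \<open>u > 0\<close> in \<open>auto simp: expansion_def abs_mult\<close>)
    then show "(\<lambda>\<iota>. norm (case \<iota> of (\<alpha>, \<beta>) \<Rightarrow> a \<alpha> * b \<beta>) * u ^ deg (case \<iota> of (\<alpha>, \<beta>) \<Rightarrow> \<alpha> + \<beta>)) summable_on UNIV \<times> UNIV"
      using \<open>u > 0\<close> by (simp add: case_prod_unfold norm_mult deg_add power_add abs_mult mult_ac)
    fix x assume x: "x \<in> polydisc p u"
    have "((\<lambda>(\<alpha>, \<beta>). (a \<alpha> * mon \<alpha> (x - p)) * (b \<beta> * mon \<beta> (x - p))) has_sum (f x * g x)) (UNIV \<times> UNIV)"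
      by (rule has_sum_product_abs(1)) (use ab x expansion_abs_summable(1)[OF ab(1) x] expansion_abs_summable(1)[OF ab(2) x] in \<open>auto simp: expansion_def\<close>)
    then show "((\<lambda>\<iota>. (case \<iota> of (\<alpha>, \<beta>) \<Rightarrow> a \<alpha> * b \<beta>) * mon (case \<iota> of (\<alpha>, \<beta>) \<Rightarrow> \<alpha> + \<beta>) (x - p)) has_sum (f x * g x)) (UNIV \<times> UNIV)"
      by (simp add: case_prod_unfold mon_add mult_ac)
  qed (rule \<open>u > 0\<close>)
qed

lemma analytic_germ_diff:
  fixes p :: "('k::{real_normed_field, banach})^'n::finite"
  assumes "analytic_germ p f" "analytic_germ p g"
  shows "analytic_germ p (\<lambda>x. f x - g x)"
  using analytic_germ_add[OF assms(1) analytic_germ_mult[OF analytic_germ_const[of p "-1"] assms(2)]] by simp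

text \<open>
  Without constant term the majorant at radius \<open>\<rho> s\<close> is at most \<open>\<rho>\<close> times the one at radius \<open>s\<close>.
\<close>
lemma expansion_small:
  fixes p :: "('k::{real_normed_field, banach})^'n::finite"
  assumes b: "expansion b s p u" "b 0 = 0"
  obtains t q where "expansion b t p u" "((\<lambda>\<alpha>. norm (b \<alpha>) * t ^ deg \<alpha>) has_sum q) UNIV" "q < 1"
proof -
  define K where "K = (\<Sum>\<^sub>\<infinity>\<alpha>. norm (b \<alpha>) * s ^ deg \<alpha>)"
  have s: "s > 0" and sK: "((\<lambda>\<alpha>. norm (b \<alpha>) * s ^ deg \<alpha>) has_sum K) UNIV"
    using b by (auto simp: expansion_def K_def)
  have K: "K \<ge> 0" by (rule has_sum_nonneg[OF sK]) (use s in auto)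
  \<comment> \<open>small enough that the majorant, at most \<open>\<rho> * K\<close>, is below 1\<close>
  define \<rho> where "\<rho> = 1 / (K + 2)"
  have \<rho>: "0 < \<rho>" "\<rho> \<le> 1" "\<rho> * K < 1" using K by (auto simp: \<rho>_def field_simps)
  have e: "expansion b (\<rho> * s) p u"
    by (rule expansion_shrink[OF b(1)]) (use s \<rho> in auto)
  then obtain q where q: "((\<lambda>\<alpha>. norm (b \<alpha>) * (\<rho> * s) ^ deg \<alpha>) has_sum q) UNIV"
    by (auto simp: expansion_def summable_on_def)
  have "q \<le> \<rho> * K"
  proof (rule has_sum_mono[OF q has_sum_cmult_right[OF sK]])
    fix \<alpha> :: "'n \<Rightarrow> nat"
    show "norm (b \<alpha>) * (\<rho> * s) ^ deg \<alpha> \<le> \<rho> * (norm (b \<alpha>) * s ^ deg \<alpha>)"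
    proof (cases "\<alpha> = 0")
      case False
      then have "\<rho> ^ deg \<alpha> \<le> \<rho> ^ 1" using \<rho> by (intro power_decreasing) (auto simp: Suc_le_eq)
      then have "\<rho> ^ deg \<alpha> * (norm (b \<alpha>) * s ^ deg \<alpha>) \<le> \<rho> * (norm (b \<alpha>) * s ^ deg \<alpha>)"
        using s by (intro mult_right_mono) auto
      then show ?thesis by (simp add: power_mult_distrib mult_ac)
    qed (use b in simp)
  qed
  with \<rho> have "q < 1" by simp
  with e q show thesis by (rule that)
qed

text \<open>
  Write \<open>f = f p * (1 - u)\<close> with \<open>u p = 0\<close> and expand \<open>1 / (1 - u)\<close> into a geometric series.
\<close>
lemma analytic_germ_inverse:
  fixes p :: "('k::{real_normed_field, banach})^'n::finite"
  assumes "analytic_germ p f" "f p \<noteq> 0"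
  shows "analytic_germ p (\<lambda>x. inverse (f x))"
proof -
  define u where "u x = 1 - inverse (f p) * f x" for x
  have "analytic_germ p u"
    unfolding u_def by (intro analytic_germ_diff analytic_germ_mult analytic_germ_const assms)
  then obtain b s where bs: "expansion b s p u" by (auto simp: analytic_germ_def)
  moreover have "b 0 = 0" using expansion_center[OF bs] assms by (simp add: u_def)
  ultimately obtain t q where b: "expansion b t p u" and q: "((\<lambda>\<alpha>. norm (b \<alpha>) * t ^ deg \<alpha>) has_sum q) UNIV" "q < 1"
    by (rule expansion_small)
  have t: "t > 0" using b by (simp add: expansion_def)
  have "analytic_germ p (\<lambda>x. 1 / (1 - u x))"
  proof (rule analytic_germ_regroup[where I = UNIV and s = t and a = "\<lambda>l. prod_list (map b l)" and d = sum_list])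
    have 1: "norm (prod_list (map b l)) * t ^ deg (sum_list l) = norm (prod_list (map (\<lambda>\<alpha>. norm (b \<alpha>) * t ^ deg \<alpha>) l))" for l
      using t by (induction l) (auto simp: norm_mult abs_mult deg_add power_add)
    show "(\<lambda>l. norm (prod_list (map b l)) * t ^ deg (sum_list l)) summable_on UNIV"
      unfolding 1 by (rule has_sum_lists(2)[OF q(1) _ q(2)]) (use q t in \<open>simp add: abs_mult\<close>)
    fix x assume x: "x \<in> polydisc p t"
    have 2: "prod_list (map b l) * mon (sum_list l) (x - p) = prod_list (map (\<lambda>\<alpha>. b \<alpha> * mon \<alpha> (x - p)) l)" for l
      by (induction l) (simp_all add: mon_add[unfolded plus_fun_def] mon_0[unfolded zero_fun_def] mon_add mult_ac)
    obtain q' where q': "((\<lambda>\<alpha>. norm (b \<alpha> * mon \<alpha> (x - p))) has_sum q') UNIV"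
      using expansion_abs_summable(1)[OF b x] by (auto simp: summable_on_def)
    have "q' \<le> q" by (rule has_sum_mono[OF q' q(1)]) (use expansion_abs_summable(2)[OF b x] in auto)
    then show "((\<lambda>l. prod_list (map b l) * mon (sum_list l) (x - p)) has_sum (1 / (1 - u x))) UNIV"
      unfolding 2 using q(2) b x by (intro has_sum_lists(1)[OF _ q']) (auto simp: expansion_def)
  qed (rule t)
  then have "analytic_germ p (\<lambda>x. inverse (f p) * (1 / (1 - u x)))"
    by (intro analytic_germ_mult analytic_germ_const)
  also have "(\<lambda>x. inverse (f p) * (1 / (1 - u x))) = (\<lambda>x. inverse (f x))"
    using assms by (auto simp: u_def field_simps)
  finally show ?thesis .
qed

lemma expansion_continuous:
  fixes p :: "('k::{real_normed_field, banach})^'n::finite"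
  assumes "expansion c s p f"
  shows "continuous_on (polydisc p s) f"
proof (rule uniform_limit_theorem)
  show "uniform_limit (polydisc p s) (\<lambda>F x. \<Sum>\<alpha>\<in>F. c \<alpha> * mon \<alpha> (x - p)) f (finite_subsets_at_top UNIV)"
    by (rule Weierstrass_m_test_general'[where M = "\<lambda>\<alpha>. norm (c \<alpha>) * s ^ deg \<alpha>"])
      (use assms expansion_abs_summable(2)[OF assms] in \<open>auto simp: expansion_def\<close>)
  show "\<forall>\<^sub>F F in finite_subsets_at_top UNIV. continuous_on (polydisc p s) (\<lambda>x. \<Sum>\<alpha>\<in>F. c \<alpha> * mon \<alpha> (x - p))"
    unfolding mon_def by (intro always_eventually allI continuous_intros)
qed simp

lemma analytic_germ_isCont:
  fixes p :: "('k::{real_normed_field, banach})^'n::finite"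
  assumes "analytic_germ p f"
  shows "isCont f p"
proof -
  obtain c s where c: "expansion c s p f" using assms by (auto simp: analytic_germ_def)
  then have "s > 0" by (simp add: expansion_def)
  moreover have "continuous_on (ball p s) f"
    using expansion_continuous[OF c] ball_subset_polydisc by (rule continuous_on_subset)
  ultimately show ?thesis by (simp add: continuous_on_eq_continuous_at)
qed

section \<open>Division of analytic functions by a coordinate\<close>

text \<open>
  Setting the coordinates in \<open>J\<close> to their values at \<open>q\<close>.
\<close>
definition freeze :: "'k^'n \<Rightarrow> 'n set \<Rightarrow> ('k::real_normed_field)^'n::finite \<Rightarrow> 'k^'n" where
  "freeze q J x = (\<chi> j. if j \<in> J then q $ j else x $ j)"

lemma freeze_nth [simp]: "freeze q J x $ j = (if j \<in> J then q $ j else x $ j)"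
  by (simp add: freeze_def)

lemma expansion_freeze:
  fixes p :: "('k::{real_normed_field, banach})^'n::finite"
  assumes c: "expansion c s (freeze q J p) f"
  shows "expansion (\<lambda>\<alpha>. if \<forall>j\<in>J. \<alpha> j = 0 then c \<alpha> else 0) s p (f \<circ> freeze q J)" (is "expansion ?d s p _")
  unfolding expansion_def
proof (intro conjI ballI)
  show "s > 0" using c by (simp add: expansion_def)
  show "(\<lambda>\<alpha>. norm (?d \<alpha>) * s ^ deg \<alpha>) summable_on UNIV"
    by (rule summable_on_comparison_test[where f = "\<lambda>\<alpha>. norm (c \<alpha>) * s ^ deg \<alpha>"])
      (use c in \<open>auto simp: expansion_def\<close>)
  fix x assume x: "x \<in> polydisc p s"
  have "((\<lambda>\<alpha>. c \<alpha> * mon \<alpha> (freeze q J x - freeze q J p)) has_sum f (freeze q J x)) UNIV"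
    using c x by (simp add: expansion_def polydisc_def)
  moreover have "c \<alpha> * mon \<alpha> (freeze q J x - freeze q J p) = ?d \<alpha> * mon \<alpha> (x - p)" for \<alpha>
    by (auto simp: mon_def intro!: prod.cong)
  ultimately show "((\<lambda>\<alpha>. ?d \<alpha> * mon \<alpha> (x - p)) has_sum (f \<circ> freeze q J) x) UNIV" by simp
qed

lemma analytic_germ_freeze:
  fixes p :: "('k::{real_normed_field, banach})^'n::finite"
  shows "analytic_germ (freeze q J p) f \<Longrightarrow> analytic_germ p (f \<circ> freeze q J)"
  unfolding analytic_germ_def using expansion_freeze by blast

definition unit_index :: "'n \<Rightarrow> 'n \<Rightarrow> nat" where
  "unit_index i j = (if j = i then 1 else 0)"

lemma mon_unit_index [simp]: "mon (unit_index i) y = y $ i"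
proof -
  have "mon (unit_index i) y = (\<Prod>j\<in>UNIV. if j = i then y $ j else 1)"
    unfolding mon_def unit_index_def by (rule prod.cong) auto
  then show ?thesis by simp
qed

lemma deg_unit_index [simp]: "deg (unit_index i) = 1"
  by (simp add: deg_def unit_index_def)

lemma analytic_germ_coordinate:
  fixes p :: "('k::{real_normed_field, banach})^'n::finite"
  shows "analytic_germ p (\<lambda>x. x $ i)"
  using analytic_germ_add[OF analytic_germ_mon[of p 1 "unit_index i"] analytic_germ_const[of p "p $ i"]] by simp

text \<open>
  The terms without \<open>x\<^sub>i - p\<^sub>i\<close> add up to \<open>f (freeze p {i} x)\<close>, and all others contain this factor.
\<close>
lemma expansion_divide:
  fixes p :: "('k::{real_normed_field, banach})^'n::finite"
  assumes c: "expansion c s p f"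
  obtains g where "expansion (\<lambda>\<beta>. c (\<beta> + unit_index i)) s p g"
    "\<And>x. x \<in> polydisc p s \<Longrightarrow> f x - f (freeze p {i} x) = (x $ i - p $ i) * g x"
proof -
  let ?\<delta> = "unit_index i"
  define g where "g x = (\<Sum>\<^sub>\<infinity>\<beta>. c (\<beta> + ?\<delta>) * mon \<beta> (x - p))" for x
  have s: "s > 0" and Nc: "(\<lambda>\<alpha>. norm (c \<alpha>) * s ^ deg \<alpha>) summable_on UNIV" using c by (auto simp: expansion_def)
  have inj: "inj (\<lambda>\<beta>. \<beta> + ?\<delta>)" by (auto intro: injI)
  have "(\<lambda>\<alpha>. norm (c \<alpha>) * s ^ deg \<alpha>) summable_on range (\<lambda>\<beta>. \<beta> + ?\<delta>)"
    by (rule summable_on_subset_banach[OF Nc]) auto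
  then have "(\<lambda>\<beta>. s * (norm (c (\<beta> + ?\<delta>)) * s ^ deg \<beta>)) summable_on UNIV"
    by (simp add: summable_on_reindex[OF inj] o_def deg_add mult_ac)
  then have N: "(\<lambda>\<beta>. norm (c (\<beta> + ?\<delta>)) * s ^ deg \<beta>) summable_on UNIV"
    using s by (simp add: summable_on_cmult_right')
  have sg: "((\<lambda>\<beta>. c (\<beta> + ?\<delta>) * mon \<beta> (x - p)) has_sum g x) UNIV" if x: "x \<in> polydisc p s" for x
    unfolding g_def
  proof (rule has_sum_infsum, rule abs_summable_summable, rule summable_on_comparison_test[OF N])
    show "norm (c (\<beta> + ?\<delta>) * mon \<beta> (x - p)) \<le> norm (c (\<beta> + ?\<delta>)) * s ^ deg \<beta>" for \<beta>
      using x by (auto simp: norm_mult polydisc_def intro!: mult_left_mono norm_mon_le)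
  qed auto
  have 1: "expansion (\<lambda>\<beta>. c (\<beta> + ?\<delta>)) s p g"
    using s N sg by (simp add: expansion_def)
  have frp: "freeze p {i} p = p" by (simp add: vec_eq_iff)
  note fr = expansion_freeze[of c s p "{i}" p f, unfolded frp, OF c]
  have 2: "f x - f (freeze p {i} x) = (x $ i - p $ i) * g x" if x: "x \<in> polydisc p s" for x
  proof -
    have lower: "(x $ i - p $ i) * (c ((\<lambda>j. \<alpha> j - ?\<delta> j) + ?\<delta>) * mon (\<lambda>j. \<alpha> j - ?\<delta> j) (x - p)) = c \<alpha> * mon \<alpha> (x - p)"
      if "\<alpha> i \<noteq> 0" for \<alpha>
    proof -
      have *: "(\<lambda>j. \<alpha> j - ?\<delta> j) + ?\<delta> = \<alpha>" using that by (auto simp: unit_index_def)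
      have "mon \<alpha> (x - p) = mon (\<lambda>j. \<alpha> j - ?\<delta> j) (x - p) * (x $ i - p $ i)"
        using mon_add[of "\<lambda>j. \<alpha> j - ?\<delta> j" ?\<delta> "x - p"] unfolding * by simp
      then show ?thesis unfolding * by (simp add: mult_ac)
    qed
    have "((\<lambda>\<alpha>. c \<alpha> * mon \<alpha> (x - p)) has_sum f x) UNIV"
      "((\<lambda>\<alpha>. - ((if \<forall>j\<in>{i}. \<alpha> j = 0 then c \<alpha> else 0) * mon \<alpha> (x - p))) has_sum - f (freeze p {i} x)) UNIV"
      using c fr x by (auto simp: expansion_def has_sum_uminus)
    from has_sum_add[OF this]
    have "((\<lambda>\<alpha>. if \<alpha> i = 0 then 0 else c \<alpha> * mon \<alpha> (x - p)) has_sum f x - f (freeze p {i} x)) UNIV"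
      by (simp add: if_distrib[of uminus] if_distrib[of "\<lambda>a. a * _"] if_distrib[of "\<lambda>a. _ + a"] cong: if_cong)
    also have "?this \<longleftrightarrow> ((\<lambda>\<alpha>. c \<alpha> * mon \<alpha> (x - p)) has_sum f x - f (freeze p {i} x)) {\<alpha>. \<alpha> i \<noteq> 0}"
      by (rule has_sum_cong_neutral) auto
    also have "\<dots> \<longleftrightarrow> ((\<lambda>\<beta>. (x $ i - p $ i) * (c (\<beta> + ?\<delta>) * mon \<beta> (x - p))) has_sum f x - f (freeze p {i} x)) UNIV"
      by (rule has_sum_reindex_bij_witness[where i = "\<lambda>\<beta>. \<beta> + ?\<delta>" and j = "\<lambda>\<alpha> j. \<alpha> j - ?\<delta> j"])
        (use lower in \<open>auto simp: fun_eq_iff unit_index_def\<close>)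
    finally show ?thesis
      using has_sum_cmult_right[OF sg[OF x], of "x $ i - p $ i"] has_sum_unique by blast
  qed
  from that[OF 1 2] show thesis .
qed

lemma continuous_axis [continuous_intros]:
  "continuous_on T f \<Longrightarrow> continuous_on T (\<lambda>t. axis i (f t) :: ('k::real_normed_field)^'n::finite)"
  unfolding axis_def
proof (rule continuous_on_vec_lambda)
  show "continuous_on T f \<Longrightarrow> continuous_on T (\<lambda>t. if j = i then f t else 0)" for j
    by (cases "j = i") auto
qed

lemma axis_0 [simp]: "axis i 0 = (0 :: ('k::real_normed_field)^'n::finite)"
  by (simp add: axis_def vec_eq_iff)

lemma open_axis_preimage:
  fixes S :: "(('k::real_normed_field)^'n::finite) set"
  assumes "open S" shows "open {t. x + axis i t \<in> S}"
proof -
  have "continuous_on UNIV (\<lambda>t. x + axis i t)" by (intro continuous_intros)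
  from open_vimage[OF assms this] show ?thesis by (simp add: vimage_def)
qed

text \<open>
  Off the hyperplane \<open>x\<^sub>i = q\<^sub>i\<close> the quotient is analytic because inverses are.  On the hyperplane it has
  to be the partial derivative, and near a point \<open>p\<close> of the hyperplane it is the power series
  of \<open>expansion_divide\<close>: that series is continuous, so its values on the hyperplane are limits of
  difference quotients.  In this way no power series has to be expanded around a second point.
\<close>
lemma analytic_division:
  fixes S :: "(('k::{real_normed_field, banach})^'n::finite) set"
  assumes S: "open S" and f: "\<And>p. p \<in> S \<Longrightarrow> analytic_germ p f"
    and fr: "\<And>x. x \<in> S \<Longrightarrow> freeze q {i} x \<in> S"
  obtains g where "\<And>p. p \<in> S \<Longrightarrow> analytic_germ p g"
    "\<And>x. x \<in> S \<Longrightarrow> f x - f (freeze q {i} x) = (x $ i - q $ i) * g x"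
proof -
  define g where "g x = (if x $ i = q $ i then partial i f x
     else (f x - f (freeze q {i} x)) * inverse (x $ i - q $ i))" for x
  have fr_id: "freeze q {i} x = x" if "x $ i = q $ i" for x using that by (simp add: vec_eq_iff)
  have eq: "f x - f (freeze q {i} x) = (x $ i - q $ i) * g x" for x
    by (simp add: g_def fr_id)
  have "analytic_germ p g" if p: "p \<in> S" for p
  proof (cases "p $ i = q $ i")
    case False
    have "open {x::'k^'n. x $ i \<noteq> q $ i}" by (intro open_Collect_neq continuous_intros)
    then have o: "open (S \<inter> {x. x $ i \<noteq> q $ i})" using S by auto
    have "analytic_germ p (\<lambda>x. (f x - (f \<circ> freeze q {i}) x) * inverse (x $ i - q $ i))"
      by (intro analytic_germ_mult analytic_germ_diff analytic_germ_inverse analytic_germ_coordinate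
          analytic_germ_const analytic_germ_freeze f fr p) (use False in auto)
    then show ?thesis
      by (rule analytic_germ_cong[OF _ o]) (use False p in \<open>auto simp: g_def\<close>)
  next
    case True
    obtain c s where cs: "expansion c s p f" using f[OF p] by (auto simp: analytic_germ_def)
    obtain r where r: "r > 0" "ball p r \<subseteq> S" using S p by (meson openE)
    obtain t where t: "0 < t" "polydisc p t \<subseteq> ball p r" using polydisc_subset_ball[OF r(1)] .
    have "s > 0" using cs by (simp add: expansion_def)
    then have c: "expansion c (min s t) p f" "polydisc p (min s t) \<subseteq> S" "min s t > 0"
      using polydisc_mono[of "min s t" t p] expansion_shrink[OF cs, of "min s t" f] r t by auto
    define u where "u = min s t"
    note c = c[folded u_def]
    obtain h where h: "expansion (\<lambda>\<beta>. c (\<beta> + unit_index i)) u p h"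
      "\<And>x. x \<in> polydisc p u \<Longrightarrow> f x - f (freeze p {i} x) = (x $ i - p $ i) * h x"
      using expansion_divide[OF c(1), where i = i] by blast
    have frpq: "freeze p {i} x = freeze q {i} x" for x using True by (simp add: vec_eq_iff)
    have "analytic_germ p h" using h by (auto simp: analytic_germ_def)
    then show ?thesis
    proof (rule analytic_germ_cong[where S = "ball p u"])
      fix x assume x: "x \<in> ball p u"
      then have xp: "x \<in> polydisc p u" by (rule subsetD[OF ball_subset_polydisc])
      show "h x = g x"
      proof (cases "x $ i = q $ i")
        case False
        then show ?thesis using h(2)[OF xp] eq[of x] True by (auto simp: frpq)
      next
        case xq: True
        have hc: "isCont h x"
          using expansion_continuous[OF h(1)] x ball_subset_polydisc[of p u] continuous_on_eq_continuous_at[OF open_ball]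
          by (metis continuous_on_subset)
        have "((\<lambda>t. h (x + axis i t)) \<longlongrightarrow> h (x + axis i 0)) (at 0)"
        proof -
          have "continuous_on UNIV (\<lambda>t. x + axis i t)" by (intro continuous_intros)
          then have "isCont (\<lambda>t. x + axis i t) 0" by (simp add: continuous_on_eq_continuous_at)
          then have "isCont (\<lambda>t. h (x + axis i t)) 0" by (rule isCont_o2) (use hc in simp)
          then show ?thesis by (simp add: isCont_def)
        qed
        moreover have "\<forall>\<^sub>F t in at 0. h (x + axis i t) = (f (x + axis i t) - f (x + axis i 0)) / t"
        proof -
          have "\<forall>\<^sub>F t in at 0. t \<in> {t. x + axis i t \<in> ball p u} \<and> t \<noteq> 0"
            using open_axis_preimage[OF open_ball, of x i p u] x
            by (auto simp: eventually_at_topological)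
          then show ?thesis
          proof eventually_elim
            case (elim t)
            have "freeze p {i} (x + axis i t) = x"
              using xq True by (auto simp: vec_eq_iff axis_def)
            moreover have "x + axis i t \<in> polydisc p u" using elim ball_subset_polydisc by blast
            then have "f (x + axis i t) - f (freeze p {i} (x + axis i t)) = t * h (x + axis i t)"
              using h(2)[of "x + axis i t"] xq True by (simp add: axis_def)
            ultimately show ?case
              using elim by (simp add: field_simps)
          qed
        qed
        ultimately have "((\<lambda>t. (f (x + axis i t) - f (x + axis i 0)) / t) \<longlongrightarrow> h x) (at 0)"
          by (auto elim: Lim_transform_eventually)
        then have "((\<lambda>t. f (x + axis i t)) has_field_derivative h x) (at 0)"
          by (simp add: has_field_derivative_iff)
        then show ?thesis using xq by (simp add: g_def partial_def DERIV_imp_deriv)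
      qed
    qed (use c in auto)
  qed
  with eq show thesis using that by blast
qed

section \<open>Smooth functions\<close>
lemma cont_diff_continuous: "cont_diff r S f \<Longrightarrow> continuous_on S f"
  by (cases r) auto

lemma cont_diff_SucD:
  "cont_diff (Suc r) S f \<Longrightarrow> x \<in> S \<Longrightarrow> ((\<lambda>t. f (x + axis i t)) has_field_derivative partial i f x) (at 0)"
  by (simp add: partial_def DERIV_deriv_iff_field_differentiable)

lemma cont_diff_cong:
  fixes S :: "(('k::real_normed_field)^'n::finite) set"
  assumes S: "open S" and "cont_diff r S f" and "\<And>x. x \<in> S \<Longrightarrow> f x = g x"
  shows "cont_diff r S g"
  using assms(2,3)
proof (induction r arbitrary: f g)
  case 0
  then show ?case by (simp cong: continuous_on_cong)
next
  case (Suc r)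
  have D: "((\<lambda>t. g (x + axis i t)) has_field_derivative partial i f x) (at 0)" if x: "x \<in> S" for x i
  proof (rule has_field_derivative_transform_within_open[OF cont_diff_SucD[OF Suc.prems(1) x] open_axis_preimage[OF S, of x i]])
  qed (use x Suc.prems in auto)
  then have p: "partial i f x = partial i g x" if "x \<in> S" for x i
    using DERIV_imp_deriv[OF D[OF that]] by (simp add: partial_def[of i g])
  have "cont_diff r S (partial i g)" for i
    by (rule Suc.IH[of "partial i f"]) (use Suc.prems p in auto)
  moreover have "continuous_on S g" using Suc.prems by (auto cong: continuous_on_cong)
  moreover have "(\<lambda>t. g (x + axis i t)) field_differentiable at 0" if "x \<in> S" for x i
    using D[OF that] by (auto simp: field_differentiable_def)
  ultimately show ?case by simp
qed

text \<open>
  The introduction rule with freely chosen derivatives, in place of the constant \<open>partial\<close>.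
\<close>
lemma cont_diff_SucI:
  fixes S :: "(('k::real_normed_field)^'n::finite) set"
  assumes S: "open S" and c: "continuous_on S f"
    and D: "\<And>i x. x \<in> S \<Longrightarrow> ((\<lambda>t. f (x + axis i t)) has_field_derivative f' i x) (at 0)"
    and r: "\<And>i. cont_diff r S (f' i)"
  shows "cont_diff (Suc r) S f"
proof -
  have "cont_diff r S (partial i f)" for i
    by (rule cont_diff_cong[OF S r[of i]]) (simp add: partial_def DERIV_imp_deriv[OF D])
  then show ?thesis using c D by (auto simp: field_differentiable_def)
qed

lemma cont_diff_Suc_imp: "cont_diff (Suc r) S f \<Longrightarrow> cont_diff r S f"
  by (induction r arbitrary: f) auto

lemma cont_diff_subset: "cont_diff r S f \<Longrightarrow> S' \<subseteq> S \<Longrightarrow> cont_diff r S' f"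
  by (induction r arbitrary: f) (auto intro: continuous_on_subset)

lemma cont_diff_const:
  fixes S :: "(('k::real_normed_field)^'n::finite) set"
  assumes S: "open S" shows "cont_diff r S (\<lambda>x. c)"
proof (induction r arbitrary: c)
  case (Suc r)
  show ?case by (rule cont_diff_SucI[OF S, where f' = "\<lambda>i x. 0"]) (use Suc in auto)
qed simp

lemma cont_diff_coordinate:
  fixes S :: "(('k::real_normed_field)^'n::finite) set"
  assumes S: "open S" shows "cont_diff r S (\<lambda>x. x $ j)"
proof (cases r)
  case (Suc r')
  show ?thesis unfolding Suc
  proof (rule cont_diff_SucI[OF S, where f' = "\<lambda>i x. if i = j then 1 else 0"])
    show "((\<lambda>t. (x + axis i t) $ j) has_field_derivative (if i = j then 1 else 0)) (at 0)" for i and x :: "'k^'n"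
      by (auto simp: axis_def intro!: derivative_eq_intros)
    show "cont_diff r' S (\<lambda>x. if i = j then 1 else 0)" for i using cont_diff_const[OF S] by auto
  qed (auto intro!: continuous_intros)
qed (auto intro!: continuous_intros)

lemma cont_diff_add:
  fixes S :: "(('k::real_normed_field)^'n::finite) set"
  assumes S: "open S" and "cont_diff r S f" "cont_diff r S g" shows "cont_diff r S (\<lambda>x. f x + g x)"
  using assms(2,3)
proof (induction r arbitrary: f g)
  case (Suc r)
  show ?case
  proof (rule cont_diff_SucI[OF S, where f' = "\<lambda>i x. partial i f x + partial i g x"])
    show "((\<lambda>t. f (x + axis i t) + g (x + axis i t)) has_field_derivative partial i f x + partial i g x) (at 0)"
      if "x \<in> S" for i x
      by (intro DERIV_add cont_diff_SucD[OF Suc.prems(1) that] cont_diff_SucD[OF Suc.prems(2) that])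
  qed (use Suc in \<open>auto intro: continuous_intros\<close>)
qed (auto intro: continuous_intros)

lemma cont_diff_mult:
  fixes S :: "(('k::real_normed_field)^'n::finite) set"
  assumes S: "open S" and "cont_diff r S f" "cont_diff r S g" shows "cont_diff r S (\<lambda>x. f x * g x)"
  using assms(2,3)
proof (induction r arbitrary: f g)
  case (Suc r)
  note fg = cont_diff_Suc_imp[OF Suc.prems(1)] cont_diff_Suc_imp[OF Suc.prems(2)]
  show ?case
  proof (rule cont_diff_SucI[OF S, where f' = "\<lambda>i x. partial i f x * g x + partial i g x * f x"])
    show "((\<lambda>t. f (x + axis i t) * g (x + axis i t)) has_field_derivative partial i f x * g x + partial i g x * f x) (at 0)"
      if "x \<in> S" for i x
      using DERIV_mult[OF cont_diff_SucD[OF Suc.prems(1) that, of i] cont_diff_SucD[OF Suc.prems(2) that, of i]] by simp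
    show "cont_diff r S (\<lambda>x. partial i f x * g x + partial i g x * f x)" for i
      by (intro cont_diff_add[OF S] Suc.IH fg) (use Suc.prems in auto)
  qed (use Suc in \<open>auto intro: continuous_intros\<close>)
qed (auto intro: continuous_intros)

lemma cont_diff_inverse:
  fixes S :: "(('k::real_normed_field)^'n::finite) set"
  assumes S: "open S" and "cont_diff r S f" and nz: "\<And>x. x \<in> S \<Longrightarrow> f x \<noteq> 0"
  shows "cont_diff r S (\<lambda>x. inverse (f x))"
  using assms(2)
proof (induction r)
  case (Suc r)
  note IH = Suc.IH[OF cont_diff_Suc_imp[OF Suc.prems]]
  show ?case
  proof (rule cont_diff_SucI[OF S, where f' = "\<lambda>i x. - 1 * (partial i f x * (inverse (f x) * inverse (f x)))"])
    show "((\<lambda>t. inverse (f (x + axis i t))) has_field_derivative - 1 * (partial i f x * (inverse (f x) * inverse (f x)))) (at 0)"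
      if "x \<in> S" for i x
      using DERIV_inverse_fun[OF cont_diff_SucD[OF Suc.prems that, of i]] nz[OF that] by (simp add: mult_ac power2_eq_square numeral_2_eq_2)
    show "cont_diff r S (\<lambda>x. - 1 * (partial i f x * (inverse (f x) * inverse (f x))))" for i
      by (intro cont_diff_mult[OF S] IH cont_diff_const[OF S]) (use Suc.prems in auto)
  qed (use Suc nz in \<open>auto intro!: continuous_intros\<close>)
qed (use nz in \<open>auto intro!: continuous_intros\<close>)

lemma continuous_on_freeze: "continuous_on T (freeze q J)"
proof -
  have "continuous_on T (\<lambda>x. if j \<in> J then q $ j else x $ j)" for j
    by (cases "j \<in> J") (auto intro!: continuous_intros)
  then show ?thesis
    unfolding freeze_def by (intro continuous_intros)
qed

lemma continuous_on_compose_freeze: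
  assumes "continuous_on S f" "\<And>x. x \<in> S \<Longrightarrow> freeze q J x \<in> S"
  shows "continuous_on S (\<lambda>x. f (freeze q J x))"
  by (rule continuous_on_compose2[OF assms(1) continuous_on_freeze]) (use assms(2) in auto)

lemma cont_diff_freeze:
  fixes S :: "(('k::real_normed_field)^'n::finite) set"
  assumes S: "open S" and fr: "\<And>x. x \<in> S \<Longrightarrow> freeze q J x \<in> S" and "cont_diff r S f"
  shows "cont_diff r S (\<lambda>x. f (freeze q J x))"
  using assms(3)
proof (induction r arbitrary: f)
  case 0
  then show ?case
    by (simp add: continuous_on_compose_freeze fr)
next
  case (Suc r)
  show ?case
  proof (rule cont_diff_SucI[OF S, where f' = "\<lambda>i x. if i \<in> J then 0 else partial i f (freeze q J x)"])
    show "continuous_on S (\<lambda>x. f (freeze q J x))"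
      by (rule continuous_on_compose_freeze[OF cont_diff_continuous[OF Suc.prems] fr])
    show "((\<lambda>t. f (freeze q J (x + axis i t))) has_field_derivative (if i \<in> J then 0 else partial i f (freeze q J x))) (at 0)"
      if "x \<in> S" for i x
    proof (cases "i \<in> J")
      case True
      then have "freeze q J (x + axis i t) = freeze q J x" for t by (auto simp: vec_eq_iff axis_def)
      with True show ?thesis by simp
    next
      case False
      then have "freeze q J (x + axis i t) = freeze q J x + axis i t" for t by (auto simp: vec_eq_iff axis_def)
      with False show ?thesis using cont_diff_SucD[OF Suc.prems fr[OF that]] by simp
    qed
    show "cont_diff r S (\<lambda>x. if i \<in> J then 0 else partial i f (freeze q J x))" for i
      using cont_diff_const[OF S] Suc by (cases "i \<in> J") auto
  qed
qed

section \<open>Division of smooth functions by a coordinate\<close>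

lemma ball_closer:
  fixes q :: "('k::real_normed_field)^'n::finite"
  assumes "x \<in> ball q r" and "\<And>j. norm (y $ j - q $ j) \<le> norm (x $ j - q $ j)"
  shows "y \<in> ball q r"
proof -
  have "norm (y - q) \<le> norm (x - q)"
    unfolding norm_vec_def by (rule L2_set_mono) (use assms in auto)
  then show ?thesis using assms(1) by (simp add: dist_norm norm_minus_commute)
qed

lemma freeze_in_ball: "x \<in> ball q r \<Longrightarrow> freeze q J x \<in> ball q r"
  by (erule ball_closer) auto

text \<open>
  The point with parameter \<open>t\<close> on the segment from \<open>freeze q {i} x\<close> to \<open>x\<close>.
\<close>
definition segment_pt :: "'k^'n \<Rightarrow> 'n \<Rightarrow> ('k::real_normed_field)^'n::finite \<Rightarrow> real \<Rightarrow> 'k^'n" where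
  "segment_pt q i x t = x + axis i ((of_real t - 1) * (x $ i - q $ i))"

lemma segment_pt_nth: "segment_pt q i x t $ j = (if j = i then q $ i + of_real t * (x $ i - q $ i) else x $ j)"
  by (simp add: segment_pt_def axis_def algebra_simps)

lemma segment_pt_in_ball:
  assumes "x \<in> ball q r" "t \<in> {0..1}"
  shows "segment_pt q i x t \<in> ball q r"
  using assms by (intro ball_closer[OF assms(1)]) (auto simp: segment_pt_nth norm_mult mult_left_le_one_le)

lemma segment_pt_shift:
  "segment_pt q i (x + axis j s) t = segment_pt q i x t + axis j ((if j = i then of_real t else 1) * s)"
  by (auto simp: vec_eq_iff segment_pt_nth axis_def algebra_simps)

lemma shifted_derivative:
  fixes f :: "('k::real_normed_field)^'n::finite \<Rightarrow> 'k"
  assumes "((\<lambda>t. f (x + axis i (c * s0) + axis i t)) has_field_derivative d) (at 0)"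
  shows "((\<lambda>s. f (x + axis i (c * s))) has_field_derivative c * d) (at s0 within T)"
proof -
  have "((\<lambda>s. f (x + axis i (c * s0) + axis i (c * (s - s0)))) has_field_derivative d * c) (at s0)"
    by (rule DERIV_chain2[where f = "\<lambda>t. f (x + axis i (c * s0) + axis i t)"])
      (use assms in \<open>auto intro!: derivative_eq_intros\<close>)
  moreover have "x + axis i (c * s0) + axis i (c * (s - s0)) = x + axis i (c * s)" for s
    by (simp add: vec_eq_iff axis_def algebra_simps)
  ultimately show ?thesis by (simp add: mult.commute has_field_derivative_at_within)
qed

text \<open>
  The factor \<open>t ^ m\<close> makes the class of these integrals closed under partial derivatives: the
  derivative in direction \<open>i\<close> produces one more factor \<open>t\<close>.
\<close>
definition segment_integral :: "'k^'n \<Rightarrow> 'n \<Rightarrow> nat \<Rightarrow> (('k::{real_normed_field, banach})^'n::finite \<Rightarrow> 'k) \<Rightarrow> 'k^'n \<Rightarrow> 'k" where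
  "segment_integral q i m f x = integral (cbox 0 1) (\<lambda>t. of_real (t ^ m) * f (segment_pt q i x t))"

lemma continuous_on_segment:
  fixes q :: "('k::{real_normed_field, banach})^'n::finite" and f :: "'k^'n \<Rightarrow> 'k"
  assumes f: "continuous_on (ball q r) f"
    and p: "continuous_on T (\<lambda>z. p z)" "\<And>z. z \<in> T \<Longrightarrow> p z \<in> ball q r"
    and t: "continuous_on T \<tau>" "\<And>z. z \<in> T \<Longrightarrow> \<tau> z \<in> {0..1}"
  shows "continuous_on T (\<lambda>z. of_real (\<tau> z ^ m) * f (segment_pt q i (p z) (\<tau> z)))"
proof -
  have "continuous_on T (\<lambda>z. segment_pt q i (p z) (\<tau> z))"
    unfolding segment_pt_def by (intro continuous_intros p t)
  then have "continuous_on T (\<lambda>z. f (segment_pt q i (p z) (\<tau> z)))"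
    by (rule continuous_on_compose2[OF f]) (use segment_pt_in_ball[OF p(2) t(2)] in blast)
  then show ?thesis using t(1) by (auto intro!: continuous_intros)
qed

text \<open>
  Differentiation under the integral sign, by induction on the order.
\<close>
lemma cont_diff_segment_integral:
  fixes q :: "('k::{real_normed_field, banach})^'n::finite"
  assumes "cont_diff k (ball q r) f"
  shows "cont_diff k (ball q r) (segment_integral q i m f)"
  using assms
proof (induction k arbitrary: f m)
  have cont: "continuous_on (ball q r) (segment_integral q i m f)" if f: "continuous_on (ball q r) f" for f m
    unfolding segment_integral_def
    by (rule integral_continuous_on_param, unfold case_prod_unfold, rule continuous_on_segment[OF f])
      (auto intro!: continuous_intros)
  {
    case 0
    then show ?case using cont by simp
  next
    case (Suc k)
    define m' where "m' j = (if j = i then Suc m else m)" for j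
    show ?case
    proof (rule cont_diff_SucI[where f' = "\<lambda>j. segment_integral q i (m' j) (partial j f)"])
      show "continuous_on (ball q r) (segment_integral q i m f)"
        using cont cont_diff_continuous[OF Suc.prems] by blast
      show "cont_diff k (ball q r) (segment_integral q i (m' j) (partial j f))" for j
        by (rule Suc.IH) (use Suc.prems in simp)
      fix j x assume x: "x \<in> ball q r"
      define T where "T = {s. x + axis j s \<in> ball q r}"
      have oT: "open T" unfolding T_def by (rule open_axis_preimage) simp
      have lin: "x + axis j (u *\<^sub>R a + v *\<^sub>R b) = u *\<^sub>R (x + axis j a) + v *\<^sub>R (x + axis j b)"
        if "u + v = 1" for u v a b
      proof -
        have "u *\<^sub>R x + v *\<^sub>R x = x" using that by (simp flip: scaleR_add_left)
        then show ?thesis by (auto simp: vec_eq_iff axis_def algebra_simps)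
      qed
      have cT: "convex T"
      proof (rule convexI)
        fix a b and u v :: real assume "a \<in> T" "b \<in> T" "0 \<le> u" "0 \<le> v" "u + v = 1"
        then show "u *\<^sub>R a + v *\<^sub>R b \<in> T"
          unfolding T_def using convexD[OF convex_ball[of q r], of "x + axis j a" "x + axis j b" u v] lin[of u v a b]
          by simp
      qed
      have "((\<lambda>s. integral (cbox 0 1) (\<lambda>t. of_real (t ^ m) * f (segment_pt q i (x + axis j s) t)))
          has_field_derivative integral (cbox 0 1) (\<lambda>t. of_real (t ^ m' j) * partial j f (segment_pt q i (x + axis j 0) t)))
          (at 0 within T)"
      proof (rule leibniz_rule_field_derivative[OF _ _ _ _ cT])
        fix s and t :: real assume s: "s \<in> T" and t: "t \<in> cbox 0 1"
        define c :: 'k where "c = (if j = i then of_real t else 1)"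
        have "segment_pt q i (x + axis j s) t \<in> ball q r"
          using s t by (intro segment_pt_in_ball) (auto simp: T_def)
        from cont_diff_SucD[OF Suc.prems this, of j]
        have "((\<lambda>s. f (segment_pt q i x t + axis j (c * s))) has_field_derivative
            c * partial j f (segment_pt q i (x + axis j s) t)) (at s within T)"
          unfolding segment_pt_shift c_def[symmetric] by (rule shifted_derivative)
        from DERIV_cmult[OF this, of "of_real (t ^ m)"]
        show "((\<lambda>s. of_real (t ^ m) * f (segment_pt q i (x + axis j s) t)) has_field_derivative
            of_real (t ^ m' j) * partial j f (segment_pt q i (x + axis j s) t)) (at s within T)"
          unfolding segment_pt_shift c_def[symmetric] by (simp add: c_def m'_def mult_ac split: if_splits)
      next
        fix s assume s: "s \<in> T"
        show "(\<lambda>t. of_real (t ^ m) * f (segment_pt q i (x + axis j s) t)) integrable_on cbox 0 1"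
          by (rule integrable_continuous, rule continuous_on_segment[OF cont_diff_continuous[OF Suc.prems]])
            (use s in \<open>auto simp: T_def intro!: continuous_intros\<close>)
      next
        show "continuous_on (T \<times> cbox 0 1) (\<lambda>(s, t). of_real (t ^ m' j) * partial j f (segment_pt q i (x + axis j s) t))"
          unfolding case_prod_unfold
          by (rule continuous_on_segment[where r = r], rule cont_diff_continuous[of k])
            (use Suc.prems in \<open>auto simp: T_def intro!: continuous_intros\<close>)
      next
        show "0 \<in> T" using x by (simp add: T_def)
      qed
      moreover have "at 0 within T = at (0::'k)" by (rule at_within_open) (use oT x in \<open>auto simp: T_def\<close>)
      ultimately show "((\<lambda>t. segment_integral q i m f (x + axis j t)) has_field_derivative
          segment_integral q i (m' j) (partial j f) x) (at 0)"
        by (simp add: segment_integral_def)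
    qed simp
  }
qed

text \<open>
  The fundamental theorem of calculus along the segment (Hadamard's lemma in one coordinate).
\<close>
lemma segment_integral_partial:
  fixes q :: "('k::{real_normed_field, banach})^'n::finite"
  assumes f: "cont_diff 1 (ball q r) f" and x: "x \<in> ball q r"
  shows "f x - f (freeze q {i} x) = (x $ i - q $ i) * segment_integral q i 0 (partial i f) x"
proof -
  have f: "cont_diff (Suc 0) (ball q r) f" using f by simp
  define c where "c = x $ i - q $ i"
  define y where "y = freeze q {i} x"
  have y: "segment_pt q i x t = y + axis i (c * of_real t)" for t
    by (simp add: vec_eq_iff segment_pt_nth y_def c_def axis_def mult.commute)
  have D: "((\<lambda>t. f (segment_pt q i x t)) has_vector_derivative c * partial i f (segment_pt q i x t)) (at t within {0..1})"
    if t: "t \<in> {0..1}" for t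
  proof -
    have "segment_pt q i x t \<in> ball q r" by (rule segment_pt_in_ball[OF x t])
    from cont_diff_SucD[OF f this, of i]
    have "((\<lambda>s. f (y + axis i (c * s))) has_field_derivative c * partial i f (segment_pt q i x t)) (at (of_real t) within UNIV)"
      unfolding y by (rule shifted_derivative)
    moreover have "(of_real has_vector_derivative (1::'k)) (at t within {0..1})"
      unfolding of_real_def by (auto intro!: derivative_eq_intros)
    ultimately have "((\<lambda>s. f (y + axis i (c * of_real s))) has_vector_derivative c * partial i f (segment_pt q i x t)) (at t within {0..1})"
      using field_vector_diff_chain_within[of of_real 1 t "{0..1}" "\<lambda>s. f (y + axis i (c * s))" "c * partial i f (segment_pt q i x t)"]
      by (simp add: o_def has_field_derivative_at_within)
    then show ?thesis by (simp only: y)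
  qed
  have endpoints: "segment_pt q i x 1 = x" "segment_pt q i x 0 = y"
    by (simp_all add: vec_eq_iff segment_pt_nth y_def)
  have "((\<lambda>t. c * partial i f (segment_pt q i x t)) has_integral
      f (segment_pt q i x 1) - f (segment_pt q i x 0)) {0..1}"
    by (rule fundamental_theorem_of_calculus) (use D in auto)
  from integral_unique[OF this]
  have "integral {0..1} (\<lambda>t. c * partial i f (segment_pt q i x t)) = f x - f y"
    unfolding endpoints .
  then show ?thesis
    by (simp add: segment_integral_def c_def y_def)
qed

section \<open>Regular functions\<close>
context
  fixes S :: "(('k::{real_normed_field, banach})^'n::finite) set" and reg :: regularity
  assumes S: "open S"
begin

lemma regular_on_subset:
  assumes "regular_on reg S f" "S' \<subseteq> S" shows "regular_on reg S' f"
proof (cases reg)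
  case Analytic
  with assms(1) have f: "power_series_on S f" by simp
  have "power_series_on S' f"
    unfolding power_series_on_def
  proof
    fix p assume "p \<in> S'"
    with f assms(2) obtain c r where "0 < r"
      "\<forall>x\<in>S \<inter> ball p r. ((\<lambda>\<alpha>. c \<alpha> * (\<Prod>i\<in>UNIV. (x $ i - p $ i) ^ \<alpha> i)) has_sum f x) UNIV"
      unfolding power_series_on_def by (meson subsetD)
    then show "\<exists>c r. 0 < r \<and> (\<forall>x\<in>S' \<inter> ball p r.
        ((\<lambda>\<alpha>. c \<alpha> * (\<Prod>i\<in>UNIV. (x $ i - p $ i) ^ \<alpha> i)) has_sum f x) UNIV)"
      using assms(2) by blast
  qed
  with Analytic show ?thesis by simp
qed (use assms in \<open>auto intro: cont_diff_subset\<close>)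

lemma regular_on_cong:
  assumes "regular_on reg S f" "\<And>x. x \<in> S \<Longrightarrow> f x = g x" shows "regular_on reg S g"
proof (cases reg)
  case Smooth
  then show ?thesis using assms by (auto intro: cont_diff_cong[OF S, of _ f])
next
  case Analytic
  then show ?thesis using assms
    by (auto simp: power_series_on_iff_germ[OF S] intro: analytic_germ_cong[OF _ S, of _ f])
qed

lemma regular_on_const: "regular_on reg S (\<lambda>x. c)"
  by (cases reg) (auto simp: power_series_on_iff_germ[OF S] intro: analytic_germ_const cont_diff_const[OF S])

lemma regular_on_coordinate: "regular_on reg S (\<lambda>x. x $ i)"
  by (cases reg) (auto simp: power_series_on_iff_germ[OF S] intro: analytic_germ_coordinate cont_diff_coordinate[OF S])

lemma regular_on_add:
  assumes "regular_on reg S f" "regular_on reg S g" shows "regular_on reg S (\<lambda>x. f x + g x)"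
  using assms
  by (cases reg) (auto simp: power_series_on_iff_germ[OF S] intro: analytic_germ_add cont_diff_add[OF S])

lemma regular_on_mult:
  assumes "regular_on reg S f" "regular_on reg S g" shows "regular_on reg S (\<lambda>x. f x * g x)"
  using assms
  by (cases reg) (auto simp: power_series_on_iff_germ[OF S] intro: analytic_germ_mult cont_diff_mult[OF S])

lemma regular_on_inverse:
  assumes "regular_on reg S f" "\<And>x. x \<in> S \<Longrightarrow> f x \<noteq> 0" shows "regular_on reg S (\<lambda>x. inverse (f x))"
  using assms
  by (cases reg) (auto simp: power_series_on_iff_germ[OF S] intro: analytic_germ_inverse cont_diff_inverse[OF S])

lemma regular_on_continuous:
  assumes "regular_on reg S f" shows "continuous_on S f"
proof (cases reg)
  case Smooth
  then show ?thesis using assms cont_diff_continuous by auto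
next
  case Analytic
  then show ?thesis using assms analytic_germ_isCont
    by (auto simp: power_series_on_iff_germ[OF S] intro: continuous_at_imp_continuous_on)
qed

end

lemma regular_on_freeze:
  fixes q :: "('k::{real_normed_field, banach})^'n::finite"
  assumes "regular_on reg (ball q r) f"
  shows "regular_on reg (ball q r) (\<lambda>x. f (freeze q J x))"
proof (cases reg)
  case Smooth
  then show ?thesis using assms cont_diff_freeze[OF open_ball freeze_in_ball, where f = f] by auto
next
  case Analytic
  have "analytic_germ p (f \<circ> freeze q J)" if "p \<in> ball q r" for p
    using assms freeze_in_ball[OF that] Analytic
    by (intro analytic_germ_freeze) (simp only: regular_on.simps power_series_on_iff_germ[OF open_ball])
  then show ?thesis using Analytic by (simp add: power_series_on_iff_germ o_def)
qed

lemma regular_on_division: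
  fixes q :: "('k::{real_normed_field, banach})^'n::finite"
  assumes f: "regular_on reg (ball q r) f"
  obtains g where "regular_on reg (ball q r) g"
    "\<And>x. x \<in> ball q r \<Longrightarrow> f x - f (freeze q {i} x) = (x $ i - q $ i) * g x"
proof (cases reg)
  case Smooth
  show thesis
  proof (rule that)
    have "cont_diff k (ball q r) (partial i f)" for k
      using f Smooth cont_diff.simps(2)[of k "ball q r" f] by simp
    then show "regular_on reg (ball q r) (segment_integral q i 0 (partial i f))"
      using Smooth by (simp add: cont_diff_segment_integral)
    show "f x - f (freeze q {i} x) = (x $ i - q $ i) * segment_integral q i 0 (partial i f) x"
      if "x \<in> ball q r" for x
      by (rule segment_integral_partial[OF _ that]) (use f Smooth in simp)
  qed
next
  case Analytic
  obtain g where "\<And>p. p \<in> ball q r \<Longrightarrow> analytic_germ p g"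
    "\<And>x. x \<in> ball q r \<Longrightarrow> f x - f (freeze q {i} x) = (x $ i - q $ i) * g x"
  proof (rule analytic_division[OF open_ball[of q r], of f q i])
    show "analytic_germ p f" if "p \<in> ball q r" for p
      using f Analytic that by (simp only: regular_on.simps power_series_on_iff_germ[OF open_ball])
  qed (use freeze_in_ball in auto)
  then show thesis
    using that[of g] Analytic by (simp add: power_series_on_iff_germ)
qed

section \<open>The structure sheaf\<close>

lemma frestr_apply [simp]: "frestr V f x = (if x \<in> V then f x else 0)"
  by (simp add: frestr_def)

lemma frestr_frestr: "W \<subseteq> V \<Longrightarrow> frestr W (frestr V f) = frestr W f"
  by (auto simp: fun_eq_iff)

locale manifold_sheaf =
  fixes reg :: regularity and n :: "'n::finite itself"
    and \<O> :: "('m::{t2_space, second_countable_topology}, 'k::{real_normed_field, banach}) func_sheaf"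
  assumes manifold: "manifold reg n \<O>"
begin

abbreviation tangent_sheaf ("\<T>") where
  "\<T> \<equiv> tangent \<O>"

lemma func_off: "open V \<Longrightarrow> f \<in> \<O> V \<Longrightarrow> x \<notin> V \<Longrightarrow> f x = 0"
  using manifold unfolding manifold_def func_sheaf_def by (metis frestr_apply)

lemma func_frestr_self: "open V \<Longrightarrow> f \<in> \<O> V \<Longrightarrow> frestr V f = f"
  using func_off by (auto simp: fun_eq_iff)

lemma func_Union_iff:
  assumes "\<And>V. V \<in> \<V> \<Longrightarrow> open V" "\<And>x. x \<notin> \<Union>\<V> \<Longrightarrow> f x = 0"
  shows "f \<in> \<O> (\<Union>\<V>) \<longleftrightarrow> (\<forall>V\<in>\<V>. frestr V f \<in> \<O> V)"
proof -
  have "frestr (\<Union>\<V>) f = f" using assms(2) by (fastforce simp: fun_eq_iff)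
  moreover have "func_sheaf \<O>" using manifold by (simp add: manifold_def)
  ultimately show ?thesis using assms(1) by (simp add: func_sheaf_def)
qed

lemma func_restrict:
  assumes "open V" "open W" "W \<subseteq> V" "f \<in> \<O> V" shows "frestr W f \<in> \<O> W"
proof -
  have V: "\<Union>{V, W} = V" using assms by auto
  have "f \<in> \<O> (\<Union>{V, W}) \<longleftrightarrow> (\<forall>V'\<in>{V, W}. frestr V' f \<in> \<O> V')"
    by (rule func_Union_iff) (use assms func_off V in auto)
  then show ?thesis using assms V by auto
qed

lemma func_if_local:
  assumes "open V" "\<And>x. x \<notin> V \<Longrightarrow> f x = 0"
    and "\<And>p. p \<in> V \<Longrightarrow> \<exists>W. open W \<and> p \<in> W \<and> W \<subseteq> V \<and> frestr W f \<in> \<O> W"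
  shows "f \<in> \<O> V"
proof -
  define \<V> where "\<V> = {W. open W \<and> W \<subseteq> V \<and> frestr W f \<in> \<O> W}"
  have "\<Union>\<V> = V" using assms(3) by (fastforce simp: \<V>_def)
  moreover have "f \<in> \<O> (\<Union>\<V>) \<longleftrightarrow> (\<forall>V\<in>\<V>. frestr V f \<in> \<O> V)"
    by (rule func_Union_iff) (use assms(2) calculation in \<open>auto simp: \<V>_def\<close>)
  ultimately show ?thesis by (auto simp: \<V>_def)
qed

lemma chart_around:
  obtains D and S :: "('k^'n) set" and h g where "p \<in> D" "chart reg \<O> D S h g"
  using manifold unfolding manifold_def by blast

lemma chart_open_image:
  fixes S :: "('k^'n) set"
  assumes "chart reg \<O> D S h g" "open W" "W \<subseteq> D"
  shows "open (h ` W)" "h ` W \<subseteq> S" "\<And>x. x \<in> W \<Longrightarrow> g (h x) = x" "\<And>y. y \<in> h ` W \<Longrightarrow> h (g y) = y \<and> g y \<in> W"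
proof -
  from assms have hom: "homeomorphism D S h g" and oS: "open S" by (auto simp: chart_def)
  show gh: "g (h x) = x" if "x \<in> W" for x using hom that assms(3) by (auto simp: homeomorphism_def)
  show sub: "h ` W \<subseteq> S" using hom assms(3) by (auto simp: homeomorphism_def)
  show "h (g y) = y \<and> g y \<in> W" if "y \<in> h ` W" for y using gh that by auto
  have "openin (top_of_set S) (h ` W)"
    using homeomorphism_imp_open_map[OF hom] assms by (metis openin_open_eq openin_open Int_absorb1 chart_def)
  then show "open (h ` W)" using oS openin_open_eq by blast
qed

lemma func_chart_iff:
  fixes S :: "('k^'n) set"
  assumes ch: "chart reg \<O> D S h g" and W: "open W" "W \<subseteq> D"
  shows "frestr W f \<in> \<O> W \<longleftrightarrow> regular_on reg (h ` W) (f \<circ> g)"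
proof -
  note im = chart_open_image[OF ch W]
  have "frestr W f \<in> \<O> W \<longleftrightarrow> regular_on reg (h ` W) (frestr W f \<circ> g)"
    using ch W unfolding chart_def by (simp add: frestr_frestr)
  also have "\<dots> \<longleftrightarrow> regular_on reg (h ` W) (f \<circ> g)"
    using im(4) by (intro iffI; elim regular_on_cong[OF im(1)]) auto
  finally show ?thesis .
qed

lemma func_chartD:
  fixes S :: "('k^'n) set"
  assumes "chart reg \<O> D S h g" "open V" "f \<in> \<O> V"
  shows "regular_on reg (h ` (V \<inter> D)) (f \<circ> g)"
proof -
  have "open D" using assms by (simp add: chart_def)
  then show ?thesis
    using func_chart_iff[OF assms(1), of "V \<inter> D" f] func_restrict[of V "V \<inter> D" f] assms by auto
qed

text \<open>
  Membership in the sheaf is local, so that it suffices to look at the parts of \<open>V\<close> inside charts.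
\<close>
lemma func_if_charts:
  assumes "open V" "\<And>x. x \<notin> V \<Longrightarrow> f x = 0"
    and "\<And>D (S :: ('k^'n) set) h g. chart reg \<O> D S h g \<Longrightarrow> open (h ` (V \<inter> D)) \<Longrightarrow>
      (\<And>y. y \<in> h ` (V \<inter> D) \<Longrightarrow> g y \<in> V) \<Longrightarrow> regular_on reg (h ` (V \<inter> D)) (f \<circ> g)"
  shows "f \<in> \<O> V"
proof (rule func_if_local[OF assms(1,2)])
  fix p assume p: "p \<in> V"
  obtain D and S :: "('k^'n) set" and h g where D: "p \<in> D" "chart reg \<O> D S h g" by (rule chart_around)
  have oD: "open D" using D by (simp add: chart_def)
  then have "open (V \<inter> D)" using assms by auto
  note im = chart_open_image[OF D(2) this]
  have "frestr (V \<inter> D) f \<in> \<O> (V \<inter> D)"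
    using func_chart_iff[OF D(2) \<open>open (V \<inter> D)\<close>] assms(3)[OF D(2)] im by auto
  then show "\<exists>W. open W \<and> p \<in> W \<and> W \<subseteq> V \<and> frestr W f \<in> \<O> W"
    using p D \<open>open (V \<inter> D)\<close> by blast
qed

lemma func_const:
  assumes "open V" shows "frestr V (\<lambda>_. c) \<in> \<O> V"
proof (rule func_if_charts[OF assms])
  fix D and S :: "('k^'n) set" and h :: "'m \<Rightarrow> 'k^'n" and g
  assume o: "open (h ` (V \<inter> D))" and g: "\<And>y. y \<in> h ` (V \<inter> D) \<Longrightarrow> g y \<in> V"
  show "regular_on reg (h ` (V \<inter> D)) (frestr V (\<lambda>_. c) \<circ> g)"
    by (rule regular_on_cong[OF o regular_on_const[OF o, of reg c]]) (use g in auto)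
qed auto

lemma func_add [simp]:
  assumes "open V" "f \<in> \<O> V" "g \<in> \<O> V" shows "f + g \<in> \<O> V"
proof (rule func_if_charts[OF assms(1)])
  fix D and S :: "('k^'n) set" and h :: "'m \<Rightarrow> 'k^'n" and c
  assume ch: "chart reg \<O> D S h c" and o: "open (h ` (V \<inter> D))"
  show "regular_on reg (h ` (V \<inter> D)) ((f + g) \<circ> c)"
    using regular_on_add[OF o func_chartD[OF ch assms(1,2)] func_chartD[OF ch assms(1,3)]]
    by (simp add: o_def)
qed (use func_off[OF assms(1,2)] func_off[OF assms(1,3)] assms in simp_all)

lemma func_mult [simp]:
  assumes "open V" "f \<in> \<O> V" "g \<in> \<O> V" shows "f * g \<in> \<O> V"
proof (rule func_if_charts[OF assms(1)])
  fix D and S :: "('k^'n) set" and h :: "'m \<Rightarrow> 'k^'n" and c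
  assume ch: "chart reg \<O> D S h c" and o: "open (h ` (V \<inter> D))"
  show "regular_on reg (h ` (V \<inter> D)) ((f * g) \<circ> c)"
    using regular_on_mult[OF o func_chartD[OF ch assms(1,2)] func_chartD[OF ch assms(1,3)]]
    by (simp add: o_def)
qed (use func_off[OF assms(1,2)] func_off[OF assms(1,3)] assms in simp_all)

lemma func_cmult [simp]:
  assumes "open V" "f \<in> \<O> V" shows "(\<lambda>_. c) * f \<in> \<O> V"
proof -
  have "(\<lambda>_. c) * f = frestr V (\<lambda>_. c) * f" using func_off[OF assms] by (auto simp: fun_eq_iff)
  then show ?thesis using assms func_const by auto
qed

lemma func_zero [simp]: "open V \<Longrightarrow> 0 \<in> \<O> V"
  using func_const[of V 0] by (simp add: frestr_def zero_fun_def)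

lemma func_uminus [simp]: "open V \<Longrightarrow> f \<in> \<O> V \<Longrightarrow> - f \<in> \<O> V"
  using func_cmult[of V f "-1"] by (simp add: fun_Compl_def times_fun_def)

lemma func_diff [simp]: "open V \<Longrightarrow> f \<in> \<O> V \<Longrightarrow> g \<in> \<O> V \<Longrightarrow> f - g \<in> \<O> V"
  using func_add[of V f "- g"] by simp

lemma func_sum [simp]: "open V \<Longrightarrow> (\<And>i. i \<in> I \<Longrightarrow> f i \<in> \<O> V) \<Longrightarrow> sum f I \<in> \<O> V"
  by (induction I rule: infinite_finite_induct) auto

lemma func_inverse:
  assumes "open V" "f \<in> \<O> V" "\<And>x. x \<in> V \<Longrightarrow> f x \<noteq> 0" shows "(\<lambda>x. inverse (f x)) \<in> \<O> V"
proof (rule func_if_charts[OF assms(1)])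
  fix D and S :: "('k^'n) set" and h :: "'m \<Rightarrow> 'k^'n" and c
  assume ch: "chart reg \<O> D S h c" and o: "open (h ` (V \<inter> D))" and c: "\<And>y. y \<in> h ` (V \<inter> D) \<Longrightarrow> c y \<in> V"
  show "regular_on reg (h ` (V \<inter> D)) ((\<lambda>x. inverse (f x)) \<circ> c)"
    using regular_on_inverse[OF o func_chartD[OF ch assms(1,2)]] c assms(3)
    by (simp add: o_def)
qed (use func_off[OF assms(1,2)] in simp)

lemma func_coordinate:
  fixes S :: "('k^'n) set"
  assumes ch: "chart reg \<O> D S h g" and V: "open V" "V \<subseteq> D"
  shows "frestr V (\<lambda>p. h p $ i) \<in> \<O> V"
proof -
  note im = chart_open_image[OF ch V]
  have "regular_on reg (h ` V) ((\<lambda>p. h p $ i) \<circ> g)"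
    by (rule regular_on_cong[OF im(1) regular_on_coordinate[OF im(1), of reg i]]) (use im in auto)
  then show ?thesis using func_chart_iff[OF ch V] by blast
qed

lemma func_continuous:
  assumes V: "open V" and f: "f \<in> \<O> V" shows "continuous_on V f"
proof (rule continuous_at_imp_continuous_on, rule ballI)
  fix p assume p: "p \<in> V"
  obtain D and S :: "('k^'n) set" and h g where D: "p \<in> D" and ch: "chart reg \<O> D S h g" by (rule chart_around)
  have oVD: "open (V \<inter> D)" using ch V by (simp add: chart_def open_Int)
  note im = chart_open_image[OF ch oVD]
  have "continuous_on (h ` (V \<inter> D)) (f \<circ> g)"
    using regular_on_continuous[OF im(1) func_chartD[OF ch V f]] by auto
  moreover have "continuous_on (V \<inter> D) h"
    using ch unfolding chart_def homeomorphism_def by (meson Int_lower2 continuous_on_subset)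
  ultimately have "continuous_on (V \<inter> D) ((f \<circ> g) \<circ> h)" by (rule continuous_on_compose[rotated])
  also have "?this \<longleftrightarrow> continuous_on (V \<inter> D) f" using im(3) by (intro continuous_on_cong) auto
  finally show "isCont f p" using oVD p D continuous_on_eq_continuous_at by blast
qed

lemma func_nonzero_open:
  assumes "open V" "f \<in> \<O> V" shows "open {x \<in> V. f x \<noteq> 0}"
proof -
  have "open (f -` (- {0}) \<inter> V)"
    using func_continuous[OF assms] assms(1) by (simp add: continuous_on_open_vimage open_Compl)
  moreover have "f -` (- {0}) \<inter> V = {x \<in> V. f x \<noteq> 0}" by auto
  ultimately show ?thesis by simp
qed

end

section \<open>The tangent sheaf\<close>

lemma vrestr_apply: "vrestr V X W f = (if W \<subseteq> V then X W f else 0)"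
  by (simp add: vrestr_def)

lemma vrestr_vrestr [simp]: "W \<subseteq> V \<Longrightarrow> vrestr W (vrestr V X) = vrestr W X"
  by (auto simp: vrestr_def fun_eq_iff)

lemma vrestr_add: "vrestr V (X + Y) = vrestr V X + (vrestr V Y :: ('m, 'k::monoid_add) vfield)"
  by (auto simp: vrestr_def fun_eq_iff)

lemma vrestr_diff: "vrestr V (X - Y) = vrestr V X - (vrestr V Y :: ('m, 'k::group_add) vfield)"
  by (auto simp: vrestr_def fun_eq_iff)

lemma vrestr_0 [simp]: "vrestr V 0 = 0"
  by (auto simp: vrestr_def fun_eq_iff)

lemma vrestr_smult: "vrestr V (smult f X) = smult f (vrestr V X :: ('m, 'k::mult_zero) vfield)"
  by (auto simp: vrestr_def smult_def fun_eq_iff)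

lemma vrestr_bracket:
  "vrestr V (bracket X Y) = bracket (vrestr V X) (vrestr V Y :: ('m, 'k::group_add) vfield)"
  by (auto simp: vrestr_def bracket_def fun_eq_iff)

lemma vrestr_sum: "vrestr V (sum X I) = (\<Sum>i\<in>I. vrestr V (X i) :: ('m, 'k::comm_monoid_add) vfield)"
  by (induction I rule: infinite_finite_induct) (simp_all only: sum.infinite sum.empty sum.insert vrestr_add vrestr_0 not_False_eq_True)

lemma smult_add_right: "smult f (X + Y) = smult f X + (smult f Y :: ('m, 'k::ring) vfield)"
  by (auto simp: smult_def fun_eq_iff algebra_simps)

lemma smult_diff_right: "smult f (X - Y) = smult f X - (smult f Y :: ('m, 'k::ring) vfield)"
  by (auto simp: smult_def fun_eq_iff algebra_simps)

lemma smult_add_left: "smult (f + g) X = smult f X + (smult g X :: ('m, 'k::ring) vfield)"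
  by (auto simp: smult_def fun_eq_iff algebra_simps)

lemma smult_diff_left: "smult (f - g) X = smult f X - (smult g X :: ('m, 'k::ring) vfield)"
  by (auto simp: smult_def fun_eq_iff algebra_simps)

lemma smult_smult: "smult f (smult g X) = smult (f * g) (X :: ('m, 'k::ring) vfield)"
  by (auto simp: smult_def fun_eq_iff algebra_simps)

lemma smult_0 [simp]: "smult f 0 = (0 :: ('m, 'k::ring) vfield)" "smult 0 X = (0 :: ('m, 'k::ring) vfield)"
  by (auto simp: smult_def fun_eq_iff)

lemma smult_sum_left: "smult (sum f I) X = (\<Sum>i\<in>I. smult (f i) X :: ('m, 'k::ring) vfield)"
  by (induction I rule: infinite_finite_induct) (simp_all only: sum.infinite sum.empty sum.insert smult_add_left smult_0 not_False_eq_True)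

lemma vector_space_smult: "vector_space (\<lambda>l :: 'k::field. smult (\<lambda>_. l) :: ('m, 'k) vfield \<Rightarrow> _)"
  by unfold_locales (auto simp: smult_def fun_eq_iff algebra_simps)

context manifold_sheaf
begin

lemma tangent_off: "X \<in> \<T> V \<Longrightarrow> \<not> (open W \<and> W \<subseteq> V \<and> f \<in> \<O> W) \<Longrightarrow> X W f = 0"
  by (auto simp: tangent_def)

context
  fixes X V W assumes X: "X \<in> \<T> V" and W: "open W" "W \<subseteq> V"
begin

lemma tangent_func [simp]: "f \<in> \<O> W \<Longrightarrow> X W f \<in> \<O> W"
  using X W by (auto simp: tangent_def)

lemma tangent_add: "f \<in> \<O> W \<Longrightarrow> g \<in> \<O> W \<Longrightarrow> X W (f + g) = X W f + X W g"
  using X W by (auto simp: tangent_def)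

lemma tangent_cmult: "f \<in> \<O> W \<Longrightarrow> X W ((\<lambda>_. c) * f) = (\<lambda>_. c) * X W f"
  using X W by (auto simp: tangent_def)

lemma tangent_mult: "f \<in> \<O> W \<Longrightarrow> g \<in> \<O> W \<Longrightarrow> X W (f * g) = X W f * g + f * X W g"
  using X W by (auto simp: tangent_def)

lemma tangent_restrict:
  "open W' \<Longrightarrow> W' \<subseteq> W \<Longrightarrow> f \<in> \<O> W \<Longrightarrow> X W' (frestr W' f) = frestr W' (X W f)"
  using X W by (auto simp: tangent_def)

lemma tangent_diff: "f \<in> \<O> W \<Longrightarrow> g \<in> \<O> W \<Longrightarrow> X W (f - g) = X W f - X W g"
  using tangent_add[of "f - g" g] W(1) by simp

lemma tangent_const: "X W (frestr W (\<lambda>_. c)) = 0"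
proof -
  let ?u = "frestr W (\<lambda>_. 1 :: 'k)"
  have u: "?u \<in> \<O> W" by (rule func_const[OF W(1)])
  have uf: "?u * f = f" if "f \<in> \<O> W" for f using func_off[OF W(1) that] by (auto simp: fun_eq_iff)
  have "X W ?u = X W ?u + X W ?u"
    using tangent_mult[OF u u] uf[OF u] uf[OF tangent_func[OF u]] by (simp add: mult.commute)
  then have "X W ?u = 0" by simp
  moreover have "frestr W (\<lambda>_. c) = (\<lambda>_. c) * ?u" by (auto simp: fun_eq_iff)
  ultimately show ?thesis using tangent_cmult[OF u, of c] by simp
qed

end

lemma tangentI:
  assumes "\<And>W f. \<not> (open W \<and> W \<subseteq> V \<and> f \<in> \<O> W) \<Longrightarrow> X W f = 0"
    and "\<And>W f. open W \<Longrightarrow> W \<subseteq> V \<Longrightarrow> f \<in> \<O> W \<Longrightarrow> X W f \<in> \<O> W"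
    and "\<And>W f g. open W \<Longrightarrow> W \<subseteq> V \<Longrightarrow> f \<in> \<O> W \<Longrightarrow> g \<in> \<O> W \<Longrightarrow> X W (f + g) = X W f + X W g"
    and "\<And>W f c. open W \<Longrightarrow> W \<subseteq> V \<Longrightarrow> f \<in> \<O> W \<Longrightarrow> X W ((\<lambda>_. c) * f) = (\<lambda>_. c) * X W f"
    and "\<And>W f g. open W \<Longrightarrow> W \<subseteq> V \<Longrightarrow> f \<in> \<O> W \<Longrightarrow> g \<in> \<O> W \<Longrightarrow> X W (f * g) = X W f * g + f * X W g"
    and "\<And>W W' f. open W \<Longrightarrow> open W' \<Longrightarrow> W' \<subseteq> W \<Longrightarrow> W \<subseteq> V \<Longrightarrow> f \<in> \<O> W \<Longrightarrow> X W' (frestr W' f) = frestr W' (X W f)"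
  shows "X \<in> \<T> V"
  unfolding tangent_def mem_Collect_eq using assms by (intro conjI allI impI ballI) assumption+

lemma tangent_zero [simp]: "0 \<in> \<T> V"
  by (rule tangentI) (auto simp: fun_eq_iff)

lemma tangent_plus [simp]:
  assumes X: "X \<in> \<T> V" and Y: "Y \<in> \<T> V" shows "X + Y \<in> \<T> V"
proof (rule tangentI)
  show "\<not> (open W \<and> W \<subseteq> V \<and> f \<in> \<O> W) \<Longrightarrow> (X + Y) W f = 0" for W f
    using tangent_off[OF X] tangent_off[OF Y] by simp
  fix W assume W: "open W" "W \<subseteq> V"
  show "f \<in> \<O> W \<Longrightarrow> (X + Y) W f \<in> \<O> W" for f using W tangent_func[OF X W] tangent_func[OF Y W] by simp
  show "f \<in> \<O> W \<Longrightarrow> g \<in> \<O> W \<Longrightarrow> (X + Y) W (f + g) = (X + Y) W f + (X + Y) W g" for f g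
    using tangent_add[OF X W] tangent_add[OF Y W] by (simp add: algebra_simps)
  show "f \<in> \<O> W \<Longrightarrow> (X + Y) W ((\<lambda>_. c) * f) = (\<lambda>_. c) * (X + Y) W f" for f c
    using tangent_cmult[OF X W] tangent_cmult[OF Y W] by (simp add: algebra_simps)
  show "f \<in> \<O> W \<Longrightarrow> g \<in> \<O> W \<Longrightarrow> (X + Y) W (f * g) = (X + Y) W f * g + f * (X + Y) W g" for f g
    using tangent_mult[OF X W] tangent_mult[OF Y W] by (simp add: algebra_simps)
  show "open W' \<Longrightarrow> W' \<subseteq> W \<Longrightarrow> f \<in> \<O> W \<Longrightarrow> (X + Y) W' (frestr W' f) = frestr W' ((X + Y) W f)" for W' f
    using tangent_restrict[OF X W] tangent_restrict[OF Y W] by (auto simp: fun_eq_iff)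
qed

lemma tangent_smult_gen:
  assumes X: "X \<in> \<T> V" and F: "\<And>W f. open W \<Longrightarrow> W \<subseteq> V \<Longrightarrow> f \<in> \<O> W \<Longrightarrow> a * f \<in> \<O> W"
  shows "smult a X \<in> \<T> V"
proof (rule tangentI)
  show "\<not> (open W \<and> W \<subseteq> V \<and> f \<in> \<O> W) \<Longrightarrow> smult a X W f = 0" for W f
    using tangent_off[OF X] by (simp add: smult_def)
  fix W assume W: "open W" "W \<subseteq> V"
  show "f \<in> \<O> W \<Longrightarrow> smult a X W f \<in> \<O> W" for f
    using F[OF W] tangent_func[OF X W] by (simp add: smult_def)
  show "f \<in> \<O> W \<Longrightarrow> g \<in> \<O> W \<Longrightarrow> smult a X W (f + g) = smult a X W f + smult a X W g" for f g
    using tangent_add[OF X W] by (simp add: smult_def algebra_simps)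
  show "f \<in> \<O> W \<Longrightarrow> smult a X W ((\<lambda>_. c) * f) = (\<lambda>_. c) * smult a X W f" for f c
    using tangent_cmult[OF X W] by (simp add: smult_def mult_ac)
  show "f \<in> \<O> W \<Longrightarrow> g \<in> \<O> W \<Longrightarrow> smult a X W (f * g) = smult a X W f * g + f * smult a X W g" for f g
    using tangent_mult[OF X W] by (simp add: smult_def algebra_simps)
  show "open W' \<Longrightarrow> W' \<subseteq> W \<Longrightarrow> f \<in> \<O> W \<Longrightarrow> smult a X W' (frestr W' f) = frestr W' (smult a X W f)" for W' f
    using tangent_restrict[OF X W] by (auto simp: smult_def fun_eq_iff)
qed

lemma tangent_smult_const [simp]: "X \<in> \<T> V \<Longrightarrow> smult (\<lambda>_. c) X \<in> \<T> V"
  by (rule tangent_smult_gen) auto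

lemma tangent_smult [simp]:
  assumes "open V" "X \<in> \<T> V" "a \<in> \<O> V" shows "smult a X \<in> \<T> V"
proof (rule tangent_smult_gen[OF assms(2)])
  fix W f assume W: "open W" "W \<subseteq> V" "f \<in> \<O> W"
  have "a * f = frestr W a * f" using func_off[OF W(1,3)] by (auto simp: fun_eq_iff)
  then show "a * f \<in> \<O> W" using W func_restrict[OF assms(1) W(1,2) assms(3)] by simp
qed

lemma tangent_uminus [simp]: "X \<in> \<T> V \<Longrightarrow> - X \<in> \<T> V"
proof -
  assume "X \<in> \<T> V"
  moreover have "- X = smult (\<lambda>_. -1) X" by (auto simp: smult_def fun_eq_iff)
  ultimately show ?thesis by simp
qed

lemma tangent_minus [simp]: "X \<in> \<T> V \<Longrightarrow> Y \<in> \<T> V \<Longrightarrow> X - Y \<in> \<T> V"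
  using tangent_plus[of X V "- Y"] by simp

lemma tangent_sum: "(\<And>i. i \<in> I \<Longrightarrow> X i \<in> \<T> V) \<Longrightarrow> sum X I \<in> \<T> V"
  by (induction I rule: infinite_finite_induct) auto

lemma tangent_vrestr [simp]:
  assumes X: "X \<in> \<T> V" and U: "U \<subseteq> V" shows "vrestr U X \<in> \<T> U"
proof (rule tangentI)
  show "\<not> (open W \<and> W \<subseteq> U \<and> f \<in> \<O> W) \<Longrightarrow> vrestr U X W f = 0" for W f
    using tangent_off[OF X, of W f] by (auto simp: vrestr_def)
  fix W assume W: "open W" "W \<subseteq> U"
  then have W': "W \<subseteq> V" using U by auto
  note W1 = X W(1) W'
  show "f \<in> \<O> W \<Longrightarrow> vrestr U X W f \<in> \<O> W" for f using tangent_func[OF W1] W by (simp add: vrestr_def)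
  show "f \<in> \<O> W \<Longrightarrow> g \<in> \<O> W \<Longrightarrow> vrestr U X W (f + g) = vrestr U X W f + vrestr U X W g" for f g
    using tangent_add[OF W1] W by (simp add: vrestr_def)
  show "f \<in> \<O> W \<Longrightarrow> vrestr U X W ((\<lambda>_. c) * f) = (\<lambda>_. c) * vrestr U X W f" for f c
    using tangent_cmult[OF W1] W by (simp add: vrestr_def)
  show "f \<in> \<O> W \<Longrightarrow> g \<in> \<O> W \<Longrightarrow> vrestr U X W (f * g) = vrestr U X W f * g + f * vrestr U X W g" for f g
    using tangent_mult[OF W1] W by (simp add: vrestr_def)
  show "open W' \<Longrightarrow> W' \<subseteq> W \<Longrightarrow> f \<in> \<O> W \<Longrightarrow> vrestr U X W' (frestr W' f) = frestr W' (vrestr U X W f)" for W' f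
    using tangent_restrict[OF W1, of W' f] W by (simp add: vrestr_def)
qed

lemma vrestr_self [simp]:
  assumes X: "X \<in> \<T> V" shows "vrestr V X = X"
  using tangent_off[OF X] by (auto simp: vrestr_def fun_eq_iff)

text \<open>
  The values of a section vanish off the open set on which they are taken, so the multiplier may be
  changed there.
\<close>
lemma smult_frestr:
  assumes X: "X \<in> \<T> V" and V: "open V" shows "smult (frestr V f) X = smult f X"
proof (intro ext)
  fix W g x
  show "smult (frestr V f) X W g x = smult f X W g x"
  proof (cases "open W \<and> W \<subseteq> V \<and> g \<in> \<O> W")
    case True
    then have "X W g \<in> \<O> W" using X by simp
    then show ?thesis using func_off[of W "X W g" x] True by (auto simp: smult_def)
  qed (use tangent_off[OF X, of W g] in \<open>simp add: smult_def\<close>)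
qed

lemma tangent_eqI:
  assumes X: "X \<in> \<T> V" and Y: "Y \<in> \<T> V"
    and eq: "\<And>W f x. open W \<Longrightarrow> W \<subseteq> V \<Longrightarrow> f \<in> \<O> W \<Longrightarrow> x \<in> W \<Longrightarrow> X W f x = Y W f x"
  shows "X = Y"
proof (intro ext)
  fix W f x
  show "X W f x = Y W f x"
  proof (cases "open W \<and> W \<subseteq> V \<and> f \<in> \<O> W")
    case True
    then have "X W f \<in> \<O> W" "Y W f \<in> \<O> W" using X Y by auto
    then show ?thesis using True eq[of W f x] func_off[of W "X W f" x] func_off[of W "Y W f" x] by (cases "x \<in> W") auto
  qed (use tangent_off[OF X, of W f] tangent_off[OF Y, of W f] in simp)
qed

lemma tangent_local_value:
  assumes X: "X \<in> \<T> V" and "open W" "W \<subseteq> V" "f \<in> \<O> W" "open W'" "x \<in> W'"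
  shows "X W f x = (if x \<in> W then vrestr W' X (W \<inter> W') (frestr (W \<inter> W') f) x else 0)"
proof -
  have "open (W \<inter> W')" using assms by auto
  then have "X (W \<inter> W') (frestr (W \<inter> W') f) = frestr (W \<inter> W') (X W f)"
    using tangent_restrict[OF X assms(2,3)] assms(4) by simp
  then show ?thesis
    using func_off[OF assms(2) tangent_func[OF X assms(2-4)]] assms(6) by (auto simp: vrestr_def)
qed

lemma tangent_eq_if_local:
  assumes X: "X \<in> \<T> V" and Y: "Y \<in> \<T> V"
    and eq: "\<And>p. p \<in> V \<Longrightarrow> \<exists>W. open W \<and> p \<in> W \<and> vrestr W X = vrestr W Y"
  shows "X = Y"
proof (rule tangent_eqI[OF X Y])
  fix W f x assume W: "open W" "W \<subseteq> V" "f \<in> \<O> W" "x \<in> W"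
  then obtain W' where "open W'" "x \<in> W'" "vrestr W' X = vrestr W' Y" using eq by blast
  then show "X W f x = Y W f x"
    using tangent_local_value[OF X W(1-3), of W' x] tangent_local_value[OF Y W(1-3), of W' x] by simp
qed

text \<open>
  If \<open>X W f\<close> were non-zero at some point, it would be non-zero on an open set by continuity.
\<close>
lemma tangent_zero_if_generically_zero:
  assumes V: "open V" and X: "X \<in> \<T> V"
    and gen: "\<And>V1. open V1 \<Longrightarrow> V1 \<subseteq> V \<Longrightarrow> V1 \<noteq> {} \<Longrightarrow> \<exists>V2. open V2 \<and> V2 \<subseteq> V1 \<and> V2 \<noteq> {} \<and> vrestr V2 X = 0"
  shows "X = 0"
proof (rule tangent_eqI[OF X tangent_zero])
  fix W f x assume W: "open W" "W \<subseteq> V" "f \<in> \<O> W" "x \<in> W"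
  show "X W f x = 0 W f x"
  proof (rule ccontr)
    define V1 where "V1 = {x \<in> W. X W f x \<noteq> 0}"
    assume "\<not> ?thesis"
    then have "V1 \<noteq> {}" using W by (auto simp: V1_def)
    moreover have "open V1" unfolding V1_def by (rule func_nonzero_open) (use W X in auto)
    ultimately obtain V2 where V2: "open V2" "V2 \<subseteq> V1" "V2 \<noteq> {}" "vrestr V2 X = 0"
      using gen[of V1] W by (auto simp: V1_def)
    then obtain y where y: "y \<in> V2" by auto
    have "X W f y = 0"
      using tangent_local_value[OF X W(1-3) V2(1) y] V2(4) by simp
    then show False using y V2 by (auto simp: V1_def)
  qed
qed

text \<open>
  The glued section at \<open>x\<close> is computed with a chosen member \<open>c x\<close> of the cover; that the choice does not
  matter follows from the agreement on overlaps and makes all derivation laws local.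
\<close>
lemma tangent_glue:
  assumes o: "\<And>V. V \<in> \<V> \<Longrightarrow> open V" and F: "\<And>V. V \<in> \<V> \<Longrightarrow> F V \<in> \<T> V"
    and agree: "\<And>V V'. V \<in> \<V> \<Longrightarrow> V' \<in> \<V> \<Longrightarrow> vrestr (V \<inter> V') (F V) = vrestr (V \<inter> V') (F V')"
  obtains X where "X \<in> \<T> (\<Union>\<V>)" "\<And>V. V \<in> \<V> \<Longrightarrow> vrestr V X = F V"
proof -
  define c where "c x = (SOME V. V \<in> \<V> \<and> x \<in> V)" for x
  have c: "c x \<in> \<V>" "x \<in> c x" if "x \<in> \<Union>\<V>" for x
    using someI_ex[of "\<lambda>V. V \<in> \<V> \<and> x \<in> V"] that by (auto simp: c_def)
  define X where "X W f x = (if open W \<and> W \<subseteq> \<Union>\<V> \<and> f \<in> \<O> W \<and> x \<in> W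
      then F (c x) (W \<inter> c x) (frestr (W \<inter> c x) f) x else 0)" for W f x
  have X: "X W f x = F V (W \<inter> V) (frestr (W \<inter> V) f) x"
    if W: "open W" "W \<subseteq> \<Union>\<V>" "f \<in> \<O> W" "x \<in> W" and V: "V \<in> \<V>" "x \<in> V" for W f x V
  proof -
    have cx: "c x \<in> \<V>" "x \<in> c x" using c[OF subsetD[OF W(2,4)]] by auto
    have *: "F V1 (W \<inter> V1) (frestr (W \<inter> V1) f) x =
        vrestr (V1 \<inter> V2) (F V1) (W \<inter> (V1 \<inter> V2)) (frestr (W \<inter> (V1 \<inter> V2)) f) x"
      if "V1 \<in> \<V>" "V2 \<in> \<V>" "x \<in> V1" "x \<in> V2" for V1 V2
    proof -
      have O: "open (W \<inter> V1)" "W \<inter> V1 \<subseteq> V1" "open (W \<inter> (V1 \<inter> V2))" "W \<inter> (V1 \<inter> V2) \<subseteq> W \<inter> V1"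
        using W o that by auto
      have "F V1 (W \<inter> (V1 \<inter> V2)) (frestr (W \<inter> (V1 \<inter> V2)) (frestr (W \<inter> V1) f))
          = frestr (W \<inter> (V1 \<inter> V2)) (F V1 (W \<inter> V1) (frestr (W \<inter> V1) f))"
        by (rule tangent_restrict[OF F[OF that(1)] O func_restrict[OF W(1) O(1) _ W(3)]]) simp
      moreover have "W \<inter> (V1 \<inter> V2) \<subseteq> V1 \<inter> V2" by auto
      ultimately show ?thesis using that W by (simp add: vrestr_apply frestr_frestr[OF O(4)])
    qed
    show ?thesis
      using *[OF V(1) cx(1) V(2) cx(2)] *[OF cx(1) V(1) cx(2) V(2)] agree[OF V(1) cx(1)] W
      by (simp add: X_def Int_commute)
  qed
  have o': "open (W \<inter> V)" if "open W" "V \<in> \<V>" for W V using that o by auto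
  have XO: "X W f \<in> \<O> W" if W: "open W" "W \<subseteq> \<Union>\<V>" "f \<in> \<O> W" for W f
  proof (rule func_if_local[OF W(1)])
    fix p assume p: "p \<in> W"
    then obtain V where V: "V \<in> \<V>" "p \<in> V" using W by auto
    have "frestr (W \<inter> V) (X W f) = F V (W \<inter> V) (frestr (W \<inter> V) f)"
    proof
      fix x
      show "frestr (W \<inter> V) (X W f) x = F V (W \<inter> V) (frestr (W \<inter> V) f) x"
        using X[OF W, of x V] V func_off[OF o'[OF W(1) V(1)] tangent_func[OF F[OF V(1)] o'[OF W(1) V(1)] _ func_restrict[OF W(1) o'[OF W(1) V(1)] _ W(3)]], of x]
        by auto
    qed
    then have "frestr (W \<inter> V) (X W f) \<in> \<O> (W \<inter> V)"
      using tangent_func[OF F[OF V(1)] o'[OF W(1) V(1)] _ func_restrict[OF W(1) o'[OF W(1) V(1)] _ W(3)]] by simp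
    then show "\<exists>V'. open V' \<and> p \<in> V' \<and> V' \<subseteq> W \<and> frestr V' (X W f) \<in> \<O> V'"
      using o'[OF W(1) V(1)] p V by (intro exI[of _ "W \<inter> V"]) auto
  qed (simp add: X_def)
  have r: "frestr U (f + g) = frestr U f + frestr U g" "frestr U ((\<lambda>_. k) * f) = (\<lambda>_. k) * frestr U f"
    "frestr U (f * g) = frestr U f * frestr U g" for U k and f g :: "'m \<Rightarrow> 'k"
    by (auto simp: fun_eq_iff)
  have ext: "(\<And>x V. x \<in> W \<Longrightarrow> V \<in> \<V> \<Longrightarrow> x \<in> V \<Longrightarrow> f x = g x) \<Longrightarrow> f = g"
    if "open W" "W \<subseteq> \<Union>\<V>" "f \<in> \<O> W" "g \<in> \<O> W" for W and f g :: "'m \<Rightarrow> 'k"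
  proof
    fix x assume "\<And>x V. x \<in> W \<Longrightarrow> V \<in> \<V> \<Longrightarrow> x \<in> V \<Longrightarrow> f x = g x"
    then show "f x = g x" using that func_off[OF that(1,3), of x] func_off[OF that(1,4), of x] by (cases "x \<in> W") auto
  qed
  have XT: "X \<in> \<T> (\<Union>\<V>)"
  proof (rule tangentI)
    show "\<not> (open W \<and> W \<subseteq> \<Union>\<V> \<and> f \<in> \<O> W) \<Longrightarrow> X W f = 0" for W f
      by (auto simp: X_def fun_eq_iff)
    fix W assume W: "open W" "W \<subseteq> \<Union>\<V>"
    note XX = X[OF W]
    show "f \<in> \<O> W \<Longrightarrow> X W f \<in> \<O> W" for f using XO W by auto
    show "X W (f + g) = X W f + X W g" if "f \<in> \<O> W" "g \<in> \<O> W" for f g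
    proof (rule ext[OF W])
      fix x V assume V: "x \<in> W" "V \<in> \<V>" "x \<in> V"
      have O: "open (W \<inter> V)" "W \<inter> V \<subseteq> V" using o' W V by auto
      show "X W (f + g) x = (X W f + X W g) x"
        using XX[OF _ V] that W V O func_restrict[OF W(1) O(1)]
        by (simp add: r tangent_add[OF F[OF V(2)] O])
    qed (use that XO W in auto)
    show "X W ((\<lambda>_. k) * f) = (\<lambda>_. k) * X W f" if "f \<in> \<O> W" for f k
    proof (rule ext[OF W])
      fix x V assume V: "x \<in> W" "V \<in> \<V>" "x \<in> V"
      have O: "open (W \<inter> V)" "W \<inter> V \<subseteq> V" using o' W V by auto
      show "X W ((\<lambda>_. k) * f) x = ((\<lambda>_. k) * X W f) x"
        using XX[OF _ V] that W V O func_restrict[OF W(1) O(1)]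
        by (simp add: r tangent_cmult[OF F[OF V(2)] O])
    qed (use that XO W in auto)
    show "X W (f * g) = X W f * g + f * X W g" if "f \<in> \<O> W" "g \<in> \<O> W" for f g
    proof (rule ext[OF W])
      fix x V assume V: "x \<in> W" "V \<in> \<V>" "x \<in> V"
      have O: "open (W \<inter> V)" "W \<inter> V \<subseteq> V" using o' W V by auto
      show "X W (f * g) x = (X W f * g + f * X W g) x"
        using XX[OF _ V] that W V O func_restrict[OF W(1) O(1)]
        by (simp add: r tangent_mult[OF F[OF V(2)] O])
    qed (use that XO W in auto)
    show "X W' (frestr W' f) = frestr W' (X W f)" if W': "open W'" "W' \<subseteq> W" "f \<in> \<O> W" for W' f
    proof (rule ext[OF W'(1)])
      have f': "frestr W' f \<in> \<O> W'" by (rule func_restrict[OF W(1) W'])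
      then show "X W' (frestr W' f) \<in> \<O> W'" "W' \<subseteq> \<Union>\<V>" using XO W W' by auto
      show "frestr W' (X W f) \<in> \<O> W'" by (rule func_restrict[OF W(1) W'(1,2) XO[OF W W'(3)]])
      fix x V assume V: "x \<in> W'" "V \<in> \<V>" "x \<in> V"
      have O: "open (W \<inter> V)" "W \<inter> V \<subseteq> V" "W' \<inter> V \<subseteq> W \<inter> V" "open (W' \<inter> V)" using o' W W' V by auto
      have fr: "frestr (W' \<inter> V) (frestr (W \<inter> V) f) = frestr (W' \<inter> V) f" "frestr (W' \<inter> V) (frestr W' f) = frestr (W' \<inter> V) f"
        using W' by (auto simp: fun_eq_iff)
      have "X W' (frestr W' f) x = F V (W' \<inter> V) (frestr (W' \<inter> V) (frestr (W \<inter> V) f)) x"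
        using X[of W' "frestr W' f" x V] W' W V f' fr by auto
      also have "\<dots> = frestr (W' \<inter> V) (F V (W \<inter> V) (frestr (W \<inter> V) f)) x"
        using tangent_restrict[OF F[OF V(2)] O(1,2) O(4,3) func_restrict[OF W(1) O(1) _ W'(3)]] by simp
      also have "\<dots> = X W f x" using XX[OF W'(3) _ V(2,3)] V W' by auto
      finally show "X W' (frestr W' f) x = frestr W' (X W f) x" using V by simp
    qed
  qed
  have "vrestr V X = F V" if V: "V \<in> \<V>" for V
  proof (rule tangent_eqI[OF tangent_vrestr[OF XT] F[OF V]])
    show "V \<subseteq> \<Union>\<V>" using V by auto
    fix W f x assume W: "open W" "W \<subseteq> V" "f \<in> \<O> W" "x \<in> W"
    moreover have "W \<inter> V = W" using W by auto
    ultimately show "vrestr V X W f x = F V W f x"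
      using X[of W f x V] V by (auto simp: vrestr_def func_frestr_self)
  qed
  with XT show thesis by (rule that)
qed

end

section \<open>Coordinates and linear dependence of vector fields\<close>

context manifold_sheaf
begin

text \<open>
  To compute \<open>X f\<close> at \<open>q\<close>, freeze the coordinates of \<open>f\<close> at \<open>q\<close> one after the other.  Each step changes
  \<open>f\<close> by \<open>(x\<^sub>i - q\<^sub>i) \<gamma>\<close> with \<open>\<gamma>\<close> regular, and the derivation \<open>X\<close> takes such a product to a function
  vanishing at \<open>q\<close>, since \<open>X x\<^sub>i = 0\<close>.  In the end \<open>f\<close> has become constant.
\<close>
lemma tangent_zero_if_coordinates:
  fixes S :: "('k^'n) set"
  assumes ch: "chart reg \<O> D S h g" and V: "open V" "V \<subseteq> D" and X: "X \<in> \<T> V"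
    and coord: "\<And>i. X V (frestr V (\<lambda>p. h p $ i)) = 0"
  shows "X = 0"
proof (rule tangent_eqI[OF X tangent_zero])
  fix W f q assume W: "open W" "W \<subseteq> V" "f \<in> \<O> W" "q \<in> W"
  have WD: "W \<subseteq> D" using W V by auto
  note im = chart_open_image[OF ch W(1) WD]
  obtain r where r: "r > 0" "ball (h q) r \<subseteq> h ` W" using im(1) W(4) by (meson imageI openE)
  define B where "B = ball (h q) r"
  define W' where "W' = {p \<in> W. h p \<in> B}"
  have hW: "continuous_on W h"
    using ch WD unfolding chart_def homeomorphism_def by (meson continuous_on_subset)
  have "W' = h -` B \<inter> W" by (auto simp: W'_def)
  then have oW': "open W'"
    using hW W(1) by (simp add: B_def continuous_on_open_vimage)
  have W'W: "W' \<subseteq> W" and W'D: "W' \<subseteq> D" and W'V: "W' \<subseteq> V" using WD W by (auto simp: W'_def)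
  have hW': "h ` W' = B" using r by (auto simp: W'_def B_def)
  have q: "q \<in> W'" using W r by (auto simp: W'_def B_def)
  note im' = chart_open_image[OF ch oW' W'D, unfolded hW']
  have reg: "frestr W' (\<lambda>p. \<psi> (h p)) \<in> \<O> W'" if "regular_on reg B \<psi>" for \<psi>
  proof -
    have "regular_on reg B ((\<lambda>p. \<psi> (h p)) \<circ> g)"
      by (rule regular_on_cong[OF im'(1) that]) (use im'(4) in auto)
    then show ?thesis using func_chart_iff[OF ch oW' W'D] hW' by simp
  qed
  define \<phi> where "\<phi> = f \<circ> g"
  have "regular_on reg (h ` W) \<phi>"
    using func_chart_iff[OF ch W(1) WD, of f] W func_frestr_self[of W f] by (simp add: \<phi>_def)
  then have \<phi>: "regular_on reg B \<phi>"
    by (rule regular_on_subset[OF im(1)]) (use r in \<open>simp add: B_def\<close>)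
  define F where "F J = frestr W' (\<lambda>p. \<phi> (freeze (h q) J (h p)))" for J
  have F: "F J \<in> \<O> W'" for J
    unfolding F_def using \<phi> by (intro reg) (simp add: B_def regular_on_freeze)
  have step: "X W' (F J) q = X W' (F (insert i J)) q" for i J
  proof -
    have "regular_on reg (ball (h q) r) (\<lambda>x. \<phi> (freeze (h q) J x))"
      using \<phi> by (simp add: B_def regular_on_freeze)
    from regular_on_division[OF this, of i] obtain \<gamma> where \<gamma>: "regular_on reg B \<gamma>"
      and eq: "\<And>x. x \<in> B \<Longrightarrow> \<phi> (freeze (h q) J x) - \<phi> (freeze (h q) J (freeze (h q) {i} x)) = (x $ i - h q $ i) * \<gamma> x"
      unfolding B_def by blast
    have fr: "freeze (h q) J (freeze (h q) {i} x) = freeze (h q) (insert i J) x" for x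
      by (simp add: vec_eq_iff)
    define G where "G = frestr W' (\<lambda>p. \<gamma> (h p))"
    define x where "x = frestr W' (\<lambda>p. h p $ i)"
    define c where "c = frestr W' (\<lambda>p. h q $ i)"
    have O: "G \<in> \<O> W'" "x \<in> \<O> W'" "c \<in> \<O> W'"
      using reg[OF \<gamma>] func_coordinate[OF ch oW' W'D] func_const[OF oW'] by (auto simp: G_def x_def c_def)
    have diff: "F J - F (insert i J) = (x - c) * G"
      using eq by (auto simp: fun_eq_iff F_def G_def x_def c_def fr W'_def)
    have "X W' x = frestr W' (X V (frestr V (\<lambda>p. h p $ i)))"
      using tangent_restrict[OF X V(1) subset_refl oW' W'V func_coordinate[OF ch V]]
      by (simp add: x_def frestr_frestr[OF W'V])
    then have x0: "X W' x = 0" by (simp add: coord fun_eq_iff)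
    have c0: "X W' c = 0" unfolding c_def by (rule tangent_const[OF X oW' W'V])
    have "X W' (F J) - X W' (F (insert i J)) = X W' ((x - c) * G)"
      using tangent_diff[OF X oW' W'V F F] by (simp flip: diff)
    also have "\<dots> = X W' (x - c) * G + (x - c) * X W' G"
      using O oW' by (intro tangent_mult[OF X oW' W'V]) auto
    also have "X W' (x - c) = 0"
      using tangent_diff[OF X oW' W'V O(2,3)] x0 c0 by simp
    finally have "X W' (F J) q - X W' (F (insert i J)) q = (0 * G + (x - c) * X W' G) q"
      by (metis fun_diff_def)
    then show ?thesis using q by (simp add: x_def c_def)
  qed
  have "X W' (F {}) q = X W' (F UNIV) q"
  proof -
    have "X W' (F {}) q = X W' (F J) q" if "finite J" for J
      using that by (induction J) (use step in auto)
    then show ?thesis by simp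
  qed
  moreover have "F {} = frestr W' f"
    using im(3) W'W by (auto simp: F_def fun_eq_iff \<phi>_def freeze_def vec_nth_inverse)
  moreover have "F UNIV = frestr W' (\<lambda>_. \<phi> (h q))"
    by (simp add: F_def freeze_def vec_nth_inverse)
  ultimately have "X W' (frestr W' f) q = 0"
    using tangent_const[OF X oW' W'V] by simp
  then show "X W f q = 0 W f q"
    using tangent_restrict[OF X W(1,2) oW' W'W W(3)] q by simp
qed

text \<open>
  Gaussian elimination, by induction on the set \<open>J\<close> of coordinates on which the vector fields \<open>u k\<close> may be
  non-zero.  If \<open>u 0 \<noteq> 0\<close>, some coordinate function \<open>u 0 x\<^sub>i\<close> is invertible on a smaller open set;
  subtracting multiples of \<open>u 0\<close> from the later fields makes them vanish on \<open>x\<^sub>i\<close>.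
\<close>
lemma generic_linear_dependence_in_chart:
  fixes S :: "('k^'n) set" and u :: "nat \<Rightarrow> ('m, 'k) vfield"
  assumes ch: "chart reg \<O> D S h g" and J: "finite J"
    and "open V" "V \<subseteq> D" "V \<noteq> {}"
    and "\<And>k. u k \<in> \<T> V" "\<And>i k. i \<notin> J \<Longrightarrow> u k V (frestr V (\<lambda>p. h p $ i)) = 0"
  shows "\<exists>V' k f. open V' \<and> V' \<subseteq> V \<and> V' \<noteq> {} \<and> (\<forall>j<k. f j \<in> \<O> V') \<and>
    vrestr V' (u k) = (\<Sum>j<k. smult (f j) (vrestr V' (u j)))"
  using J assms(3-7)
proof (induction J arbitrary: V u rule: finite_psubset_induct)
  case (psubset J V u)
  note V = psubset.prems(1-3) and u = psubset.prems(4) and uJ = psubset.prems(5)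
  let ?x = "\<lambda>V i. frestr V (\<lambda>p. h p $ i)"
  have x: "?x W i \<in> \<O> W" if "open W" "W \<subseteq> D" for W i by (rule func_coordinate[OF ch that])
  show ?case
  proof (cases "u 0 = 0")
    case True
    have "vrestr V (u 0) = (\<Sum>j<0. smult (f j) (vrestr V (u j)))" for f
      unfolding True by (simp only: vrestr_0 lessThan_0 sum.empty)
    then show ?thesis using V by (intro exI[of _ V] exI[of _ 0]) blast
  next
    case False
    then obtain i where i: "u 0 V (?x V i) \<noteq> 0"
      using tangent_zero_if_coordinates[OF ch V(1,2) u] by blast
    then have "i \<in> J" using uJ by blast
    define V1 where "V1 = {x \<in> V. u 0 V (?x V i) x \<noteq> 0}"
    have V1: "open V1" unfolding V1_def
      by (rule func_nonzero_open[OF V(1) tangent_func[OF u V(1) subset_refl x[OF V(1,2)]]])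
    have V1V: "V1 \<subseteq> V" and V1D: "V1 \<subseteq> D" using V by (auto simp: V1_def)
    have ne: "V1 \<noteq> {}"
    proof -
      obtain p where p: "u 0 V (?x V i) p \<noteq> 0" using i by (auto simp: fun_eq_iff)
      then have "p \<in> V" using func_off[OF V(1) tangent_func[OF u V(1) subset_refl x[OF V(1,2)]]] by blast
      then show ?thesis using p by (auto simp: V1_def)
    qed
    have xV1: "u k V1 (?x V1 l) = frestr V1 (u k V (?x V l))" for k l
      using tangent_restrict[OF u V(1) subset_refl V1 V1V x[OF V(1,2)]] frestr_frestr[OF V1V] by metis
    have nz: "u 0 V1 (?x V1 i) p \<noteq> 0" if "p \<in> V1" for p
      unfolding xV1 using that by (simp add: V1_def)
    define a where "a = (\<lambda>p. inverse (u 0 V1 (?x V1 i) p))"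
    have uO: "u k V1 (?x V1 l) \<in> \<O> V1" for k l
      by (rule tangent_func[OF u V1 V1V x[OF V1 V1D]])
    have a: "a \<in> \<O> V1"
      unfolding a_def by (rule func_inverse[OF V1 uO nz])
    define b where "b k = u (Suc k) V1 (?x V1 i) * a" for k
    have b: "b k \<in> \<O> V1" for k unfolding b_def using V1 uO a by simp
    define w where "w k = vrestr V1 (u (Suc k)) - smult (b k) (vrestr V1 (u 0))" for k
    have w: "w k \<in> \<T> V1" for k
      unfolding w_def by (intro tangent_minus tangent_smult tangent_vrestr[OF u V1V] V1 b)
    have wJ: "w k V1 (?x V1 l) = 0" if "l \<notin> J - {i}" for k l
    proof (cases "l = i")
      case True
      have "w k V1 (?x V1 i) p = 0" for p
      proof (cases "p \<in> V1")
        case True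
        from nz[OF this] show ?thesis by (simp add: w_def smult_def vrestr_apply b_def a_def)
      next
        case False
        then show ?thesis using func_off[OF V1 tangent_func[OF w V1 subset_refl x[OF V1 V1D]]] by blast
      qed
      then show ?thesis using True by (simp add: fun_eq_iff)
    next
      case False
      then have "l \<notin> J" using that by auto
      then show ?thesis by (simp add: w_def smult_def vrestr_apply xV1 uJ fun_eq_iff)
    qed
    have "J - {i} \<subset> J" using \<open>i \<in> J\<close> by auto
    then have "\<exists>V' k f. open V' \<and> V' \<subseteq> V1 \<and> V' \<noteq> {} \<and> (\<forall>j<k. f j \<in> \<O> V') \<and>
        vrestr V' (w k) = (\<Sum>j<k. smult (f j) (vrestr V' (w j)))"
      by (rule psubset.IH[OF _ V1 V1D ne w]) (rule wJ)
    then obtain V' k f where V': "open V'" "V' \<subseteq> V1" "V' \<noteq> {}" "\<forall>j<k. f j \<in> \<O> V'"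
      and wk: "vrestr V' (w k) = (\<Sum>j<k. smult (f j) (vrestr V' (w j)))"
      by (elim exE conjE) (rule that)
    define c where "c j = frestr V' (b j)" for j
    have c: "c j \<in> \<O> V'" for j unfolding c_def by (rule func_restrict[OF V1 V'(1,2) b])
    have wV': "vrestr V' (w j) = vrestr V' (u (Suc j)) - smult (c j) (vrestr V' (u 0))" for j
    proof -
      have "smult (c j) (vrestr V' (u 0)) = smult (b j) (vrestr V' (u 0))"
        unfolding c_def by (rule smult_frestr[OF tangent_vrestr[OF u] V'(1)]) (use V' V1V in auto)
      then show ?thesis using V'(2) by (simp add: w_def vrestr_diff vrestr_smult)
    qed
    \<comment> \<open>undoing the elimination: the coefficient of \<open>u 0\<close> collects all subtracted multiples\<close>
    define f' where "f' j = (case j of 0 \<Rightarrow> c k - (\<Sum>j<k. f j * c j) | Suc j \<Rightarrow> f j)" for j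
    have "vrestr V' (u (Suc k)) = vrestr V' (w k) + smult (c k) (vrestr V' (u 0))"
      by (simp add: wV')
    also have "vrestr V' (w k) = (\<Sum>j<k. smult (f j) (vrestr V' (u (Suc j)))) - smult (\<Sum>j<k. f j * c j) (vrestr V' (u 0))"
      unfolding wk by (simp only: wV' smult_diff_right sum_subtractf smult_smult smult_sum_left)
    also have "\<dots> + smult (c k) (vrestr V' (u 0)) = (\<Sum>j<Suc k. smult (f' j) (vrestr V' (u j)))"
      unfolding sum.lessThan_Suc_shift by (simp add: f'_def smult_diff_left)
    finally have "vrestr V' (u (Suc k)) = (\<Sum>j<Suc k. smult (f' j) (vrestr V' (u j)))" .
    moreover have "f' j \<in> \<O> V'" if "j < Suc k" for j
    proof (cases j)
      case 0
      have "(\<Sum>j<k. f j * c j) \<in> \<O> V'" using V' c by (intro func_sum func_mult) auto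
      then show ?thesis using 0 V'(1) c by (simp add: f'_def)
    qed (use that V' in \<open>auto simp: f'_def\<close>)
    ultimately show ?thesis
      using V' V1V by (intro exI[of _ V'] exI[of _ "Suc k"] exI[of _ f']) auto
  qed
qed

lemma generic_linear_dependence:
  fixes u :: "nat \<Rightarrow> ('m, 'k) vfield"
  assumes V: "open V" "V \<noteq> {}" and u: "\<And>k. u k \<in> \<T> V"
  obtains V' k f where "open V'" "V' \<subseteq> V" "V' \<noteq> {}" "\<And>j. j < k \<Longrightarrow> f j \<in> \<O> V'"
    "vrestr V' (u k) = (\<Sum>j<k. smult (f j) (vrestr V' (u j)))"
proof -
  obtain p where p: "p \<in> V" using V by auto
  obtain D and S :: "('k^'n) set" and h g where D: "p \<in> D" and ch: "chart reg \<O> D S h g" by (rule chart_around)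
  have o: "open (V \<inter> D)" using V ch by (auto simp: chart_def)
  have "\<exists>V' k f. open V' \<and> V' \<subseteq> V \<inter> D \<and> V' \<noteq> {} \<and> (\<forall>j<k. f j \<in> \<O> V') \<and>
    vrestr V' (vrestr (V \<inter> D) (u k)) = (\<Sum>j<k. smult (f j) (vrestr V' (vrestr (V \<inter> D) (u j))))"
    by (rule generic_linear_dependence_in_chart[OF ch finite[of UNIV] o])
      (use p D tangent_vrestr[OF u] in auto)
  then obtain V' k f where V': "open V'" "V' \<subseteq> V \<inter> D" "V' \<noteq> {}" "\<forall>j<k. f j \<in> \<O> V'"
    and *: "vrestr V' (vrestr (V \<inter> D) (u k)) = (\<Sum>j<k. smult (f j) (vrestr V' (vrestr (V \<inter> D) (u j))))"
    by (elim exE conjE) (rule that)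
  have "vrestr V' (u k) = (\<Sum>j<k. smult (f j) (vrestr V' (u j)))"
    using * V'(2) by simp
  note V' = V' this
  show thesis by (rule that[of V' k f]) (use V' in auto)
qed

end

section \<open>Invertibility of the shifted multiplications\<close>

lemma smult_1: "smult (\<lambda>_. 1) X = (X :: ('m, 'k::ring_1) vfield)"
  by (auto simp: smult_def fun_eq_iff)

context manifold_sheaf
begin

text \<open>
  Invertibility on each member of a cover passes to the union, since preimages are unique on overlaps
  and can be glued.
\<close>
lemma invertible_on_Union:
  assumes A: "\<And>V X. open V \<Longrightarrow> X \<in> \<T> V \<Longrightarrow> A V X \<in> \<T> V"
    and res: "\<And>V W X. open V \<Longrightarrow> open W \<Longrightarrow> W \<subseteq> V \<Longrightarrow> X \<in> \<T> V \<Longrightarrow> A W (vrestr W X) = vrestr W (A V X)"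
    and \<V>: "\<And>V. V \<in> \<V> \<Longrightarrow> open V \<and> invertible_on \<O> V A"
  shows "invertible_on \<O> (\<Union>\<V>) A"
  unfolding invertible_on_def
proof (intro allI impI)
  fix W assume W: "open W" "W \<subseteq> \<Union>\<V>"
  have bij: "bij_betw (A W') (\<T> W') (\<T> W')" if "open W'" "V \<in> \<V>" "W' \<subseteq> V" for W' V
    using \<V>[OF that(2)] that by (simp add: invertible_on_def)
  have inj: "inj_on (A W') (\<T> W')" if W': "open W'" "W' \<subseteq> \<Union>\<V>" for W'
  proof (rule inj_onI)
    fix X Y assume X: "X \<in> \<T> W'" and Y: "Y \<in> \<T> W'" and eq: "A W' X = A W' Y"
    show "X = Y"
    proof (rule tangent_eq_if_local[OF X Y])
      fix p assume p: "p \<in> W'"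
      then obtain V where V: "V \<in> \<V>" "p \<in> V" using W' by auto
      then have o: "open (W' \<inter> V)" using W' \<V> by auto
      have "A (W' \<inter> V) (vrestr (W' \<inter> V) X) = A (W' \<inter> V) (vrestr (W' \<inter> V) Y)"
        using res[OF W'(1) o _ X] res[OF W'(1) o _ Y] eq by simp
      then have "vrestr (W' \<inter> V) X = vrestr (W' \<inter> V) Y"
        using bij_betw_imp_inj_on[OF bij[OF o V(1)]] tangent_vrestr[OF X, of "W' \<inter> V"] tangent_vrestr[OF Y, of "W' \<inter> V"]
        by (auto dest: inj_onD)
      then show "\<exists>W. open W \<and> p \<in> W \<and> vrestr W X = vrestr W Y"
        using o p V by blast
    qed
  qed
  have "A W ` \<T> W = \<T> W"
  proof (intro equalityI subsetI)
    fix Y assume Y: "Y \<in> \<T> W"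
    define \<W> where "\<W> = (\<lambda>V. W \<inter> V) ` \<V>"
    have UW: "\<Union>\<W> = W" using W by (auto simp: \<W>_def)
    have \<W>: "open V" "V \<subseteq> W" "\<exists>V'\<in>\<V>. V \<subseteq> V'" if "V \<in> \<W>" for V
      using that W \<V> by (auto simp: \<W>_def)
    have "\<exists>X. X \<in> \<T> V \<and> A V X = vrestr V Y" if V: "V \<in> \<W>" for V
    proof -
      obtain V' where "V' \<in> \<V>" "V \<subseteq> V'" using \<W>[OF V] by auto
      from bij_betw_imp_surj_on[OF bij[OF \<W>(1)[OF V] this]] show ?thesis
        using tangent_vrestr[OF Y \<W>(2)[OF V]] by (metis imageE)
    qed
    then obtain F where F: "\<And>V. V \<in> \<W> \<Longrightarrow> F V \<in> \<T> V" "\<And>V. V \<in> \<W> \<Longrightarrow> A V (F V) = vrestr V Y"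
      by metis
    have agree: "vrestr (V1 \<inter> V2) (F V1) = vrestr (V1 \<inter> V2) (F V2)" if V: "V1 \<in> \<W>" "V2 \<in> \<W>" for V1 V2
    proof -
      have o: "open (V1 \<inter> V2)" using \<W> V by auto
      have "A (V1 \<inter> V2) (vrestr (V1 \<inter> V2) (F V1)) = A (V1 \<inter> V2) (vrestr (V1 \<inter> V2) (F V2))"
        using res[OF \<W>(1)[OF V(1)] o _ F(1)[OF V(1)]] res[OF \<W>(1)[OF V(2)] o _ F(1)[OF V(2)]] F(2) V by simp
      moreover have "V1 \<inter> V2 \<subseteq> \<Union>\<V>" using \<W>[OF V(1)] W by auto
      ultimately show ?thesis
        using inj[OF o] tangent_vrestr[OF F(1)[OF V(1)], of "V1 \<inter> V2"] tangent_vrestr[OF F(1)[OF V(2)], of "V1 \<inter> V2"]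
        by (auto dest: inj_onD)
    qed
    obtain X where X: "X \<in> \<T> (\<Union>\<W>)" "\<And>V. V \<in> \<W> \<Longrightarrow> vrestr V X = F V"
      using tangent_glue[of \<W> F, OF \<W>(1) F(1) agree] by blast
    have "A W X = Y"
    proof (rule tangent_eq_if_local[OF A[OF W(1)] Y])
      show "X \<in> \<T> W" using X UW by simp
      fix p assume "p \<in> W"
      then obtain V where V: "V \<in> \<W>" "p \<in> V" using UW by auto
      have "vrestr V (A W X) = vrestr V Y"
        using res[OF W(1) \<W>(1,2)[OF V(1)], of X] X UW F(2) V by simp
      then show "\<exists>V. open V \<and> p \<in> V \<and> vrestr V (A W X) = vrestr V Y" using V \<W> by blast
    qed
    then show "Y \<in> A W ` \<T> W" using X UW by auto
  qed (use A[OF W(1)] in auto)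
  with inj[OF W] show "bij_betw (A W) (\<T> W) (\<T> W)" by (simp add: bij_betw_def)
qed

end

text \<open>
  What is needed of an F-manifold with Euler field for the invertibility of \<open>L\<^sub>\<lambda>\<close>.
\<close>
locale manifold_algebra = manifold_sheaf reg n \<O>
  for reg and n :: "'n::finite itself"
    and \<O> :: "('m::{t2_space, second_countable_topology}, 'k::{real_normed_field, banach}) func_sheaf" +
  fixes circ :: "('m, 'k) binop" and e E :: "('m, 'k) vfield"
  assumes product: "product_on \<O> UNIV circ"
    and unit_tangent: "e \<in> \<T> UNIV" and E_tangent: "E \<in> \<T> UNIV"
    and unit: "\<And>V X. open V \<Longrightarrow> X \<in> \<T> V \<Longrightarrow> circ V (vrestr V e) X = X"
begin

lemma e_restr [simp]: "vrestr V e \<in> \<T> V" by (rule tangent_vrestr[OF unit_tangent]) simp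

lemma E_restr [simp]: "vrestr V E \<in> \<T> V" by (rule tangent_vrestr[OF E_tangent]) simp

context
  fixes V :: "'m set" assumes V: "open V"
begin

lemma circ_tangent [simp]: "X \<in> \<T> V \<Longrightarrow> Y \<in> \<T> V \<Longrightarrow> circ V X Y \<in> \<T> V"
  using product V by (auto simp: product_on_def binop_on_def)

lemma circ_restrict:
  "X \<in> \<T> V \<Longrightarrow> Y \<in> \<T> V \<Longrightarrow> open W \<Longrightarrow> W \<subseteq> V \<Longrightarrow>
    circ W (vrestr W X) (vrestr W Y) = vrestr W (circ V X Y)"
  using product V by (auto simp: product_on_def binop_on_def)

lemma circ_laws:
  assumes "X \<in> \<T> V" "Y \<in> \<T> V" "Z \<in> \<T> V"
  shows "circ V (X + Y) Z = circ V X Z + circ V Y Z" "circ V X (Y + Z) = circ V X Y + circ V X Z"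
    "circ V X Y = circ V Y X" "circ V (circ V X Y) Z = circ V X (circ V Y Z)"
  using product V assms func_zero[OF V] unfolding product_on_def by blast+

lemma circ_smult:
  assumes "X \<in> \<T> V" "Y \<in> \<T> V" "f \<in> \<O> V"
  shows "circ V (smult f X) Y = smult f (circ V X Y)" "circ V X (smult f Y) = smult f (circ V X Y)"
  using product V assms unfolding product_on_def by blast+

lemma circ_sc:
  assumes X: "X \<in> \<T> V" and Y: "Y \<in> \<T> V"
  shows "circ V X (smult (\<lambda>_. l) Y) = smult (\<lambda>_. l) (circ V X Y)"
  using circ_smult(2)[OF X Y func_const[OF V, of l]] smult_frestr[OF Y V] smult_frestr[OF circ_tangent[OF X Y] V] by simp

lemma circ_sum_left:
  assumes "\<And>i. i \<in> I \<Longrightarrow> X i \<in> \<T> V" "Y \<in> \<T> V" "finite I"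
  shows "circ V (sum X I) Y = (\<Sum>i\<in>I. circ V (X i) Y)"
  using assms(3,1)
proof (induction I)
  case empty
  have "circ V (0 + 0) Y = circ V 0 Y + circ V 0 Y" by (rule circ_laws) (use assms(2) in auto)
  then have "circ V 0 Y = 0" by simp
  then show ?case by (simp only: sum.empty)
next
  case (insert i I)
  have "circ V (sum X (insert i I)) Y = circ V (X i + sum X I) Y" using insert by (simp only: sum.insert not_False_eq_True)
  also have "\<dots> = circ V (X i) Y + circ V (sum X I) Y"
    by (rule circ_laws(1)[OF _ tangent_sum assms(2)]) (use insert assms in auto)
  also have "circ V (sum X I) Y = (\<Sum>i\<in>I. circ V (X i) Y)"
    by (rule insert.IH) (rule insert.prems, simp)
  finally show ?case using insert.hyps by (simp only: sum.insert not_False_eq_True)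
qed

end

definition E_power :: "nat \<Rightarrow> ('m, 'k) vfield" where
  "E_power k = (circ UNIV E ^^ k) e"

lemma E_power_tangent: "E_power k \<in> \<T> UNIV"
  unfolding E_power_def by (induction k) (auto simp: unit_tangent E_tangent)

lemma mult_by_tangent: "open V \<Longrightarrow> X \<in> \<T> V \<Longrightarrow> mult_by circ E V X \<in> \<T> V"
  by (simp add: mult_by_def)

lemma iterate_tangent: "open V \<Longrightarrow> X \<in> \<T> V \<Longrightarrow> (mult_by circ E V ^^ k) X \<in> \<T> V"
  by (induction k) (auto simp: mult_by_tangent)

lemma E_power_mult:
  assumes V: "open V" and X: "X \<in> \<T> V"
  shows "circ V (vrestr V (E_power k)) X = (mult_by circ E V ^^ k) X"
proof (induction k)
  case 0
  then show ?case using unit[OF V X] by (simp add: E_power_def)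
next
  case (Suc k)
  have "vrestr V (E_power (Suc k)) = circ V (vrestr V E) (vrestr V (E_power k))"
    using circ_restrict[OF open_UNIV E_tangent E_power_tangent V] by (simp add: E_power_def)
  moreover have "vrestr V (E_power k) \<in> \<T> V" by (rule tangent_vrestr[OF E_power_tangent]) simp
  ultimately show ?case
    using circ_laws(4)[OF V E_restr, of "vrestr V (E_power k)" X] X Suc by (simp add: mult_by_def)
qed

lemma shifted_mult_tangent: "open V \<Longrightarrow> X \<in> \<T> V \<Longrightarrow> shifted_mult circ E l V X \<in> \<T> V"
  by (simp add: shifted_mult_def mult_by_tangent)

lemma shifted_mult_restrict:
  assumes "open V" "open W" "W \<subseteq> V" "X \<in> \<T> V"
  shows "shifted_mult circ E l W (vrestr W X) = vrestr W (shifted_mult circ E l V X)"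
  using circ_restrict[OF assms(1) E_restr assms(4,2,3)] assms(3)
  by (simp add: shifted_mult_def mult_by_def vrestr_diff vrestr_smult)

lemma shifted_mult_add:
  assumes "open V" "X \<in> \<T> V" "Y \<in> \<T> V"
  shows "shifted_mult circ E l V (X + Y) = shifted_mult circ E l V X + shifted_mult circ E l V Y"
  using circ_laws(2)[OF assms(1) E_restr assms(2,3)]
  by (simp only: shifted_mult_def mult_by_def smult_add_right add_diff_add)

lemma shifted_mult_smult:
  assumes "open V" "X \<in> \<T> V" "f \<in> \<O> V"
  shows "shifted_mult circ E l V (smult f X) = smult f (shifted_mult circ E l V X)"
  using circ_smult(2)[OF assms(1) E_restr assms(2,3)]
  by (simp add: shifted_mult_def mult_by_def smult_diff_right smult_smult mult.commute)

text \<open>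
  Let \<open>P\<close> be the monic polynomial over the functions on \<open>V\<close> that annihilates \<open>L\<close>.  Then \<open>P(L) - P(l)\<close> is
  divisible by \<open>L - l\<close>, and as \<open>P(L) = 0\<close> and \<open>P(l)\<close> is a unit, \<open>L - l\<close> is invertible.
\<close>
lemma shifted_mult_bij:
  assumes V: "open V" and f: "\<And>j. j < k \<Longrightarrow> f j \<in> \<O> V"
    and dep: "vrestr V (E_power k) = (\<Sum>j<k. smult (f j) (vrestr V (E_power j)))"
    and nz: "\<And>p. p \<in> V \<Longrightarrow> l ^ k - (\<Sum>j<k. f j p * l ^ j) \<noteq> 0"
  shows "bij_betw (shifted_mult circ E l V) (\<T> V) (\<T> V)"
proof -
  let ?T = "\<T> V" and ?L = "mult_by circ E V" and ?M = "shifted_mult circ E l V"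
  have M_zero: "?M 0 = 0" using shifted_mult_add[OF V, of 0 0] by simp
  have M_diff: "?M (X - Y) = ?M X - ?M Y" if "X \<in> ?T" "Y \<in> ?T" for X Y
    using shifted_mult_add[OF V, of "X - Y" Y l] that by simp
  have M_sum: "?M (\<Sum>j<m. G j) = (\<Sum>j<m. ?M (G j))" if "\<And>j. j < m \<Longrightarrow> G j \<in> ?T" for G and m :: nat
    using that
  proof (induction m)
    case 0
    then show ?case by (simp only: lessThan_0 sum.empty M_zero)
  next
    case (Suc m)
    have "?M (\<Sum>j<Suc m. G j) = ?M (sum G {..<m} + G m)" by (simp only: sum.lessThan_Suc)
    also have "\<dots> = ?M (sum G {..<m}) + ?M (G m)"
      by (rule shifted_mult_add[OF V tangent_sum]) (use Suc in auto)
    also have "?M (sum G {..<m}) = (\<Sum>j<m. ?M (G j))"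
      by (rule Suc.IH) (use Suc.prems in simp)
    finally show ?case by (simp only: sum.lessThan_Suc)
  qed
  have char: "(?L ^^ k) X = (\<Sum>j<k. smult (f j) ((?L ^^ j) X))" if X: "X \<in> ?T" for X
  proof -
    have P: "vrestr V (E_power j) \<in> ?T" for j by (rule tangent_vrestr[OF E_power_tangent]) simp
    have "(?L ^^ k) X = circ V (\<Sum>j<k. smult (f j) (vrestr V (E_power j))) X"
      unfolding E_power_mult[OF V X, symmetric] dep ..
    also have "\<dots> = (\<Sum>j<k. circ V (smult (f j) (vrestr V (E_power j))) X)"
      by (rule circ_sum_left[OF V _ X]) (use P V f in auto)
    also have "\<dots> = (\<Sum>j<k. smult (f j) ((?L ^^ j) X))"
      by (rule sum.cong) (use circ_smult(1)[OF V P X f] E_power_mult[OF V X] in auto)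
    finally show ?thesis .
  qed
  define d where "d = frestr V (\<lambda>p. l ^ k - (\<Sum>j<k. f j p * l ^ j))"
  define c where "c m = frestr V (\<lambda>_. l ^ m)" for m
  have c: "c m \<in> \<O> V" for m unfolding c_def by (rule func_const[OF V])
  have csm: "smult (c m) X = smult (\<lambda>_. l ^ m) X" if "X \<in> ?T" for X m
    unfolding c_def by (rule smult_frestr[OF that V])
  have fsum: "(\<Sum>j<m. f j * c j) p = (\<Sum>j<m. f j p * c j p)" for m p
    by (induction m) auto
  have d_eq: "d = c k - (\<Sum>j<k. f j * c j)"
    by (auto simp: fun_eq_iff d_def c_def fsum[unfolded c_def])
  have dO: "d \<in> \<O> V"
    unfolding d_eq by (intro func_diff func_sum func_mult V c f) auto
  \<comment> \<open>the inverse of the unit \<open>P(l)\<close>\<close>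
  define r where "r = (\<lambda>p. inverse (d p))"
  have r: "r \<in> \<O> V" unfolding r_def by (rule func_inverse[OF V dO]) (use nz in \<open>auto simp: d_def\<close>)
  have rd: "smult (r * d) X = X" if X: "X \<in> ?T" for X
  proof -
    have "r * d = frestr V (\<lambda>_. 1)" using nz by (auto simp: fun_eq_iff r_def d_def)
    then show ?thesis using smult_frestr[OF X V, of "\<lambda>_. 1"] by (simp only: smult_1)
  qed
  \<comment> \<open>\<open>L\<^sup>m - l\<^sup>m\<close> is divisible by \<open>L - l\<close>\<close>
  have G: "\<exists>G. G \<in> ?T \<and> ?M G = (?L ^^ m) X - smult (c m) X" if X: "X \<in> ?T" for X m
  proof (induction m)
    case 0
    have "(?L ^^ 0) X - smult (c 0) X = 0" using csm[OF X, of 0] by (simp add: smult_1)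
    then show ?case using M_zero by (metis tangent_zero)
  next
    case (Suc m)
    then obtain G where G: "G \<in> ?T" "?M G = (?L ^^ m) X - smult (c m) X" by blast
    let ?Y = "(?L ^^ m) X" and ?l = "frestr V (\<lambda>_. l)"
    have Y: "?Y \<in> ?T" using iterate_tangent V X by auto
    have l: "?l \<in> \<O> V" by (rule func_const[OF V])
    have "?M (?Y + smult ?l G) = ?M ?Y + smult ?l (?Y - smult (c m) X)"
      using shifted_mult_add[OF V Y, of "smult ?l G" l] shifted_mult_smult[OF V G(1) l] G V l by simp
    also have "?M ?Y = ?L ?Y - smult ?l ?Y"
      by (simp add: shifted_mult_def smult_frestr[OF Y V])
    also have "?l * c m = c (Suc m)" by (auto simp: c_def fun_eq_iff)
    then have "?L ?Y - smult ?l ?Y + smult ?l (?Y - smult (c m) X) = (?L ^^ Suc m) X - smult (c (Suc m)) X"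
      by (simp add: smult_diff_right smult_smult)
    finally have "?M (?Y + smult ?l G) = (?L ^^ Suc m) X - smult (c (Suc m)) X" .
    moreover have "?Y + smult ?l G \<in> ?T" by (intro tangent_plus tangent_smult Y V G l)
    ultimately show ?case by blast
  qed
  have scale: "smult d X = smult (c k) X - (\<Sum>j<k. smult (f j) (smult (c j) X))" for X
    by (simp only: d_eq smult_diff_left smult_sum_left smult_smult)
  have "inj_on ?M ?T"
  proof (rule inj_onI)
    fix X Y assume XY: "X \<in> ?T" "Y \<in> ?T" "?M X = ?M Y"
    define Z where "Z = X - Y"
    have Z: "Z \<in> ?T" "?M Z = 0" using XY M_diff by (auto simp: Z_def)
    then have LZ: "?L Z = smult (\<lambda>_. l) Z" by (simp add: shifted_mult_def)
    have "(?L ^^ m) Z = smult (c m) Z" for m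
    proof (induction m)
      case 0
      then show ?case using csm[OF Z(1), of 0] by (simp add: smult_1)
    next
      case (Suc m)
      have "(?L ^^ Suc m) Z = circ V (vrestr V E) (smult (c m) Z)"
        by (simp only: funpow.simps(2) o_apply Suc mult_by_def[of circ E V "smult (c m) Z"])
      also have "\<dots> = smult (c m) (smult (\<lambda>_. l) Z)"
        using circ_smult(2)[OF V E_restr Z(1) c] LZ by (simp add: mult_by_def)
      also have "\<dots> = smult (\<lambda>_. l) (smult (c m) Z)" by (simp add: smult_smult mult.commute)
      also have "\<dots> = smult (c (Suc m)) Z"
        unfolding csm[OF Z(1)] smult_smult by (simp add: times_fun_def)
      finally show ?case .
    qed
    with char[OF Z(1)] scale[of Z] have "smult d Z = 0" by simp
    then have "smult r (smult d Z) = 0" by (simp only: smult_0)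
    then have "Z = 0" using rd[OF Z(1)] by (simp only: smult_smult)
    then show "X = Y" by (simp add: Z_def)
  qed
  moreover have "?M ` ?T = ?T"
  proof (intro equalityI subsetI)
    fix X assume X: "X \<in> ?T"
    from G[OF X] obtain G where G: "\<And>m. G m \<in> ?T" "\<And>m. ?M (G m) = (?L ^^ m) X - smult (c m) X" by metis
    define Y where "Y = G k - (\<Sum>j<k. smult (f j) (G j))"
    have fG: "smult (f j) (G j) \<in> ?T" if "j < k" for j using V f[OF that] G by simp
    have sG: "(\<Sum>j<k. smult (f j) (G j)) \<in> ?T" by (rule tangent_sum) (use fG in auto)
    have Y: "Y \<in> ?T" unfolding Y_def using G sG by simp
    have "?M Y = ?M (G k) - (\<Sum>j<k. ?M (smult (f j) (G j)))"
      unfolding Y_def M_diff[OF G(1) sG] using M_sum[OF fG] by simp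
    also have "(\<Sum>j<k. ?M (smult (f j) (G j))) = (\<Sum>j<k. smult (f j) ((?L ^^ j) X) - smult (f j) (smult (c j) X))"
      by (rule sum.cong) (use shifted_mult_smult[OF V G(1) f] G(2) in \<open>auto simp: smult_diff_right\<close>)
    also have "?M (G k) - \<dots> = - smult d X"
      unfolding G(2) char[OF X] scale sum_subtractf by (simp add: algebra_simps)
    finally have "?M (smult r Y) = - X"
      using shifted_mult_smult[OF V Y r] rd[OF X] smult_diff_right[of r 0 "smult d X"]
      by (simp add: smult_smult)
    moreover have "?M (0 - smult r Y) = ?M 0 - ?M (smult r Y)"
      by (rule M_diff) (use Y r V in auto)
    ultimately have "?M (0 - smult r Y) = X" by (simp add: M_zero)
    moreover have "0 - smult r Y \<in> ?T" using Y r V by simp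
    ultimately show "X \<in> ?M ` ?T" by (metis imageI)
  qed (use shifted_mult_tangent[OF V] in auto)
  ultimately show ?thesis by (simp add: bij_betw_def)
qed

lemma finite_roots:
  fixes a :: "nat \<Rightarrow> 'k"
  shows "finite {l. l ^ k - (\<Sum>j<k. a j * l ^ j) = 0}"
proof -
  define P where "P = monom 1 k - (\<Sum>j<k. monom (a j) j)"
  have "poly.coeff P k = 1" by (auto simp: P_def coeff_sum intro!: sum.neutral)
  then have "P \<noteq> 0" by auto
  from poly_roots_finite[OF this] show ?thesis
    by (simp add: P_def poly_monom poly_sum)
qed

text \<open>
  For a relation \<open>E\<^sup>k = \<Sum>j<k. f\<^sub>j E\<^sup>j\<close> on an open set, fix a point \<open>q\<close> of this set.  All but finitely many scalars are
  not roots of the polynomial at \<open>q\<close>, hence also not near \<open>q\<close>.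
\<close>
lemma generically_shifted_mult_invertible:
  assumes V: "open V" "V \<noteq> {}"
  obtains W l m where "open W" "W \<subseteq> V" "W \<noteq> {}" "l \<noteq> 0" "m \<noteq> 0" "l \<noteq> m"
    "invertible_on \<O> W (shifted_mult circ E l)" "invertible_on \<O> W (shifted_mult circ E m)"
proof -
  have "vrestr V (E_power k) \<in> \<T> V" for k by (rule tangent_vrestr[OF E_power_tangent]) simp
  note P = this
  obtain V' k f where V': "open V'" "V' \<subseteq> V" "V' \<noteq> {}"
    and f: "\<And>j. j < k \<Longrightarrow> f j \<in> \<O> V'"
    and "vrestr V' (vrestr V (E_power k)) = (\<Sum>j<k. smult (f j) (vrestr V' (vrestr V (E_power j))))"
    by (rule generic_linear_dependence[OF V P]) (rule that)
  then have dep: "vrestr V' (E_power k) = (\<Sum>j<k. smult (f j) (vrestr V' (E_power j)))" by simp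
  obtain q where q: "q \<in> V'" using V' by auto
  define cp where "cp l p = l ^ k - (\<Sum>j<k. f j p * l ^ j)" for l p
  have fin: "finite (insert 0 {l. cp l q = 0})"
    unfolding cp_def by (intro finite.insertI finite_roots)
  obtain l where l: "l \<notin> insert 0 {l. cp l q = 0}" using ex_new_if_finite[OF infinite_UNIV_char_0 fin] by blast
  have "finite (insert l (insert 0 {l. cp l q = 0}))" using fin by simp
  from ex_new_if_finite[OF infinite_UNIV_char_0 this] obtain m where m: "m \<notin> insert l (insert 0 {l. cp l q = 0})" by blast
  have cpO: "frestr V' (cp l) \<in> \<O> V'" for l
  proof -
    have "(\<Sum>j<k. f j * (\<lambda>_. l ^ j)) p = (\<Sum>j<k. f j p * l ^ j)" for p
      by (induction k) auto
    then have "frestr V' (cp l) = frestr V' (\<lambda>_. l ^ k) - (\<Sum>j<k. f j * frestr V' (\<lambda>_. l ^ j))"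
    proof -
      have "(\<Sum>j<k. f j * frestr V' (\<lambda>_. l ^ j)) p = (if p \<in> V' then \<Sum>j<k. f j p * l ^ j else 0)" for p
        by (induction k) auto
      then show ?thesis by (auto simp: fun_eq_iff cp_def)
    qed
    also have "\<dots> \<in> \<O> V'" by (intro func_diff func_sum func_mult func_const V' f) auto
    finally show ?thesis .
  qed
  define W where "W = {p \<in> V'. frestr V' (cp l) p \<noteq> 0} \<inter> {p \<in> V'. frestr V' (cp m) p \<noteq> 0}"
  have "open W"
    unfolding W_def by (intro open_Int func_nonzero_open[OF V'(1) cpO])
  moreover have "W \<subseteq> V'" "q \<in> W"
    unfolding W_def using q l m by auto
  ultimately have W: "open W" "W \<subseteq> V'" "q \<in> W" by auto
  have inv: "invertible_on \<O> W (shifted_mult circ E t)" if "\<And>p. p \<in> W \<Longrightarrow> cp t p \<noteq> 0" for t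
    unfolding invertible_on_def
  proof (intro allI impI)
    fix W' assume W': "open W'" "W' \<subseteq> W"
    define f' where "f' j = frestr W' (f j)" for j
    have rr: "vrestr W' (vrestr V' X) = vrestr W' X" for X :: "('m, 'k) vfield" using W W' by simp
    have ff: "smult (f' j) (vrestr W' (E_power j)) = smult (f j) (vrestr W' (E_power j))" for j
      unfolding f'_def by (rule smult_frestr[OF tangent_vrestr[OF E_power_tangent] W'(1)]) simp
    have "vrestr W' (vrestr V' (E_power k)) = (\<Sum>j<k. smult (f j) (vrestr W' (vrestr V' (E_power j))))"
      unfolding dep vrestr_sum vrestr_smult ..
    then have dep': "vrestr W' (E_power k) = (\<Sum>j<k. smult (f' j) (vrestr W' (E_power j)))"
      unfolding rr ff .
    show "bij_betw (shifted_mult circ E t W') (\<T> W') (\<T> W')"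
    proof (rule shifted_mult_bij[OF W'(1) _ dep'])
      show "f' j \<in> \<O> W'" if "j < k" for j
        unfolding f'_def by (rule func_restrict[OF V'(1) W'(1) _ f[OF that]]) (use W W' in auto)
      show "t ^ k - (\<Sum>j<k. f' j p * t ^ j) \<noteq> 0" if p: "p \<in> W'" for p
        using \<open>\<And>p. p \<in> W \<Longrightarrow> cp t p \<noteq> 0\<close>[of p] p W' by (auto simp: cp_def f'_def)
    qed
  qed
  have "cp l p \<noteq> 0" "cp m p \<noteq> 0" if "p \<in> W" for p
    using that by (auto simp: W_def)
  then have "invertible_on \<O> W (shifted_mult circ E l)" "invertible_on \<O> W (shifted_mult circ E m)"
    by (auto intro: inv)
  then show thesis
    using that[of W l m] W V'(2) l m by blast
qed

end

section \<open>Gauss-Manin connections and bi-flat F-structures\<close>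

locale Gauss_Manin_setting = manifold_sheaf reg n \<O>
  for reg and n :: "'n::finite itself"
    and \<O> :: "('m::{t2_space, second_countable_topology}, 'k::{real_normed_field, banach}) func_sheaf" +
  fixes circ nabla :: "('m, 'k) binop" and e E :: "('m, 'k) vfield" and U :: "'m set"
  assumes F: "F_manifold \<O> UNIV circ e"
    and Eu: "Euler_field \<O> UNIV circ e E"
    and conn: "connection_on \<O> UNIV nabla"
    and tors: "torsionless_on \<O> UNIV nabla"
    and par: "parallel_on \<O> UNIV nabla e"
    and nondegenerate: "invertible_on \<O> UNIV (\<lambda>V X. nabla V X (vrestr V E))"
    and U: "open U" "closure U = UNIV" and E_inv: "invertible_on \<O> U (mult_by circ E)"
begin

sublocale manifold_algebra reg n \<O> circ e E
  by unfold_locales (use F Eu in \<open>auto simp: F_manifold_def Euler_field_def\<close>)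

abbreviation sc :: "'k \<Rightarrow> ('m, 'k) vfield \<Rightarrow> ('m, 'k) vfield" where
  "sc \<equiv> \<lambda>l. smult (\<lambda>_. l)"

context
  fixes V :: "'m set" assumes V: "open V"
begin

lemma nabla_tangent [simp]: "X \<in> \<T> V \<Longrightarrow> Y \<in> \<T> V \<Longrightarrow> nabla V X Y \<in> \<T> V"
  using conn V by (auto simp: connection_on_def binop_on_def)

lemma nabla_restrict:
  "X \<in> \<T> V \<Longrightarrow> Y \<in> \<T> V \<Longrightarrow> open W \<Longrightarrow> W \<subseteq> V \<Longrightarrow>
    nabla W (vrestr W X) (vrestr W Y) = vrestr W (nabla V X Y)"
  using conn V by (auto simp: connection_on_def binop_on_def)

lemma nabla_add:
  assumes "X \<in> \<T> V" "Y \<in> \<T> V" "Z \<in> \<T> V"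
  shows "nabla V (X + Y) Z = nabla V X Z + nabla V Y Z" "nabla V X (Y + Z) = nabla V X Y + nabla V X Z"
  using conn V assms func_zero[OF V] unfolding connection_on_def by blast+

lemma nabla_smult:
  assumes "X \<in> \<T> V" "Y \<in> \<T> V" "f \<in> \<O> V"
  shows "nabla V (smult f X) Y = smult f (nabla V X Y)"
    "nabla V X (smult f Y) = smult (X V f) Y + smult f (nabla V X Y)"
  using conn V assms unfolding connection_on_def by blast+

lemma nabla_sc:
  assumes X: "X \<in> \<T> V" and Y: "Y \<in> \<T> V"
  shows "nabla V (sc l X) Y = sc l (nabla V X Y)" "nabla V X (sc l Y) = sc l (nabla V X Y)"
proof -
  let ?c = "frestr V (\<lambda>_. l)"
  have c: "smult ?c Z = sc l Z" if "Z \<in> \<T> V" for Z by (rule smult_frestr[OF that V])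
  have cO: "?c \<in> \<O> V" by (rule func_const[OF V])
  show "nabla V (sc l X) Y = sc l (nabla V X Y)"
    using nabla_smult(1)[OF X Y cO] c[OF X] c[OF nabla_tangent[OF X Y]] by (simp only:)
  have "X V ?c = 0" by (rule tangent_const[OF X V subset_refl])
  then have "smult (X V ?c) Y + smult ?c (nabla V X Y) = smult ?c (nabla V X Y)"
    by (simp only: smult_0 add_0)
  then show "nabla V X (sc l Y) = sc l (nabla V X Y)"
    using nabla_smult(2)[OF X Y cO] c[OF Y] c[OF nabla_tangent[OF X Y]] by (simp only:)
qed

lemma scaled: "scaled_torsionless_product (\<T> V) (circ V) (nabla V) bracket sc"
proof -
  interpret torsionless_product "\<T> V" "circ V" "nabla V" bracket
  proof
    show "bracket X Y = nabla V X Y - nabla V Y X" if "X \<in> \<T> V" "Y \<in> \<T> V" for X Y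
      using tors V that by (auto simp: torsionless_on_def)
  qed (use circ_laws[OF V] nabla_add in \<open>simp_all add: V\<close>)
  show ?thesis
  proof (intro scaled_torsionless_product.intro scaled_torsionless_product_axioms.intro)
    show "torsionless_product (\<T> V) (circ V) (nabla V) bracket" by unfold_locales
    show "vector_space sc" by (rule vector_space_smult)
  qed (simp_all add: circ_sc[OF V] nabla_sc)
qed

lemma Euler: "Euler_algebra (\<T> V) (circ V) (nabla V) bracket sc (vrestr V e) (vrestr V E)"
proof -
  interpret scaled_torsionless_product "\<T> V" "circ V" "nabla V" bracket sc by (rule scaled)
  show ?thesis
  proof
    show "vrestr V e \<in> \<T> V" "vrestr V E \<in> \<T> V" by simp_all
    show "circ V (vrestr V e) X = X" if "X \<in> \<T> V" for X using unit[OF V that] .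
    show "hm X Y W Z = 0" if "X \<in> \<T> V" "Y \<in> \<T> V" "W \<in> \<T> V" "Z \<in> \<T> V" for X Y W Z
      unfolding hm_def
      using F[unfolded F_manifold_def, THEN conjunct2, THEN conjunct2, THEN spec, THEN mp, OF V,
          THEN mp, OF subset_UNIV, THEN conjunct2, rule_format, OF that] .
    show "bracket (vrestr V e) (vrestr V E) = vrestr V e"
      unfolding vrestr_bracket[symmetric] using Eu by (simp add: Euler_field_def)
    show "bracket (vrestr V E) (circ V X Y) - circ V (bracket (vrestr V E) X) Y - circ V X (bracket (vrestr V E) Y) = circ V X Y"
      if "X \<in> \<T> V" "Y \<in> \<T> V" for X Y
      using Eu[unfolded Euler_field_def, THEN conjunct2, THEN conjunct2, THEN spec, THEN mp, OF V,
          THEN mp, OF subset_UNIV, rule_format, OF that] .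
    show "nabla V X (vrestr V e) = 0" if "X \<in> \<T> V" for X
      using par V that unfolding parallel_on_def by blast
  qed
qed

lemma nabla_E_cancel: "X \<in> \<T> V \<Longrightarrow> nabla V X (vrestr V E) = 0 \<Longrightarrow> X = 0"
proof -
  interpret scaled_torsionless_product "\<T> V" "circ V" "nabla V" bracket sc by (rule scaled)
  have "bij_betw (\<lambda>X. nabla V X (vrestr V E)) (\<T> V) (\<T> V)"
    using nondegenerate V by (simp add: invertible_on_def)
  then have inj: "inj_on (\<lambda>X. nabla V X (vrestr V E)) (\<T> V)" by (rule bij_betw_imp_inj_on)
  assume "X \<in> \<T> V" "nabla V X (vrestr V E) = 0"
  moreover have "nabla V 0 (vrestr V E) = 0" by simp
  ultimately show "X = 0" using inj_onD[OF inj, of X 0] by simp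
qed

end

context
  fixes V :: "'m set" assumes V: "open V" and VU: "V \<subseteq> U"
begin

lemma E_bij: "bij_betw (circ V (vrestr V E)) (\<T> V) (\<T> V)"
proof -
  have "mult_by circ E V = circ V (vrestr V E)" by (auto simp: mult_by_def)
  then show ?thesis using E_inv V VU unfolding invertible_on_def by metis
qed

lemma E_surj: "X \<in> \<T> V \<Longrightarrow> \<exists>X'. X' \<in> \<T> V \<and> X = circ V (vrestr V E) X'"
  using bij_betw_imp_surj_on[OF E_bij] by (metis imageE)

lemma dual_product_tangent: "X \<in> \<T> V \<Longrightarrow> Y \<in> \<T> V \<Longrightarrow> dual_product \<O> circ E V X Y \<in> \<T> V"
  and circ_dual_product: "X \<in> \<T> V \<Longrightarrow> Y \<in> \<T> V \<Longrightarrow>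
    circ V (vrestr V E) (dual_product \<O> circ E V X Y) = circ V X Y"
proof -
  assume XY: "X \<in> \<T> V" "Y \<in> \<T> V"
  have m: "mult_by circ E V = circ V (vrestr V E)" by (auto simp: mult_by_def)
  have "circ V X Y \<in> circ V (vrestr V E) ` \<T> V"
    using bij_betw_imp_surj_on[OF E_bij] XY V by simp
  then show "dual_product \<O> circ E V X Y \<in> \<T> V"
    "circ V (vrestr V E) (dual_product \<O> circ E V X Y) = circ V X Y"
    unfolding dual_product_def endo_inv_def m by (rule inv_into_into, rule f_inv_into_f)
qed

lemma dual: "dual_Euler_algebra (\<T> V) (circ V) (nabla V) bracket sc (vrestr V e) (vrestr V E) (dual_product \<O> circ E V)"
proof -
  interpret Euler_algebra "\<T> V" "circ V" "nabla V" bracket sc "vrestr V e" "vrestr V E" by (rule Euler[OF V])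
  show ?thesis
  proof
    show "X = 0" if "X \<in> \<T> V" "circ V (vrestr V E) X = 0" for X
    proof -
      have "circ V (vrestr V E) 0 = 0" by simp
      then show ?thesis using inj_onD[OF bij_betw_imp_inj_on[OF E_bij], of X 0] that by simp
    qed
  qed (use dual_product_tangent circ_dual_product nabla_E_cancel[OF V] in blast)+
qed

end

abbreviation (input) "star \<equiv> dual_product \<O> circ E"
abbreviation (input) "nabla' \<equiv> dual_connection \<O> circ E nabla"
abbreviation (input) "GM \<equiv> Gauss_Manin \<O> circ E nabla"

abbreviation "curvature V \<equiv> torsionless_product.curv (nabla V) bracket"
abbreviation "d_circ V \<equiv> torsionless_product.d_mul (circ V) (nabla V)"
abbreviation "hessian V \<equiv> Euler_algebra.hess (nabla V) (vrestr V E)"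

lemma star_restrict:
  assumes V: "open V" "V \<subseteq> U" and W: "open W" "W \<subseteq> V" and XY: "X \<in> \<T> V" "Y \<in> \<T> V"
  shows "star W (vrestr W X) (vrestr W Y) = vrestr W (star V X Y)"
proof -
  have WU: "W \<subseteq> U" using V W by auto
  interpret W: dual_Euler_algebra "\<T> W" "circ W" "nabla W" bracket sc "vrestr W e" "vrestr W E" "star W"
    by (rule dual[OF W(1) WU])
  have T: "vrestr W X \<in> \<T> W" "vrestr W Y \<in> \<T> W" "star V X Y \<in> \<T> V"
    using XY W dual_product_tangent[OF V] by auto
  show ?thesis
  proof (rule W.E_inj)
    have "circ W (vrestr W E) (vrestr W (star V X Y)) = vrestr W (circ V X Y)"
      using circ_restrict[OF V(1) E_restr T(3) W] circ_dual_product[OF V XY] W(2) by simp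
    then show "circ W (vrestr W E) (star W (vrestr W X) (vrestr W Y)) = circ W (vrestr W E) (vrestr W (star V X Y))"
      using T circ_restrict[OF V(1) XY W] by simp
  qed (use T W in auto)
qed

lemma star_smult:
  assumes V: "open V" "V \<subseteq> U" and XY: "X \<in> \<T> V" "Y \<in> \<T> V" and f: "f \<in> \<O> V"
  shows "star V (smult f X) Y = smult f (star V X Y)" "star V X (smult f Y) = smult f (star V X Y)"
proof -
  interpret dual_Euler_algebra "\<T> V" "circ V" "nabla V" bracket sc "vrestr V e" "vrestr V E" "star V"
    by (rule dual[OF V])
  have T: "smult f X \<in> \<T> V" "smult f Y \<in> \<T> V" "smult f (star V X Y) \<in> \<T> V"
    using tangent_smult[OF V(1)] XY f by auto
  have E: "circ V (vrestr V E) (smult f (star V X Y)) = smult f (circ V X Y)"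
    using circ_smult(2)[OF V(1) E_restr star_closed[OF XY] f] XY by simp
  show "star V (smult f X) Y = smult f (star V X Y)"
    by (rule E_inj) (use T XY E circ_smult(1)[OF V(1) XY f] in simp_all)
  show "star V X (smult f Y) = smult f (star V X Y)"
    by (rule E_inj) (use T XY E circ_smult(2)[OF V(1) XY f] in simp_all)
qed

lemma curvature_restrict:
  assumes V: "open V" and W: "open W" "W \<subseteq> V" and T: "X \<in> \<T> V" "Y \<in> \<T> V" "Z \<in> \<T> V"
  shows "vrestr W (curvature V X Y Z) = curvature W (vrestr W X) (vrestr W Y) (vrestr W Z)"
    and "vrestr W (d_circ V X Y Z) = d_circ W (vrestr W X) (vrestr W Y) (vrestr W Z)"
    and "vrestr W (hessian V X Y) = hessian W (vrestr W X) (vrestr W Y)"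
proof -
  interpret V: Euler_algebra "\<T> V" "circ V" "nabla V" bracket sc "vrestr V e" "vrestr V E" by (rule Euler[OF V])
  interpret W: Euler_algebra "\<T> W" "circ W" "nabla W" bracket sc "vrestr W e" "vrestr W E" by (rule Euler[OF W(1)])
  have nab: "vrestr W (nabla V A B) = nabla W (vrestr W A) (vrestr W B)" if "A \<in> \<T> V" "B \<in> \<T> V" for A B
    using nabla_restrict[OF V that W] by simp
  have cir: "vrestr W (circ V A B) = circ W (vrestr W A) (vrestr W B)" if "A \<in> \<T> V" "B \<in> \<T> V" for A B
    using circ_restrict[OF V that W] by simp
  have E: "vrestr W (vrestr V E) = vrestr W E" using W by simp
  show "vrestr W (curvature V X Y Z) = curvature W (vrestr W X) (vrestr W Y) (vrestr W Z)"
    unfolding V.curv_def W.curv_def using T V by (simp only: vrestr_diff nab vrestr_bracket V.nb_closed V.br_closed)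
  show "vrestr W (d_circ V X Y Z) = d_circ W (vrestr W X) (vrestr W Y) (vrestr W Z)"
    unfolding V.d_mul_def W.d_mul_def V.nb_mul_def W.nb_mul_def using T V
    by (simp only: vrestr_diff nab cir V.nb_closed V.mul_closed)
  show "vrestr W (hessian V X Y) = hessian W (vrestr W X) (vrestr W Y)"
    unfolding V.hess_def W.hess_def using T V by (simp only: vrestr_diff nab E V.nb_closed V.E_closed)
qed

text \<open>
  By \<open>gm_eq\<close>; the inverse in the definition of the Gauss-Manin connection undoes the shift.
\<close>
lemma Gauss_Manin_eq:
  assumes V: "open V" "V \<subseteq> U" and bij: "bij_betw (shifted_mult circ E l V) (\<T> V) (\<T> V)"
    and XY: "X \<in> \<T> V" "Y \<in> \<T> V"
  shows "GM l V (shifted_mult circ E l V X) Y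
    = Euler_algebra.gm (circ V) (nabla V) sc (vrestr V E) l X Y"
proof -
  interpret dual_Euler_algebra "\<T> V" "circ V" "nabla V" bracket sc "vrestr V e" "vrestr V E" "star V"
    by (rule dual[OF V])
  have inv: "endo_inv \<O> (shifted_mult circ E l) V (shifted_mult circ E l V X) = X"
    unfolding endo_inv_def by (rule inv_into_f_f[OF bij_betw_imp_inj_on[OF bij] XY(1)])
  have "shifted_mult circ E l V X = circ V (vrestr V E) X - sc l X"
    by (simp add: shifted_mult_def mult_by_def)
  then show ?thesis
    unfolding Gauss_Manin_def Let_def inv dual_connection_def
    using gm_eq[OF XY, of l] by (simp only: nbs_def)
qed

text \<open>
  Every section over \<open>V\<close> is of the form \<open>L\<^sub>\<lambda> X\<close>, and the bracket of two such sections is \<open>L\<^sub>\<lambda>\<close> of \<open>gm_br\<close>.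
\<close>
lemma Gauss_Manin_curvature_torsion:
  assumes V: "open V" "V \<subseteq> U" and bij: "bij_betw (shifted_mult circ E l V) (\<T> V) (\<T> V)"
  shows "(\<forall>X\<in>\<T> V. \<forall>Y\<in>\<T> V. \<forall>Z\<in>\<T> V.
      GM l V X (GM l V Y Z) - GM l V Y (GM l V X Z) - GM l V (bracket X Y) Z = 0)
    \<longleftrightarrow> dual_Euler_algebra.gm_flat (\<T> V) (circ V) (nabla V) bracket sc (vrestr V E) l"
    and "X \<in> \<T> V \<Longrightarrow> Y \<in> \<T> V \<Longrightarrow> GM l V X Y - GM l V Y X = bracket X Y"
proof -
  interpret dual_Euler_algebra "\<T> V" "circ V" "nabla V" bracket sc "vrestr V e" "vrestr V E" "star V"
    by (rule dual[OF V])
  let ?T = "\<T> V" and ?M = "shifted_mult circ E l V"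
  have M: "?M X = circ V (vrestr V E) X - sc l X" for X by (simp add: shifted_mult_def mult_by_def)
  have surj: "\<exists>X'. X' \<in> ?T \<and> X = ?M X'" if "X \<in> ?T" for X
    using bij_betw_imp_surj_on[OF bij] that by (metis imageE)
  note eq = Gauss_Manin_eq[OF V bij]
  have gmT: "gm l X Y \<in> ?T" if "X \<in> ?T" "Y \<in> ?T" for X Y using that by (simp add: gm_def)
  have MT: "?M X \<in> ?T" if "X \<in> ?T" for X using that unfolding M by simp
  have br: "bracket (?M X) (?M Y) = ?M (gm_br l X Y)" if "X \<in> ?T" "Y \<in> ?T" for X Y
    unfolding M using br_shift[OF that, of l] by simp
  have *: "GM l V (?M X) (GM l V (?M Y) Z) - GM l V (?M Y) (GM l V (?M X) Z) - GM l V (bracket (?M X) (?M Y)) Z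
      = gm l X (gm l Y Z) - gm l Y (gm l X Z) - gm l (gm_br l X Y) Z" if "X \<in> ?T" "Y \<in> ?T" "Z \<in> ?T" for X Y Z
    using that by (simp only: br eq gmT gm_br_closed)
  show "(\<forall>X\<in>?T. \<forall>Y\<in>?T. \<forall>Z\<in>?T.
      GM l V X (GM l V Y Z) - GM l V Y (GM l V X Z) - GM l V (bracket X Y) Z = 0) \<longleftrightarrow> gm_flat l"
    unfolding gm_flat_def
  proof (intro iffI ballI)
    fix X Y Z assume "\<forall>X\<in>?T. \<forall>Y\<in>?T. \<forall>Z\<in>?T.
      GM l V X (GM l V Y Z) - GM l V Y (GM l V X Z) - GM l V (bracket X Y) Z = 0" "X \<in> ?T" "Y \<in> ?T" "Z \<in> ?T"
    then show "gm l X (gm l Y Z) - gm l Y (gm l X Z) - gm l (gm_br l X Y) Z = 0"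
      using *[of X Y Z] MT by metis
  next
    fix X Y Z assume fl: "\<forall>X\<in>?T. \<forall>Y\<in>?T. \<forall>Z\<in>?T. gm l X (gm l Y Z) - gm l Y (gm l X Z) - gm l (gm_br l X Y) Z = 0"
      and T: "X \<in> ?T" "Y \<in> ?T" "Z \<in> ?T"
    obtain X' Y' where X': "X' \<in> ?T" "Y' \<in> ?T" "X = ?M X'" "Y = ?M Y'"
      using surj[OF T(1)] surj[OF T(2)] by (elim exE conjE) (rule that)
    show "GM l V X (GM l V Y Z) - GM l V Y (GM l V X Z) - GM l V (bracket X Y) Z = 0"
      unfolding X'(3,4) *[OF X'(1,2) T(3)] using fl X'(1,2) T(3) by blast
  qed
  assume T: "X \<in> ?T" "Y \<in> ?T"
  obtain X' Y' where X': "X' \<in> ?T" "Y' \<in> ?T" "X = ?M X'" "Y = ?M Y'"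
    using surj[OF T(1)] surj[OF T(2)] by (elim exE conjE) (rule that)
  have "GM l V X Y = gm l X' (?M Y')" "GM l V Y X = gm l Y' (?M X')"
    unfolding X'(3,4) using eq X' MT by auto
  then show "GM l V X Y - GM l V Y X = bracket X Y"
    using gm_torsionless[OF X'(1,2), of l] unfolding X'(3,4) M by simp
qed

text \<open>
  The domain is a union of open sets on which \<open>L\<^sub>\<lambda>\<close> is invertible; an open subset of it need not lie in
  one of them, and this is where gluing is needed.
\<close>
lemma GM_domain_bij:
  assumes "open V" "V \<subseteq> GM_domain \<O> U circ E l"
  shows "V \<subseteq> U" "bij_betw (shifted_mult circ E l V) (\<T> V) (\<T> V)"
proof -
  show "V \<subseteq> U" using assms(2) by (auto simp: GM_domain_def)
  have "invertible_on \<O> (GM_domain \<O> U circ E l) (shifted_mult circ E l)"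
    unfolding GM_domain_def
    by (rule invertible_on_Union) (auto simp: shifted_mult_tangent shifted_mult_restrict)
  then show "bij_betw (shifted_mult circ E l V) (\<T> V) (\<T> V)"
    using assms by (simp add: invertible_on_def)
qed

lemma GM_domain_zero: "GM_domain \<O> U circ E 0 = U"
proof -
  have "shifted_mult circ E 0 = mult_by circ E"
    by (auto simp: shifted_mult_def smult_def fun_eq_iff)
  then have "invertible_on \<O> U (shifted_mult circ E 0)" using E_inv by simp
  then show ?thesis using U by (auto simp: GM_domain_def)
qed

lemma GM_torsionless: "torsionless_on \<O> (GM_domain \<O> U circ E l) (GM l)"
  unfolding torsionless_on_def using Gauss_Manin_curvature_torsion(2) GM_domain_bij by blast

lemma GM_flat_iff:
  "flat_on \<O> (GM_domain \<O> U circ E l) (GM l) \<longleftrightarrow> (\<forall>V. open V \<longrightarrow> V \<subseteq> GM_domain \<O> U circ E l \<longrightarrow>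
     dual_Euler_algebra.gm_flat (\<T> V) (circ V) (nabla V) bracket sc (vrestr V E) l)"
  unfolding flat_on_def
  by (intro iff_allI imp_cong refl) (rule Gauss_Manin_curvature_torsion(1)[OF _ GM_domain_bij])

text \<open>
  The three parameters are \<open>0\<close>, for which the domain is all of \<open>U\<close>, and two non-zero ones that are
  admissible on a small open set.
\<close>
lemma generically_flat:
  assumes flat: "\<forall>l. flat_on \<O> (GM_domain \<O> U circ E l) (GM l)" and V: "open V" "V \<noteq> {}"
  obtains W where "open W" "W \<subseteq> V" "W \<noteq> {}"
    "\<And>X Y Z. X \<in> \<T> W \<Longrightarrow> Y \<in> \<T> W \<Longrightarrow> Z \<in> \<T> W \<Longrightarrow>
      curvature W X Y Z = 0 \<and> d_circ W X Y Z = 0 \<and> hessian W X Z = 0"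
proof -
  have "V \<inter> U \<noteq> {}" using open_Int_closure_eq_empty[OF V(1), of U] U V by auto
  then obtain W l m where W: "open W" "W \<subseteq> V \<inter> U" "W \<noteq> {}" and lm: "l \<noteq> 0" "m \<noteq> 0" "l \<noteq> m"
    and inv: "invertible_on \<O> W (shifted_mult circ E l)" "invertible_on \<O> W (shifted_mult circ E m)"
    using generically_shifted_mult_invertible[of "V \<inter> U"] V U by (metis open_Int)
  have WU: "W \<subseteq> U" using W by auto
  interpret dual_Euler_algebra "\<T> W" "circ W" "nabla W" bracket sc "vrestr W e" "vrestr W E" "star W"
    by (rule dual[OF W(1) WU])
  have "W \<subseteq> GM_domain \<O> U circ E 0" "W \<subseteq> GM_domain \<O> U circ E l" "W \<subseteq> GM_domain \<O> U circ E m"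
    using GM_domain_zero WU W(1) inv unfolding GM_domain_def by blast+
  then have gf: "gm_flat 0" "gm_flat l" "gm_flat m"
    using flat W(1) unfolding GM_flat_iff by blast+
  show thesis
    by (rule that[of W]) (use W flat_consequences[OF gf lm] in blast)+
qed

text \<open>
  Also at points outside \<open>U\<close>, by density.
\<close>
lemma flatness_everywhere:
  assumes flat: "\<forall>l. flat_on \<O> (GM_domain \<O> U circ E l) (GM l)" and V: "open V"
    and T: "X \<in> \<T> V" "Y \<in> \<T> V" "Z \<in> \<T> V"
  shows "curvature V X Y Z = 0" "d_circ V X Y Z = 0" "hessian V X Z = 0"
proof -
  interpret Euler_algebra "\<T> V" "circ V" "nabla V" bracket sc "vrestr V e" "vrestr V E"
    by (rule Euler[OF V])
  have gen: "\<exists>V2. open V2 \<and> V2 \<subseteq> V1 \<and> V2 \<noteq> {} \<and> vrestr V2 (curvature V X Y Z) = 0 \<and>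
      vrestr V2 (d_circ V X Y Z) = 0 \<and> vrestr V2 (hessian V X Z) = 0"
    if V1: "open V1" "V1 \<subseteq> V" "V1 \<noteq> {}" for V1
  proof -
    obtain W where W: "open W" "W \<subseteq> V1" "W \<noteq> {}"
      and z: "\<And>X Y Z. X \<in> \<T> W \<Longrightarrow> Y \<in> \<T> W \<Longrightarrow> Z \<in> \<T> W \<Longrightarrow>
        curvature W X Y Z = 0 \<and> d_circ W X Y Z = 0 \<and> hessian W X Z = 0"
      by (rule generically_flat[OF flat V1(1,3)]) (rule that)
    have WV: "W \<subseteq> V" using W V1 by auto
    note z' = z[OF tangent_vrestr[OF T(1) WV] tangent_vrestr[OF T(2) WV] tangent_vrestr[OF T(3) WV]]
    show ?thesis
      using W z' curvature_restrict(1,2)[OF V W(1) WV T] curvature_restrict(3)[OF V W(1) WV T(1,3) T(3)]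
      by (intro exI[of _ W]) simp
  qed
  have cT: "curvature V X Y Z \<in> \<T> V" using T by (simp add: curv_def)
  show "curvature V X Y Z = 0" by (rule tangent_zero_if_generically_zero[OF V cT]) (use gen in blast)
  show "d_circ V X Y Z = 0" by (rule tangent_zero_if_generically_zero[OF V d_mul_closed[OF T]]) (use gen in blast)
  show "hessian V X Z = 0" by (rule tangent_zero_if_generically_zero[OF V hess_closed[OF T(1,3)]]) (use gen in blast)
qed

lemma pencil_curvature:
  assumes V: "open V" and T: "X \<in> \<T> V" "Y \<in> \<T> V" "Z \<in> \<T> V"
  shows "nabla V X (nabla V Y Z - sc l (circ V Y Z)) - sc l (circ V X (nabla V Y Z - sc l (circ V Y Z)))
      - (nabla V Y (nabla V X Z - sc l (circ V X Z)) - sc l (circ V Y (nabla V X Z - sc l (circ V X Z))))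
      - (nabla V (bracket X Y) Z - sc l (circ V (bracket X Y) Z))
    = curvature V X Y Z - sc l (d_circ V X Y Z)"
proof -
  interpret scaled_torsionless_product "\<T> V" "circ V" "nabla V" bracket sc by (rule scaled[OF V])
  show ?thesis using curv_pencil[OF T, of l] by (simp only:)
qed

lemma dual_pencil_curvature:
  assumes V: "open V" "V \<subseteq> U" and T: "X \<in> \<T> V" "Y \<in> \<T> V" "Z \<in> \<T> V"
  shows "nabla' V X (nabla' V Y Z - sc l (star V Y Z)) - sc l (star V X (nabla' V Y Z - sc l (star V Y Z)))
      - (nabla' V Y (nabla' V X Z - sc l (star V X Z)) - sc l (star V Y (nabla' V X Z - sc l (star V X Z))))
      - (nabla' V (bracket X Y) Z - sc l (star V (bracket X Y) Z))
    = torsionless_product.curv (nabla' V) bracket X Y Z - sc l (torsionless_product.d_mul (star V) (nabla' V) X Y Z)"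
proof -
  interpret dual_Euler_algebra "\<T> V" "circ V" "nabla V" bracket sc "vrestr V e" "vrestr V E" "star V"
    by (rule dual[OF V])
  have "nabla' V = nbs" by (auto simp: nbs_def dual_connection_def fun_eq_iff)
  then show ?thesis using dual.curv_pencil[OF T, of l] by (simp only:)
qed

lemma dual_connection_nbs:
  assumes V: "open V" "V \<subseteq> U"
  shows "nabla' V = dual_Euler_algebra.nbs (nabla V) (vrestr V E) (star V)"
proof -
  interpret dual_Euler_algebra "\<T> V" "circ V" "nabla V" bracket sc "vrestr V e" "vrestr V E" "star V"
    by (rule dual[OF V])
  show ?thesis by (auto simp: nbs_def dual_connection_def fun_eq_iff)
qed

lemma dual_product_on: "product_on \<O> U star"
  unfolding product_on_def binop_on_def
proof (intro conjI allI impI ballI)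
  fix V X Y assume V: "open V" "V \<subseteq> U" and T: "X \<in> \<T> V" "Y \<in> \<T> V"
  interpret dual_Euler_algebra "\<T> V" "circ V" "nabla V" bracket sc "vrestr V e" "vrestr V E" "star V"
    by (rule dual[OF V])
  show "star V X Y \<in> \<T> V" by (rule star_closed[OF T])
  show "star W (vrestr W X) (vrestr W Y) = vrestr W (star V X Y)" if "open W" "W \<subseteq> V" for W
    by (rule star_restrict[OF V that T])
  fix Z f assume Z: "Z \<in> \<T> V" and f: "f \<in> \<O> V"
  show "star V (X + Y) Z = star V X Z + star V Y Z" by (rule dual.mul_add_left[OF T Z])
  show "star V X (Y + Z) = star V X Y + star V X Z" by (rule star_add_right[OF T Z])
  show "star V (smult f X) Y = smult f (star V X Y)" "star V X (smult f Y) = smult f (star V X Y)"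
    by (rule star_smult[OF V T f])+
  show "star V X Y = star V Y X" by (rule star_comm[OF T])
  show "star V (star V X Y) Z = star V X (star V Y Z)" by (rule star_assoc[OF T Z])
qed

lemma dual_connection_on: "connection_on \<O> U nabla'"
  unfolding connection_on_def binop_on_def
proof (intro conjI allI impI ballI)
  fix V X Y assume V: "open V" "V \<subseteq> U" and T: "X \<in> \<T> V" "Y \<in> \<T> V"
  interpret dual_Euler_algebra "\<T> V" "circ V" "nabla V" bracket sc "vrestr V e" "vrestr V E" "star V"
    by (rule dual[OF V])
  note n = dual_connection_nbs[OF V]
  show "nabla' V X Y \<in> \<T> V" unfolding n by (rule nbs_closed[OF T])
  show "nabla' W (vrestr W X) (vrestr W Y) = vrestr W (nabla' V X Y)" if W: "open W" "W \<subseteq> V" for W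
    using nabla_restrict[OF V(1) T W] star_restrict[OF V W T] nabla_restrict[OF V(1) star_closed[OF T] E_closed W] W(2)
    by (simp add: dual_connection_def vrestr_diff)
  fix Z f assume Z: "Z \<in> \<T> V" and f: "f \<in> \<O> V"
  show "nabla' V (X + Y) Z = nabla' V X Z + nabla' V Y Z" unfolding n by (rule dual.nb_add_left[OF T Z])
  show "nabla' V X (Y + Z) = nabla' V X Y + nabla' V X Z" unfolding n by (rule dual.nb_add_right[OF T Z])
  have s: "nabla V (smult f (star V X Y)) (vrestr V E) = smult f (nabla V (star V X Y) (vrestr V E))"
    by (rule nabla_smult(1)[OF V(1) star_closed[OF T] E_closed f])
  show "nabla' V (smult f X) Y = smult f (nabla' V X Y)"
    unfolding dual_connection_def star_smult(1)[OF V T f] nabla_smult(1)[OF V(1) T f] s smult_diff_right ..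
  show "nabla' V X (smult f Y) = smult (X V f) Y + smult f (nabla' V X Y)"
    unfolding dual_connection_def star_smult(2)[OF V T f] nabla_smult(2)[OF V(1) T f] s smult_diff_right
    by (rule add_diff_eq[symmetric])
qed

text \<open>
  The tensors of \<open>\<nabla>\<close> and \<open>\<circ>\<close> vanish by density.  Those of the dual structure only have to vanish on
  \<open>U\<close>, where \<open>\<nabla>*\<close> is the Gauss-Manin connection for \<open>\<lambda> = 0\<close>.
\<close>
lemma biflat_if_GM_flat:
  assumes flat: "\<forall>l. flat_on \<O> (GM_domain \<O> U circ E l) (GM l)"
  shows "biflat_F_structure \<O> U nabla circ e nabla' star E"
proof -
  note zero = flatness_everywhere[OF flat]
  have 1: "flat_F_manifold \<O> UNIV nabla circ e"
    unfolding flat_F_manifold_def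
  proof (intro conjI allI F conn par)
    fix l :: 'k
    show "flat_on \<O> UNIV (\<lambda>V X Y. nabla V X Y - sc l (circ V X Y))"
      unfolding flat_on_def
    proof (intro allI impI ballI)
      fix V X Y Z assume V: "open V" and T: "X \<in> \<T> V" "Y \<in> \<T> V" "Z \<in> \<T> V"
      show "nabla V X (nabla V Y Z - sc l (circ V Y Z)) - sc l (circ V X (nabla V Y Z - sc l (circ V Y Z)))
         - (nabla V Y (nabla V X Z - sc l (circ V X Z)) - sc l (circ V Y (nabla V X Z - sc l (circ V X Z))))
         - (nabla V (bracket X Y) Z - sc l (circ V (bracket X Y) Z)) = 0"
        using pencil_curvature[OF V T, of l] zero(1,2)[OF V T] by (simp only: smult_0 diff_self)
    qed
    show "torsionless_on \<O> UNIV (\<lambda>V X Y. nabla V X Y - sc l (circ V X Y))"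
      unfolding torsionless_on_def
    proof (intro allI impI ballI)
      fix V X Y assume V: "open V" and T: "X \<in> \<T> V" "Y \<in> \<T> V"
      have "circ V X Y = circ V Y X" by (rule circ_laws(3)[OF V T T(1)])
      then show "nabla V X Y - sc l (circ V X Y) - (nabla V Y X - sc l (circ V Y X)) = bracket X Y"
        using tors V T by (simp add: torsionless_on_def)
    qed
  qed
  have flat0: "dual_Euler_algebra.gm_flat (\<T> V) (circ V) (nabla V) bracket sc (vrestr V E) 0"
    if "open V" "V \<subseteq> U" for V
    using GM_flat_iff[THEN iffD1, OF flat[THEN spec, of 0]] that unfolding GM_domain_zero by blast
  have dz: "torsionless_product.curv (nabla' V) bracket X Y Z = 0"
    "torsionless_product.d_mul (star V) (nabla' V) X Y Z = 0"
    if V: "open V" "V \<subseteq> U" and T: "X \<in> \<T> V" "Y \<in> \<T> V" "Z \<in> \<T> V" for V X Y Z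
  proof -
    interpret dual_Euler_algebra "\<T> V" "circ V" "nabla V" bracket sc "vrestr V e" "vrestr V E" "star V"
      by (rule dual[OF V])
    obtain X' Y' where X': "X' \<in> \<T> V" "Y' \<in> \<T> V" "X = circ V (vrestr V E) X'" "Y = circ V (vrestr V E) Y'"
      using E_surj[OF V T(1)] E_surj[OF V T(2)] by (elim exE conjE) (rule that)
    have "gm 0 X' (gm 0 Y' Z) - gm 0 Y' (gm 0 X' Z) - gm 0 (gm_br 0 X' Y') Z = 0"
      using flat0[OF V] X'(1,2) T(3) unfolding gm_flat_def by blast
    then have c: "dual.curv X Y Z = 0"
      unfolding X'(3,4) gm_zero_curv[OF X'(1,2) T(3)] .
    then show "torsionless_product.curv (nabla' V) bracket X Y Z = 0"
      unfolding dual_connection_nbs[OF V] .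
    have "dual.d_mul X Y Z = 0"
      by (rule dual_d_mul_zero[OF zero(1)[OF V(1)] zero(2)[OF V(1)] zero(3)[OF V(1) _ zero_closed] c T])
    then show "torsionless_product.d_mul (star V) (nabla' V) X Y Z = 0"
      unfolding dual_connection_nbs[OF V] .
  qed
  have 2: "flat_F_manifold \<O> U nabla' star (vrestr U E)"
    unfolding flat_F_manifold_def
  proof (intro conjI allI dual_connection_on)
    show "F_manifold \<O> U star (vrestr U E)"
      unfolding F_manifold_def
    proof (intro conjI allI impI ballI dual_product_on)
      show "vrestr U E \<in> \<T> U" by simp
      fix V X assume V: "open V" "V \<subseteq> U" and X: "X \<in> \<T> V"
      interpret dual_Euler_algebra "\<T> V" "circ V" "nabla V" bracket sc "vrestr V e" "vrestr V E" "star V"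
        by (rule dual[OF V])
      show "star V (vrestr V (vrestr U E)) X = X"
        unfolding vrestr_vrestr[OF V(2)] by (rule E_star_unit[OF X])
      fix Y W Z assume T: "Y \<in> \<T> V" "W \<in> \<T> V" "Z \<in> \<T> V"
      have "dual.hm X Y W Z = 0"
        by (rule dual.hm_zero_if_d_mul_zero[OF dz(2)[OF V, unfolded dual_connection_nbs[OF V]] X T])
      then show "bracket (star V X Y) (star V W Z) - star V (bracket (star V X Y) Z) W
          - star V (bracket (star V X Y) W) Z - star V X (bracket Y (star V Z W))
          + star V X (star V (bracket Y Z) W) + star V X (star V (bracket Y W) Z)
          - star V Y (bracket X (star V Z W)) + star V Y (star V (bracket X Z) W)
          + star V Y (star V (bracket X W) Z) = 0"
        unfolding dual.hm_def .
    qed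
    fix l :: 'k
    show "flat_on \<O> U (\<lambda>V X Y. nabla' V X Y - sc l (star V X Y))"
      unfolding flat_on_def
    proof (intro allI impI ballI)
      fix V X Y Z assume V: "open V" "V \<subseteq> U" and T: "X \<in> \<T> V" "Y \<in> \<T> V" "Z \<in> \<T> V"
      show "nabla' V X (nabla' V Y Z - sc l (star V Y Z)) - sc l (star V X (nabla' V Y Z - sc l (star V Y Z)))
         - (nabla' V Y (nabla' V X Z - sc l (star V X Z)) - sc l (star V Y (nabla' V X Z - sc l (star V X Z))))
         - (nabla' V (bracket X Y) Z - sc l (star V (bracket X Y) Z)) = 0"
        using dual_pencil_curvature[OF V T, of l] dz[OF V T] by (simp only: smult_0 diff_self)
    qed
    show "torsionless_on \<O> U (\<lambda>V X Y. nabla' V X Y - sc l (star V X Y))"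
      unfolding torsionless_on_def
    proof (intro allI impI ballI)
      fix V X Y assume V: "open V" "V \<subseteq> U" and T: "X \<in> \<T> V" "Y \<in> \<T> V"
      interpret dual_Euler_algebra "\<T> V" "circ V" "nabla V" bracket sc "vrestr V e" "vrestr V E" "star V"
        by (rule dual[OF V])
      show "nabla' V X Y - sc l (star V X Y) - (nabla' V Y X - sc l (star V Y X)) = bracket X Y"
        using dual.br_eq[OF T] star_comm[OF T] unfolding dual_connection_nbs[OF V] by simp
    qed
  next
    show "parallel_on \<O> U nabla' (vrestr U E)"
      unfolding parallel_on_def
    proof (intro allI impI ballI)
      fix V X assume V: "open V" "V \<subseteq> U" and X: "X \<in> \<T> V"
      interpret dual_Euler_algebra "\<T> V" "circ V" "nabla V" bracket sc "vrestr V e" "vrestr V E" "star V"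
        by (rule dual[OF V])
      show "nabla' V X (vrestr V (vrestr U E)) = 0"
        unfolding vrestr_vrestr[OF V(2)] dual_connection_nbs[OF V] by (rule nbs_E[OF X])
    qed
  qed
  have 3: "nabla V Y (circ V X Z) - nabla V Z (circ V X Y) = nabla' V Y (circ V X Z) - nabla' V Z (circ V X Y)"
    if V: "open V" "V \<subseteq> U" and T: "X \<in> \<T> V" "Y \<in> \<T> V" "Z \<in> \<T> V" for V X Y Z
  proof -
    interpret dual_Euler_algebra "\<T> V" "circ V" "nabla V" bracket sc "vrestr V e" "vrestr V E" "star V"
      by (rule dual[OF V])
    show ?thesis unfolding dual_connection_nbs[OF V] by (rule almost_dual_condition[OF T])
  qed
  show ?thesis
    unfolding biflat_F_structure_def using 1 Eu U E_inv 2 3 by blast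
qed

text \<open>
  The pencils of a bi-flat structure are flat for all parameters; \<open>0\<close> and \<open>1\<close> suffice to separate the
  curvature from the derivative of the product.
\<close>
lemma GM_flat_if_biflat:
  assumes bf: "biflat_F_structure \<O> U nabla circ e nabla' star E"
  shows "flat_on \<O> (GM_domain \<O> U circ E l) (GM l)"
  unfolding GM_flat_iff
proof (intro allI impI)
  fix V assume V: "open V" "V \<subseteq> GM_domain \<O> U circ E l"
  then have VU: "V \<subseteq> U" by (auto simp: GM_domain_def)
  note V' = V(1) VU
  interpret dual_Euler_algebra "\<T> V" "circ V" "nabla V" bracket sc "vrestr V e" "vrestr V E" "star V"
    by (rule dual[OF V'])
  have fl: "flat_on \<O> UNIV (\<lambda>V X Y. nabla V X Y - sc k (circ V X Y))"
    "flat_on \<O> U (\<lambda>V X Y. nabla' V X Y - sc k (star V X Y))" for k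
  proof -
    note b = bf[unfolded biflat_F_structure_def flat_F_manifold_def]
    show "flat_on \<O> UNIV (\<lambda>V X Y. nabla V X Y - sc k (circ V X Y))"
      by (rule b[THEN conjunct1, THEN conjunct2, THEN conjunct2, THEN conjunct1, THEN spec, THEN conjunct1])
    show "flat_on \<O> U (\<lambda>V X Y. nabla' V X Y - sc k (star V X Y))"
      by (rule b[THEN conjunct2, THEN conjunct2, THEN conjunct2, THEN conjunct2, THEN conjunct2, THEN conjunct2,
          THEN conjunct1, THEN conjunct2, THEN conjunct2, THEN conjunct1, THEN spec, THEN conjunct1])
  qed
  have s: "sc 0 W = 0" "sc 1 W = W" for W :: "('m, 'k) vfield"
    by (auto simp: smult_def fun_eq_iff)
  have p: "curvature V X Y Z - sc k (d_circ V X Y Z) = 0"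
    "torsionless_product.curv (nabla' V) bracket X Y Z - sc k (torsionless_product.d_mul (star V) (nabla' V) X Y Z) = 0"
    if T: "X \<in> \<T> V" "Y \<in> \<T> V" "Z \<in> \<T> V" for X Y Z k
    using fl(1)[of k, unfolded flat_on_def, rule_format, OF V(1) subset_UNIV T] pencil_curvature[OF V(1) T, of k]
      fl(2)[of k, unfolded flat_on_def, rule_format, OF V' T] dual_pencil_curvature[OF V' T, of k]
    by (simp_all only:)
  have q: "curvature V X Y Z = 0" "d_circ V X Y Z = 0" "dual.curv X Y Z = 0" "dual.d_mul X Y Z = 0"
    if T: "X \<in> \<T> V" "Y \<in> \<T> V" "Z \<in> \<T> V" for X Y Z
  proof -
    show a: "curvature V X Y Z = 0" using p(1)[OF T, of 0] by (simp only: s diff_zero)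
    show "d_circ V X Y Z = 0" using p(1)[OF T, of 1] by (simp only: s a diff_0 neg_equal_0_iff_equal)
    note p' = p(2)[OF T, unfolded dual_connection_nbs[OF V']]
    show b: "dual.curv X Y Z = 0" using p'[of 0] by (simp only: s diff_zero)
    show "dual.d_mul X Y Z = 0" using p'[of 1] by (simp only: s b diff_0 neg_equal_0_iff_equal)
  qed
  show "gm_flat l" by (rule gm_flat_if_biflat[OF q])
qed

end

theorem theorem3p4:
  fixes reg :: regularity
    and \<O> :: "('m::{t2_space, second_countable_topology}, 'k::{real_normed_field, banach}) func_sheaf"
    and circ nabla :: "('m, 'k) binop"
    and e E :: "('m, 'k) vfield"
    and U :: "'m set"
  assumes "manifold reg TYPE('n::finite) \<O>"
    and "F_manifold \<O> UNIV circ e"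
    and "Euler_field \<O> UNIV circ e E"
    and "connection_on \<O> UNIV nabla"
    and "torsionless_on \<O> UNIV nabla"
    and "parallel_on \<O> UNIV nabla e"
    and "invertible_on \<O> UNIV (\<lambda>V X. nabla V X (vrestr V E))"
    and "open U" and "closure U = UNIV"
    and "invertible_on \<O> U (mult_by circ E)"
  shows "(\<forall>l :: 'k.
            flat_on \<O> (GM_domain \<O> U circ E l) (Gauss_Manin \<O> circ E nabla l) \<and>
            torsionless_on \<O> (GM_domain \<O> U circ E l) (Gauss_Manin \<O> circ E nabla l))
     \<longleftrightarrow> biflat_F_structure \<O> U nabla circ e
           (dual_connection \<O> circ E nabla) (dual_product \<O> circ E) E"
proof -
  interpret Gauss_Manin_setting reg "TYPE('n)" \<O> circ nabla e E U
    by unfold_locales (rule assms)+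
  show ?thesis
    using biflat_if_GM_flat GM_flat_if_biflat GM_torsionless by blast
qed

end
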